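(* Let $k\ge2$ be an integer and, for $1\le i\le k$, let $$x_{2k,i}(q):=\sum_{n_1,\dots,n_{k-1}\ge0}\frac{q^{N_1^2+\cdots+N_{k-1}^2+N_i+\cdots+N_{k-1}}}{(q;q)_{n_1}\cdots(q;q)_{n_{k-2}}(q^2;q^2)_{n_{k-1}}},$$ where $N_j=n_j+\cdots+n_{k-1}$ for $j\le k-1$ and $N_k=0$ (so for $i=k$ there is no linear term in the exponent). Let $s_k$ be the largest even number less than $k$, $t_k$ the largest odd number less than $k$, and $\widetilde t_k$ the largest odd number not exceeding $k$. For $\mathrm{Im}\,\tau>0$, $q=e^{2\pi i\tau}$, define $$X_{2k}^{(0)}(\tau):=q^{-\frac1{24}}\Big(x_{2k,k}(q),q^{\frac{2^2}{4k}}x_{2k,k-2}(q),\dots,q^{\frac{s_k^2}{4k}}x_{2k,k-s_k}(q)\Big)^{\mathrm T},$$ $$X_{2k}^{(1)}(\tau):=q^{-\frac1{24}}\Big(q^{\frac1{4k}}x_{2k,k-1}(q),q^{\frac{3^2}{4k}}x_{2k,k-3}(q),\dots,q^{\frac{t_k^2}{4k}}x_{2k,k-t_k}(q)\Big)^{\mathrm T}.$$ Then $$X_{2k}^{(0)}(\tau+1)=e^{-\frac1{12}\pi i}\,\mathrm{diag}\big(1,e^{\frac{2^2}{2k}\pi i},\dots,e^{\frac{s_k^2}{2k}\pi i}\big)X_{2k}^{(0)}(\tau),$$ $$X_{2k}^{(1)}(\tau+1)=e^{-\frac1{12}\pi i}\,\mathrm{diag}\big(e^{\frac{1}{2k}\pi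 i},e^{\frac{3^2}{2k}\pi i},\dots,e^{\frac{t_k^2}{2k}\pi i}\big)X_{2k}^{(1)}(\tau),$$ $$X_{2k}^{(0)}\Big(\frac{\tau}{4\tau+1}\Big)=\frac4k\,e^{\frac{\pi i}{3}}\,B_k\widetilde\Lambda_kC_k\,X_{2k}^{(0)}(\tau),$$ $$X_{2k}^{(1)}\Big(\frac{\tau}{4\tau+1}\Big)=\frac4k\,e^{\frac{\pi i}{3}}\,A_k\Lambda_k^{-1}A_k\,X_{2k}^{(1)}(\tau),$$ with the matrices $A_k,\Lambda_k,\widetilde\Lambda_k,B_k,C_k$ given in the context. As a consequence, both $X_{2k}^{(0)}(\tau)$ and $X_{2k}^{(1)}(\tau)$ are vector-valued modular functions on $\Gamma_0(4)$.
   Context: Matrices: $A_k=(a_{ij})$ is $\lfloor k/2\rfloor\times\lfloor k/2\rfloor$ with $a_{ij}=\cos\frac{(2i-1)(2j-1)\pi}{2k}$; $\Lambda_k=\mathrm{diag}(e^{\frac{1}{2k}\pi i},e^{\frac{9}{2k}\pi i},\dots,e^{\frac{t_k^2}{2k}\pi i})$; $\widetilde\Lambda_k=\mathrm{diag}(e^{-\frac1{2k}\pi i},e^{-\frac9{2k}\pi i},\dots,e^{-\frac{\widetilde t_k^{\,2}}{2k}\pi i})$; $B_k=(b_{ij})$ and $C_k=(c_{ij})$ are $\lfloor (k+1)/2\rfloor\times\lfloor (k+1)/2\rfloor$ with $b_{ij}=\cos\frac{(i-1)(2j-1)\pi}{k}$ when $k$ is even, and when $k$ is odd $b_{ij}=\cos\frac{(i-1)(2j-1)\pi}{k}$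 for $1\le j\le\frac{k-1}2$ and $b_{ij}=\frac12\cos(i-1)\pi$ for $j=\frac{k+1}{2}$; $c_{ij}=\frac12$ for $j=1$ and $c_{ij}=\cos\frac{(2i-1)(j-1)\pi}{k}$ for $2\le j\le\lfloor\frac{k+1}2\rfloor$. Notation: for rational $r$, $q^r:=e^{2\pi i r\tau}$; $(a;q)_n=\prod_{l=0}^{n-1}(1-aq^l)$, $(a;q)_\infty=\prod_{l\ge0}(1-aq^l)$, $(a_1,\dots,a_m;q)_\infty=\prod_i(a_i;q)_\infty$. By Bressoud's known identity, $x_{2k,i}(q)=\frac{(q^i,q^{2k-i},q^{2k};q^{2k})_\infty}{(q;q)_\infty}$. $\Gamma_0(N)$ is the group of matrices in $\mathrm{SL}(2,\mathbb Z)$ whose lower-left entry is divisible by $N$, acting on the upper half plane by Möbius transformations. A (column) vector-valued function $X$ on the upper half plane is called a vector-valued modular function on $\Gamma_0(N)$ if for every $\gamma\in\Gamma_0(N)$ there is a constant complex matrix $\rho(\gamma)$ with $X(\gamma\tau)=\rho(\gamma)X(\tau)$ for all $\tau$. *)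

theory Defs
  imports
    "HOL-Analysis.Infinite_Sum"
    "HOL-Analysis.Complex_Transcendental"
    "HOL-Library.FuncSet"
    "Jordan_Normal_Form.Determinant"
    "Jordan_Normal_Form.Gauss_Jordan_Elimination"
begin

definition qpow :: "real \<Rightarrow> complex \<Rightarrow> complex" where
  "qpow r \<tau> = exp (2 * of_real pi * \<i> * of_real r * \<tau>)"

definition qpoch :: "complex \<Rightarrow> complex \<Rightarrow> nat \<Rightarrow> complex" where
  "qpoch a q n = (\<Prod>l<n. 1 - a * q ^ l)"

text \<open>A tuple \<open>(n\<^sub>1, \<dots>, n\<^sub>k\<^sub>-\<^sub>1)\<close> is an extensional function on \<open>{1..k-1}\<close>. For \<open>j = k\<close> the
  sum below is empty, so \<open>N\<^sub>k = 0\<close>.\<close>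

definition tail_sum :: "nat \<Rightarrow> (nat \<Rightarrow> nat) \<Rightarrow> nat \<Rightarrow> nat" where
  "tail_sum k n j = (\<Sum>m=j..k-1. n m)"

definition x2k :: "nat \<Rightarrow> nat \<Rightarrow> complex \<Rightarrow> complex" where
  "x2k k i q = (\<Sum>\<^sub>\<infinity>n \<in> {1..k-1} \<rightarrow>\<^sub>E UNIV.
     q ^ ((\<Sum>j=1..k-1. (tail_sum k n j)\<^sup>2) + (\<Sum>j=i..k-1. tail_sum k n j)) /
     ((\<Prod>m=1..k-2. qpoch q q (n m)) * qpoch (q\<^sup>2) (q\<^sup>2) (n (k-1))))"

definition s_idx :: "nat \<Rightarrow> nat" where
  "s_idx k = Max {m. even m \<and> m < k}"

definition t_idx :: "nat \<Rightarrow> nat" where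
  "t_idx k = Max {m. odd m \<and> m < k}"

definition t'_idx :: "nat \<Rightarrow> nat" where
  "t'_idx k = Max {m. odd m \<and> m \<le> k}"

text \<open>Lengths of the progressions \<open>0, 2, \<dots>, s\<^sub>k\<close> and \<open>1, 3, \<dots>, t\<^sub>k\<close>.\<close>

abbreviation dim0 :: "nat \<Rightarrow> nat" where
  "dim0 k \<equiv> s_idx k div 2 + 1"

abbreviation dim1 :: "nat \<Rightarrow> nat" where
  "dim1 k \<equiv> (t_idx k + 1) div 2"

definition X0 :: "nat \<Rightarrow> complex \<Rightarrow> complex vec" where
  "X0 k \<tau> = qpow (- 1 / 24) \<tau> \<cdot>\<^sub>v
     Matrix.vec (dim0 k) (\<lambda>j. qpow ((2 * real j)\<^sup>2 / (4 * real k)) \<tau> * x2k k (k - 2 * j) (qpow 1 \<tau>))"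

definition X1 :: "nat \<Rightarrow> complex \<Rightarrow> complex vec" where
  "X1 k \<tau> = qpow (- 1 / 24) \<tau> \<cdot>\<^sub>v
     Matrix.vec (dim1 k) (\<lambda>j. qpow ((2 * real j + 1)\<^sup>2 / (4 * real k)) \<tau> * x2k k (k - (2 * j + 1)) (qpow 1 \<tau>))"

text \<open>Square matrix with entries indexed from 1 (whereas \<^const>\<open>Matrix.mat\<close> indexes from 0).\<close>

definition mat1 :: "nat \<Rightarrow> (nat \<Rightarrow> nat \<Rightarrow> real) \<Rightarrow> complex mat" where
  "mat1 n f = Matrix.mat n n (\<lambda>(i, j). of_real (f (i + 1) (j + 1)))"

definition A_mat :: "nat \<Rightarrow> complex mat" where
  "A_mat k = mat1 (k div 2) (\<lambda>i j. cos ((2 * real i - 1) * (2 * real j - 1) * pi / (2 * real k)))"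

definition B_mat :: "nat \<Rightarrow> complex mat" where
  "B_mat k = mat1 ((k + 1) div 2) (\<lambda>i j.
     if odd k \<and> j = (k + 1) div 2 then 1 / 2 * cos ((real i - 1) * pi)
     else cos ((real i - 1) * (2 * real j - 1) * pi / real k))"

definition C_mat :: "nat \<Rightarrow> complex mat" where
  "C_mat k = mat1 ((k + 1) div 2) (\<lambda>i j.
     if j = 1 then 1 / 2 else cos ((2 * real i - 1) * (real j - 1) * pi / real k))"

definition Lambda_mat :: "nat \<Rightarrow> complex mat" where
  "Lambda_mat k = mat_diag (dim1 k) (\<lambda>j. exp (of_real ((2 * real j + 1)\<^sup>2 / (2 * real k) * pi) * \<i>))"

definition Lambda'_mat :: "nat \<Rightarrow> complex mat" where
  "Lambda'_mat k = mat_diag ((t'_idx k + 1) div 2)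
     (\<lambda>j. exp (of_real (- ((2 * real j + 1)\<^sup>2) / (2 * real k) * pi) * \<i>))"

definition Gamma0 :: "nat \<Rightarrow> int mat set" where
  "Gamma0 N = {\<gamma> \<in> carrier_mat 2 2. Determinant.det \<gamma> = 1 \<and> int N dvd \<gamma> $$ (1, 0)}"

definition moeb_act :: "int mat \<Rightarrow> complex \<Rightarrow> complex" where
  "moeb_act \<gamma> = moebius (of_int (\<gamma> $$ (0, 0))) (of_int (\<gamma> $$ (0, 1)))
                        (of_int (\<gamma> $$ (1, 0))) (of_int (\<gamma> $$ (1, 1)))"

definition vv_modular_function :: "nat \<Rightarrow> nat \<Rightarrow> (complex \<Rightarrow> complex vec) \<Rightarrow> bool" where
  "vv_modular_function N d X \<longleftrightarrow>
     (\<forall>\<tau>. Im \<tau> > 0 \<longrightarrow> X \<tau> \<in> carrier_vec d) \<and>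
     (\<forall>\<gamma>\<in>Gamma0 N. \<exists>\<rho>\<in>carrier_mat d d. \<forall>\<tau>. Im \<tau> > 0 \<longrightarrow> X (moeb_act \<gamma> \<tau>) = \<rho> *\<^sub>v X \<tau>)"

text \<open>The products of matrices and vectors in the transformation laws are well-dimensioned.\<close>

lemma s_idx_eq: "k \<ge> 1 \<Longrightarrow> s_idx k = 2 * ((k - 1) div 2)"
  unfolding s_idx_def by (rule Max_eqI) (auto elim!: evenE)

lemma t_idx_eq: "k \<ge> 2 \<Longrightarrow> t_idx k = 2 * (k div 2) - 1"
  unfolding t_idx_def by (rule Max_eqI) (auto elim!: oddE, presburger+)

lemma t'_idx_eq: "k \<ge> 1 \<Longrightarrow> t'_idx k = 2 * ((k + 1) div 2) - 1"
  unfolding t'_idx_def by (rule Max_eqI) (auto elim!: oddE, presburger+)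

lemma dim0_eq: "k \<ge> 2 \<Longrightarrow> dim0 k = (k + 1) div 2"
  by (simp add: s_idx_eq)

lemma dim1_eq: "k \<ge> 2 \<Longrightarrow> dim1 k = k div 2"
  by (simp add: t_idx_eq)

lemma dim'_eq: "k \<ge> 2 \<Longrightarrow> (t'_idx k + 1) div 2 = (k + 1) div 2"
  by (simp add: t'_idx_eq)

text \<open>\<^const>\<open>mat_inverse\<close> returns an option; it is \<^const>\<open>Some\<close> on the invertible matrix \<open>\<Lambda>\<^sub>k\<close>.\<close>

lemma mat_inverse_Lambda:
  "mat_inverse (Lambda_mat k) =
     Some (mat_diag (dim1 k) (\<lambda>j. exp (- (of_real ((2 * real j + 1)\<^sup>2 / (2 * real k) * pi) * \<i>))))"
  (is "_ = Some ?D")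
proof -
  let ?L = "Lambda_mat k" and ?n = "dim1 k"
  have L: "?L \<in> carrier_mat ?n ?n" and D: "?D \<in> carrier_mat ?n ?n"
    by (auto simp: Lambda_mat_def mat_diag_def)
  have LD: "?L * ?D = 1\<^sub>m ?n" and DL: "?D * ?L = 1\<^sub>m ?n"
    by (simp_all add: Lambda_mat_def mat_diag_diag flip: exp_add mat_diag_one)
  then have "?L \<in> Units (ring_mat TYPE(complex) ?n ())"
    using L D by (auto simp: Units_def ring_mat_def)
  then obtain E where E: "mat_inverse ?L = Some E"
    using mat_inverse(1)[OF L, of "()"] by (cases "mat_inverse ?L") auto
  have EL: "E * ?L = 1\<^sub>m ?n" "E \<in> carrier_mat ?n ?n"
    using mat_inverse(2)[OF L E] by auto
  have "E = E * (?L * ?D)" using LD EL(2) by simp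
  also have "\<dots> = ?D"
    unfolding assoc_mult_mat[OF EL(2) L D, symmetric] EL(1) by (rule left_mult_one_mat[OF D])
  finally show ?thesis using E by simp
qed

end

theory Submission
  imports Defs "HOL-Complex_Analysis.Conformal_Mappings" "HOL-Probability.Characteristic_Functions"
begin

text \<open>Iterating Bailey's lemma, with bilateral sums in place of Bailey pairs, gives
  \<open>P(q) x\<^sub>2\<^sub>k\<^sub>,\<^sub>i(q) = \<Sum>\<^sub>n (-1)\<^sup>n q^(k n\<^sup>2 + (k - i) n)\<close>, where \<open>P(q) = \<Sum>\<^sub>n (-1)\<^sup>n q^(n (3 n - 1) / 2)\<close> is nonzero;
  neither the product form nor the Jacobi triple product is needed. So the components of the two
  vectors are quotients \<open>\<theta>\<^sub>r / \<eta>\<close> with \<open>\<theta>\<^sub>r(\<tau>) = \<Sum>\<^sub>n (-1)\<^sup>n q^((2 k n + r)\<^sup>2 / (4 k))\<close>.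
  Poisson summation for the Gaussian transforms theta series with periodic coefficients under
  \<open>\<tau> \<mapsto> -1/\<tau>\<close> into theta series whose coefficients are the finite cosine transforms. Both \<open>\<theta>\<^sub>r\<close> and \<open>\<eta>\<close>
  have weight \<open>1/2\<close>, hence the square roots cancel. As \<open>\<tau> / (4 m \<tau> + 1) = -1 / (-1/\<tau> - 4 m)\<close>, two
  such transforms give the matrices, after the sums over residues are folded by the symmetries
  \<open>r \<mapsto> -r\<close> and \<open>r \<mapsto> r + 2 k\<close> of \<open>\<theta>\<^sub>r\<close>. Finally \<open>\<Gamma>\<^sub>0(4)\<close> is generated by \<open>-1\<close>, \<open>\<tau> \<mapsto> \<tau> + 1\<close> and
  \<open>\<tau> \<mapsto> \<tau> / (4 \<tau> + 1)\<close>.\<close>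

section \<open>Bailey chains\<close>

text \<open>Summing over all integers keeps every \<alpha> a single term (-1)^n q^(quadratic), so
  that changing the parameter from q to 1, which is needed where the linear terms N_i + ... stop,
  reduces to an antisymmetry under n -> -n-1. The limits of the nested sum and of the bilateral sum
  differ by one factor 1/(q;q)_infinity, whose inverse is the series P, by the same Bailey step
  applied to the unit pair. A single inversion leads out of the family of the theta_r: theta_r is
  taken at 2 \<tau>, and 2 (-1/\<sigma>) = -1/(\<sigma>/2) yields a cosine series over odd j at
  \<sigma>/2. Translating \<sigma> by -4 m multiplies its coefficients by exp (-pi \<i> m j^2 / (2
  k)). This phase has period 2 k in j, which keeps even and odd r apart, hence the two vectors; the
  support on odd j is what lets the second inversion return to the theta_r. All laws are established
  for arbitrary integral powers of the generators, so no representing matrix has to be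
  inverted.\<close>

lemma infsum_int_shift: "(\<Sum>\<^sub>\<infinity>n::int. f (n + c)) = (\<Sum>\<^sub>\<infinity>n. f n)"
proof -
  have "bij_betw (\<lambda>n::int. n + c) UNIV UNIV"
    by (rule bij_betwI[where g = "\<lambda>n. n - c"]) auto
  from infsum_reindex_bij_betw[OF this] show ?thesis .
qed

lemma infsum_int_reflect: "(\<Sum>\<^sub>\<infinity>n::int. f (c - n)) = (\<Sum>\<^sub>\<infinity>n. f n)"
proof -
  have "bij_betw (\<lambda>n::int. c - n) UNIV UNIV"
    by (rule bij_betwI[where g = "\<lambda>n. c - n"]) auto
  from infsum_reindex_bij_betw[OF this] show ?thesis .
qed

lemma summable_on_bounded_support:
  fixes f :: "int \<Rightarrow> 'a::real_normed_vector"
  assumes "\<And>n. n < a \<Longrightarrow> f n = 0" "\<And>n. n > b \<Longrightarrow> f n = 0"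
  shows "f summable_on UNIV"
proof -
  have "f summable_on {a..b}" by simp
  also have "f summable_on {a..b} \<longleftrightarrow> f summable_on UNIV"
    using assms by (intro summable_on_cong_neutral) (auto simp: not_le)
  finally show ?thesis .
qed

lemma infsum_bounded_support:
  fixes f :: "int \<Rightarrow> 'a::real_normed_vector"
  assumes "\<And>n. n < a \<Longrightarrow> f n = 0" "\<And>n. n > b \<Longrightarrow> f n = 0"
  shows "(\<Sum>\<^sub>\<infinity>n. f n) = (\<Sum>n=a..b. f n)"
proof -
  have "(\<Sum>\<^sub>\<infinity>n. f n) = infsum f {a..b}"
    using assms by (intro infsum_cong_neutral) (auto simp: not_le)
  then show ?thesis by simp
qed

definition tri :: "int \<Rightarrow> int" where "tri n = n * (n - 1) div 2"

lemma two_tri: "2 * tri n = n * (n - 1)"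
  unfolding tri_def by simp

lemma tri_simps: "tri (n + 1) = tri n + n" "tri (1 - n) = tri n"
proof -
  have "2 * tri (n + 1) = 2 * (tri n + n)" "2 * tri (1 - n) = 2 * tri n"
    using two_tri[of n] two_tri[of "n+1"] two_tri[of "1-n"] by (simp_all add: algebra_simps)
  then show "tri (n + 1) = tri n + n" "tri (1 - n) = tri n" by simp_all
qed

lemma tri_nonneg: "tri n \<ge> 0"
proof -
  have "n * (n - 1) \<ge> 0" by (cases "n \<ge> 1") (auto intro: mult_nonneg_nonneg mult_nonpos_nonpos)
  then show ?thesis unfolding tri_def by simp
qed

abbreviation sgn_pow :: "int \<Rightarrow> complex" where
  "sgn_pow n \<equiv> (-1) powi n"

lemma sgn_pow_simps: "sgn_pow (n + 1) = - sgn_pow n" "sgn_pow (n - 1) = - sgn_pow n"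
  "sgn_pow (- n) = sgn_pow n"
  by (simp_all add: power_int_add power_int_diff power_int_minus power_int_minus_left)

section \<open>Reciprocal q-factorials and the finite q-Vandermonde sum\<close>

locale nome =
  fixes q :: complex
  assumes q_nz: "q \<noteq> 0" and q_lt_1: "norm q < 1"
begin

text \<open>The convention 1/(q;q)_m = 0 for m < 0 gives the bilateral sums below finite support and
  frees shifts and reflections of the summation index from boundary terms.\<close>

definition rq :: "int \<Rightarrow> complex" where
  "rq m = (if m < 0 then 0 else 1 / qpoch q q (nat m))"

lemma one_minus_power_nz: "n > 0 \<Longrightarrow> 1 - q ^ n \<noteq> 0"
proof
  assume "n > 0" "1 - q ^ n = 0"
  then have "norm (q ^ n) = 1" by simp
  moreover have "norm q ^ n < 1" using q_lt_1 \<open>n > 0\<close> by (simp add: power_less_one_iff)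
  ultimately show False by (simp add: norm_power)
qed

lemma rq_neg: "m < 0 \<Longrightarrow> rq m = 0" and rq_0 [simp]: "rq 0 = 1"
  and rq_nat: "rq (int n) = 1 / qpoch q q n"
  by (simp_all add: rq_def qpoch_def)

text \<open>At m = 0 the factor 1 - q^0 vanishes together with rq (-1), so the recurrence has no
  side condition; every splitting of terms below rests on it.\<close>

lemma rq_rec: "(1 - q powi m) * rq m = rq (m - 1)"
proof -
  consider "m < 0" | "m = 0" | n where "m = int (Suc n)"
    by (metis nat_0_iff nat_eq_iff2 not_less not0_implies_Suc of_nat_0)
  then show ?thesis
  proof cases
    case 3
    have "1 - q ^ Suc n \<noteq> 0" by (rule one_minus_power_nz) simp
    moreover have "qpoch q q (Suc n) = qpoch q q n * (1 - q ^ Suc n)"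
      by (simp add: qpoch_def)
    moreover have "q powi m = q ^ Suc n" unfolding 3 by (rule power_int_of_nat)
    moreover have "rq m = 1 / qpoch q q (Suc n)" unfolding 3 by (rule rq_nat)
    moreover have "rq (m - 1) = 1 / qpoch q q n" unfolding 3 using rq_nat[of n] by simp
    ultimately show ?thesis by simp
  qed (simp_all add: rq_neg)
qed

lemma powi_mult: "q powi a * q powi b = q powi (a + b)"
  using q_nz by (simp add: power_int_add)

lemma powi_mult': "q powi a * (q powi b * c) = q powi (a + b) * c"
  using q_nz by (simp add: power_int_add)

definition vand :: "int \<Rightarrow> int \<Rightarrow> int \<Rightarrow> complex" where
  "vand A b t = q powi (t\<^sup>2 + b * t) * rq (A - t) * rq t * rq (t + b)"

lemma vand_support: "t < 0 \<Longrightarrow> vand A b t = 0" "t > A \<Longrightarrow> vand A b t = 0"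
  by (simp_all add: vand_def rq_neg)

text \<open>Induction on A with b free, because the second half of the splitting reappears as the
  sum for b + 1, shifted by one in t. This is the q-Chu-Vandermonde identity in the form that
  evaluates the inner sum of Bailey's lemma.\<close>

lemma q_Vandermonde: "(\<Sum>\<^sub>\<infinity>t. vand A b t) = rq A * rq (A + b)"
proof (cases "A < 0")
  case True
  then have "vand A b t = 0" for t by (cases "t < 0") (auto intro: vand_support)
  then show ?thesis using True by (simp add: rq_neg)
next
  case False
  then obtain n where n: "A = int n" by (metis nat_eq_iff2 not_less)
  have "(\<Sum>\<^sub>\<infinity>t. vand (int n) b t) = rq (int n) * rq (int n + b)"
  proof (induction n arbitrary: b)
    case 0
    have "(\<Sum>\<^sub>\<infinity>t. vand (int 0) b t) = (\<Sum>t=0..0. vand (int 0) b t)"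
      by (rule infsum_bounded_support) (auto intro: vand_support)
    then show ?case by (simp add: vand_def)
  next
    case (Suc n)
    let ?A = "int (Suc n)"
    \<comment> \<open>1 - q^A = (1 - q^(A-t)) + q^(A-t) (1 - q^t): by \<open>rq_rec\<close> the
      first part lowers A - t, the second lowers t.\<close>
    have split: "(1 - q powi ?A) * vand ?A b t
        = vand (int n) b t + q powi (?A + b) * vand (int n) (b + 1) (t - 1)" for t
    proof -
      have e: "q powi ?A = q powi (?A - t) * q powi t" using powi_mult[of "?A - t" t] by simp
      have "(1 - q powi ?A) * vand ?A b t
         = q powi (t\<^sup>2 + b * t) * ((1 - q powi (?A - t)) * rq (?A - t)) * rq t * rq (t + b)
         + q powi (t\<^sup>2 + b * t) * q powi (?A - t) * rq (?A - t) * ((1 - q powi t) * rq t) * rq (t + b)"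
        unfolding vand_def e by (simp only: algebra_simps) simp
      also have "\<dots> = q powi (t\<^sup>2 + b * t) * rq (int n - t) * rq t * rq (t + b)
         + q powi (t\<^sup>2 + b * t) * q powi (?A - t) * rq (?A - t) * rq (t - 1) * rq (t + b)"
        unfolding rq_rec by (simp add: algebra_simps)
      also have "q powi (t\<^sup>2 + b * t) * q powi (?A - t)
          = q powi (?A + b) * q powi ((t - 1)\<^sup>2 + (b + 1) * (t - 1))"
        unfolding powi_mult by (rule arg_cong[where f = "\<lambda>x. q powi x"])
          (simp add: power2_eq_square algebra_simps)
      finally have "(1 - q powi ?A) * vand ?A b t = q powi (t\<^sup>2 + b * t) * rq (int n - t) * rq t * rq (t + b)
        + q powi (?A + b) * q powi ((t - 1)\<^sup>2 + (b + 1) * (t - 1)) * rq (?A - t) * rq (t - 1) * rq (t + b)" .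
      moreover have "int n - (t - 1) = ?A - t" "t - 1 + (b + 1) = t + b" by simp_all
      ultimately show ?thesis by (simp only: vand_def mult.assoc)
    qed
    have sm: "(\<lambda>t. vand A b t) summable_on UNIV" for A b
      by (rule summable_on_bounded_support) (auto intro: vand_support)
    have sm': "(\<lambda>t. vand A b (t - 1)) summable_on UNIV" for A b
      by (rule summable_on_bounded_support[of 1 _ "A+1"]) (auto intro: vand_support)
    have sh: "(\<Sum>\<^sub>\<infinity>t. vand (int n) (b + 1) (t - 1)) = rq (int n) * rq (?A + b)"
      using infsum_int_shift[of "vand (int n) (b+1)" "-1"] Suc.IH[of "b+1"] by (simp add: algebra_simps)
    have "(1 - q powi ?A) * (\<Sum>\<^sub>\<infinity>t. vand ?A b t) = (\<Sum>\<^sub>\<infinity>t. (1 - q powi ?A) * vand ?A b t)"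
      by (rule infsum_cmult_right'[symmetric])
    also have "\<dots> = (\<Sum>\<^sub>\<infinity>t. vand (int n) b t) + (\<Sum>\<^sub>\<infinity>t. q powi (?A + b) * vand (int n) (b + 1) (t - 1))"
      unfolding split by (intro infsum_add sm summable_on_cmult_right sm')
    also have "\<dots> = rq (int n) * (rq (int n + b) + q powi (?A + b) * rq (?A + b))"
      using sh by (simp add: infsum_cmult_right' Suc.IH algebra_simps)
    also have "rq (int n + b) = (1 - q powi (?A + b)) * rq (?A + b)"
      unfolding rq_rec by (simp add: algebra_simps)
    also have "rq (int n) = (1 - q powi ?A) * rq ?A" unfolding rq_rec by simp
    finally have "(1 - q powi ?A) * (\<Sum>\<^sub>\<infinity>t. vand ?A b t) = (1 - q powi ?A) * (rq ?A * rq (?A + b))"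
      by (simp add: algebra_simps)
    moreover have "1 - q powi ?A \<noteq> 0"
      unfolding power_int_of_nat by (rule one_minus_power_nz) simp
    ultimately show ?case using mult_left_cancel by blast
  qed
  then show ?thesis unfolding n .
qed

text \<open>In Bailey's terminology, \<open>(\<alpha>, \<lambda>N. bailey e \<alpha> N)\<close> is a bilateral Bailey pair relative to \<open>1\<close>
  if \<open>e = 0\<close>, and (up to a factor \<open>1 - q\<close>) relative to \<open>q\<close> if \<open>e = 1\<close>.\<close>

definition bailey :: "int \<Rightarrow> (int \<Rightarrow> complex) \<Rightarrow> int \<Rightarrow> complex" where
  "bailey e \<alpha> N = (\<Sum>\<^sub>\<infinity>n. \<alpha> n * rq (N - n) * rq (N + n + e))"

text \<open>One window -M-1..M serves every N up to M, so that sums over N can be interchanged with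
  it; the extra index -M-1 is reached when e = 1.\<close>

lemma bailey_eq_sum:
  assumes "e \<le> 1" "N \<le> M"
  shows "bailey e \<alpha> N = (\<Sum>n=-M-1..M. \<alpha> n * rq (N - n) * rq (N + n + e))"
  unfolding bailey_def using assms by (intro infsum_bounded_support) (auto simp: rq_neg)

lemma bailey_summable:
  "(\<lambda>n. \<alpha> n * rq (N - n) * rq (N + n + e)) summable_on UNIV"
  by (rule summable_on_bounded_support[of "-N-e" _ N]) (auto simp: rq_neg)

text \<open>After the interchange of summations, t = s - n turns the inner sum into the
  q-Vandermonde sum with A = N - n and b = 2 n + e, because s^2 + e s = n^2 + e n + t^2 + b t. This
  is Bailey's lemma with both free parameters sent to infinity.\<close>

lemma bailey_step:
  assumes e: "0 \<le> e" "e \<le> 1" and N: "N \<ge> 0"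
  shows "(\<Sum>s=0..N. q powi (s\<^sup>2 + e * s) * rq (N - s) * bailey e \<alpha> s)
       = bailey e (\<lambda>n. q powi (n\<^sup>2 + e * n) * \<alpha> n) N"
proof -
  have inner: "(\<Sum>s=0..N. q powi (s\<^sup>2 + e * s) * rq (N - s) * rq (s - n) * rq (s + n + e))
     = q powi (n\<^sup>2 + e * n) * (rq (N - n) * rq (N + n + e))" for n
  proof -
    have "(\<Sum>s=0..N. q powi (s\<^sup>2 + e * s) * rq (N - s) * rq (s - n) * rq (s + n + e))
      = (\<Sum>\<^sub>\<infinity>s. q powi (s\<^sup>2 + e * s) * rq (N - s) * rq (s - n) * rq (s + n + e))"
    proof (rule infsum_bounded_support[symmetric])
      fix s :: int assume "s < 0"
      \<comment> \<open>The two arguments add up to 2 s + e, which is negative for s < 0 and e \<le>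
        1.\<close>
      then have "s - n < 0 \<or> s + n + e < 0" using e by linarith
      then show "q powi (s\<^sup>2 + e * s) * rq (N - s) * rq (s - n) * rq (s + n + e) = 0"
        by (auto simp: rq_neg)
    qed (auto simp: rq_neg)
    also have "\<dots> = (\<Sum>\<^sub>\<infinity>s. q powi (n\<^sup>2 + e * n) * vand (N - n) (2 * n + e) (s - n))"
    proof (rule infsum_cong)
      fix s
      have "q powi (s\<^sup>2 + e * s) = q powi (n\<^sup>2 + e * n) * q powi ((s - n)\<^sup>2 + (2 * n + e) * (s - n))"
        unfolding powi_mult by (rule arg_cong[where f = "\<lambda>x. q powi x"])
          (simp add: power2_eq_square algebra_simps)
      then show "q powi (s\<^sup>2 + e * s) * rq (N - s) * rq (s - n) * rq (s + n + e)
         = q powi (n\<^sup>2 + e * n) * vand (N - n) (2 * n + e) (s - n)"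
        by (simp add: vand_def algebra_simps)
    qed
    also have "\<dots> = q powi (n\<^sup>2 + e * n) * (\<Sum>\<^sub>\<infinity>s. vand (N - n) (2 * n + e) (s - n))"
      by (rule infsum_cmult_right')
    also have "(\<Sum>\<^sub>\<infinity>s. vand (N - n) (2 * n + e) (s - n)) = rq (N - n) * rq (N + n + e)"
      using infsum_int_shift[of "vand (N - n) (2 * n + e)" "-n"] q_Vandermonde[of "N - n" "2 * n + e"]
      by (simp add: algebra_simps)
    finally show ?thesis .
  qed
  have "(\<Sum>s=0..N. q powi (s\<^sup>2 + e * s) * rq (N - s) * bailey e \<alpha> s)
     = (\<Sum>s=0..N. \<Sum>n=-N-1..N. \<alpha> n * (q powi (s\<^sup>2 + e * s) * rq (N - s) * rq (s - n) * rq (s + n + e)))"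
    by (intro sum.cong refl)
      (subst bailey_eq_sum[of e _ N], auto simp: e sum_distrib_left algebra_simps)
  also have "\<dots> = (\<Sum>n=-N-1..N. \<alpha> n * (q powi (n\<^sup>2 + e * n) * (rq (N - n) * rq (N + n + e))))"
    by (subst sum.swap) (simp add: sum_distrib_left[symmetric] inner)
  also have "\<dots> = bailey e (\<lambda>n. q powi (n\<^sup>2 + e * n) * \<alpha> n) N"
    by (subst bailey_eq_sum[of e _ N]) (auto simp: e algebra_simps)
  finally show ?thesis .
qed

text \<open>By \<open>rq_rec\<close> the terms of the two sides differ by \<open>?g\<close>. The
  reflection n -> -1-n exchanges the two \<open>rq\<close> factors, and by the hypothesis it changes
  the sign of \<open>?g\<close>, whose sum is therefore 0. This is the passage between the
  parameters 1 and q.\<close>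

lemma bailey_transfer:
  assumes d: "\<And>n. \<alpha> (-n-1) = - \<alpha> n * q powi (2 * n + 1)"
  shows "bailey 0 \<alpha> N = bailey 1 \<alpha> N"
proof -
  let ?g = "\<lambda>n. (\<alpha> n * q powi (N + n + 1)) * rq (N - n) * rq (N + n + 1)"
  have "?g (-1 - n) = - ?g n" for n
  proof -
    have "\<alpha> (-1-n) * q powi (N + (-1-n) + 1) = - \<alpha> n * (q powi (2 * n + 1) * q powi (N - n))"
      using d[of n] by (simp add: minus_diff_commute[of n 1] algebra_simps del: minus_diff_commute)
    also have "q powi (2 * n + 1) * q powi (N - n) = q powi (N + n + 1)"
      unfolding powi_mult by (simp add: algebra_simps)
    finally show ?thesis by (simp add: algebra_simps)
  qed
  then have "infsum ?g UNIV = - infsum ?g UNIV"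
    using infsum_int_reflect[of ?g "-1"] by (simp only: infsum_uminus)
  then have g0: "infsum ?g UNIV = 0" by simp
  have "\<alpha> n * rq (N - n) * rq (N + n + 1) = \<alpha> n * rq (N - n) * rq (N + n + 0) + ?g n" for n
  proof -
    have r: "rq (N + n + 0) = (1 - q powi (N + n + 1)) * rq (N + n + 1)" unfolding rq_rec by simp
    show ?thesis unfolding r by (simp add: algebra_simps)
  qed
  then have "bailey 1 \<alpha> N = (\<Sum>\<^sub>\<infinity>n. \<alpha> n * rq (N - n) * rq (N + n + 0) + ?g n)"
    unfolding bailey_def by simp
  also have "\<dots> = bailey 0 \<alpha> N + infsum ?g UNIV"
    unfolding bailey_def by (intro infsum_add bailey_summable)
  finally show ?thesis using g0 by simp
qed

section \<open>Two seed pairs: the one for 1/(q^2;q^2)_N and the unit pair\<close>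

lemma bailey_sq_rec:
  assumes "N \<ge> 1"
  shows "(1 - q powi (2 * N)) * bailey 0 (\<lambda>n. sgn_pow n * q powi n\<^sup>2) N
       = bailey 0 (\<lambda>n. sgn_pow n * q powi n\<^sup>2) (N - 1)"
proof -
  let ?\<alpha> = "\<lambda>n. sgn_pow n * q powi n\<^sup>2"
  let ?h = "\<lambda>n. (sgn_pow n * q powi (n\<^sup>2 + N - n)) * rq (N - n) * rq (N + n + (-1))"
  let ?h' = "\<lambda>n. (sgn_pow n * q powi (n\<^sup>2 + N + n)) * rq (N - 1 - n) * rq (N - 1 + n + 1)"
  have "?h' n = - ?h (n + 1)" for n
  proof -
    have e: "n\<^sup>2 + N + n = (n+1)\<^sup>2 + N - (n + 1)" "N - 1 - n = N - (n + 1)" "N - 1 + n + 1 = N + (n + 1) + (-1)"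
      by (simp_all add: power2_eq_square algebra_simps)
    show ?thesis unfolding e sgn_pow_simps(1) by simp
  qed
  then have h: "infsum ?h' UNIV = - infsum ?h UNIV"
    using infsum_int_shift[of ?h 1] by (simp only: infsum_uminus)
  \<comment> \<open>With x = q^(N-n) and y = q^(N+n), 1 - x y = (1-x)(1-y) + x (1-y) + y (1-x). The
    first part is the term for N - 1; the other two, \<open>?h\<close> and \<open>?h'\<close>,
    cancel after a shift by one.\<close>
  have split: "(1 - q powi (2 * N)) * (?\<alpha> n * rq (N - n) * rq (N + n + 0))
      = ?\<alpha> n * rq (N - 1 - n) * rq (N - 1 + n + 0) + (?h n + ?h' n)" for n
  proof -
    have a: "rq (N - 1 - n) = (1 - q powi (N - n)) * rq (N - n)"
      "rq (N + n + (-1)) = (1 - q powi (N + n)) * rq (N + n)"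
      "rq (N - 1 + n) = (1 - q powi (N + n)) * rq (N + n)"
      unfolding rq_rec by (simp_all add: algebra_simps)
    have b: "q powi (2 * N) = q powi (N - n) * q powi (N + n)" unfolding powi_mult by simp
    have c: "q powi (n\<^sup>2 + N - n) = q powi n\<^sup>2 * q powi (N - n)"
      "q powi (n\<^sup>2 + N + n) = q powi n\<^sup>2 * q powi (N + n)" unfolding powi_mult by (simp_all add: algebra_simps)
    have d: "rq (N + n + 0) = rq (N + n)" "rq (N - 1 + n + 0) = rq (N - 1 + n)"
       "rq (N - 1 + n + 1) = rq (N + n)" by (simp_all add: algebra_simps)
    show ?thesis unfolding d a b c by (simp add: algebra_simps)
  qed
  have sh: "?h summable_on UNIV" by (rule bailey_summable)
  have sh': "?h' summable_on UNIV" by (rule bailey_summable)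
  have "(1 - q powi (2 * N)) * bailey 0 ?\<alpha> N
     = (\<Sum>\<^sub>\<infinity>n. (1 - q powi (2 * N)) * (?\<alpha> n * rq (N - n) * rq (N + n + 0)))"
    unfolding bailey_def by (rule infsum_cmult_right'[symmetric])
  also have "\<dots> = bailey 0 ?\<alpha> (N - 1) + (infsum ?h UNIV + infsum ?h' UNIV)"
    unfolding split bailey_def
    by (subst infsum_add[symmetric, OF sh sh'], rule infsum_add) (intro bailey_summable summable_on_add sh sh')+
  finally show ?thesis unfolding h by simp
qed

text \<open>The right side is the innermost factor of the multiple sum, so this pair starts all
  chains.\<close>

lemma bailey_sq: "bailey 0 (\<lambda>n. sgn_pow n * q powi n\<^sup>2) (int N) = 1 / qpoch (q\<^sup>2) (q\<^sup>2) N"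
proof (induction N)
  case 0
  have "bailey 0 (\<lambda>n. sgn_pow n * q powi n\<^sup>2) 0 = (\<Sum>n=0-1..0. sgn_pow n * q powi n\<^sup>2 * rq (0 - n) * rq (0 + n + 0))"
    by (subst bailey_eq_sum[of _ _ 0]) auto
  also have "{0-1..0::int} = {-1,0}" by auto
  finally show ?case by (simp add: rq_neg qpoch_def)
next
  case (Suc N)
  have e: "q powi (2 * int (Suc N)) = q ^ (2 * Suc N)"
    by (metis of_nat_mult of_nat_numeral power_int_of_nat)
  have nz: "1 - q ^ (2 * Suc N) \<noteq> 0" by (rule one_minus_power_nz) simp
  have "qpoch (q\<^sup>2) (q\<^sup>2) (Suc N) = qpoch (q\<^sup>2) (q\<^sup>2) N * (1 - q ^ (2 * Suc N))"
    by (simp add: qpoch_def power_mult[symmetric] power_add[symmetric])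
  then show ?case
    using bailey_sq_rec[of "int (Suc N)"] Suc
      nonzero_mult_div_cancel_left[OF nz, of "bailey 0 (\<lambda>n. sgn_pow n * q powi n\<^sup>2) (int (Suc N))"]
    unfolding e by simp
qed

text \<open>Here 1 - x y = (1-y) + y (1-x) with x = q^(N-n) and y = q^(N+n). The sum of
  \<open>?u\<close> is 0 since n -> 1-n reverses its sign, and \<open>?h'\<close> is a shift of -q^N
  times \<open>?u\<close>. The assumption N \<ge> 1 makes the remaining factor 1 - q^(2 N)
  nonzero.\<close>

lemma bailey_unit:
  assumes "N \<ge> 1"
  shows "bailey 0 (\<lambda>n. sgn_pow n * q powi tri n) N = 0"
proof -
  let ?\<alpha> = "\<lambda>n. sgn_pow n * q powi tri n"
  let ?u = "\<lambda>n. ?\<alpha> n * rq (N - n) * rq (N + n + (-1))"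
  let ?h' = "\<lambda>n. (sgn_pow n * q powi (tri n + N + n)) * rq (N - 1 - n) * rq (N - 1 + n + 1)"
  let ?h = "\<lambda>n. q powi N * ?u n"
  have "?u (1 - n) = - ?u n" for n
    using sgn_pow_simps(1)[of "-n"] by (simp add: sgn_pow_simps tri_simps algebra_simps)
  then have "infsum ?u UNIV = - infsum ?u UNIV"
    using infsum_int_reflect[of ?u 1] by (simp only: infsum_uminus)
  then have u: "infsum ?u UNIV = 0" by simp
  have "?h' n = - ?h (n + 1)" for n
  proof -
    have "q powi (tri n + N + n) = q powi N * q powi tri (n + 1)"
      unfolding powi_mult tri_simps by (simp add: algebra_simps)
    moreover have "N - 1 - n = N - (n + 1)" "N - 1 + n + 1 = N + (n + 1) + (-1)" by simp_all
    ultimately show ?thesis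
      by (simp only: sgn_pow_simps(1) mult_minus_left mult_minus_right minus_minus mult_ac)
  qed
  then have h: "infsum ?h' UNIV = - infsum ?h UNIV"
    using infsum_int_shift[of ?h 1] by (simp only: infsum_uminus)
  have h0: "infsum ?h UNIV = 0" using u by (simp only: infsum_cmult_right' mult_zero_right)
  have split: "(1 - q powi (2 * N)) * (?\<alpha> n * rq (N - n) * rq (N + n + 0)) = ?u n + ?h' n" for n
  proof -
    have a: "rq (N - 1 - n) = (1 - q powi (N - n)) * rq (N - n)"
      "rq (N + n + (-1)) = (1 - q powi (N + n)) * rq (N + n)"
      unfolding rq_rec by (simp_all add: algebra_simps)
    have b: "q powi (2 * N) = q powi (N - n) * q powi (N + n)" unfolding powi_mult by simp
    have c: "q powi (tri n + N + n) = q powi tri n * q powi (N + n)" unfolding powi_mult by (simp add: algebra_simps)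
    have d: "rq (N + n + 0) = rq (N + n)" "rq (N - 1 + n + 1) = rq (N + n)" by (simp_all add: algebra_simps)
    show ?thesis unfolding d a b c by (simp add: algebra_simps)
  qed
  have su: "?u summable_on UNIV" by (rule bailey_summable)
  have sh': "?h' summable_on UNIV" by (rule bailey_summable)
  have "(1 - q powi (2 * N)) * bailey 0 ?\<alpha> N
     = (\<Sum>\<^sub>\<infinity>n. (1 - q powi (2 * N)) * (?\<alpha> n * rq (N - n) * rq (N + n + 0)))"
    unfolding bailey_def by (rule infsum_cmult_right'[symmetric])
  also have "\<dots> = infsum ?u UNIV + infsum ?h' UNIV"
    unfolding split by (rule infsum_add[OF su sh'])
  finally have "(1 - q powi (2 * N)) * bailey 0 ?\<alpha> N = 0" using u h h0 by simp
  moreover have "q powi (2 * N) = q ^ nat (2 * N)" using assms by (simp add: power_int_def)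
  moreover have "1 - q ^ nat (2 * N) \<noteq> 0" using assms by (intro one_minus_power_nz) simp
  ultimately show ?thesis by simp
qed

lemma bailey_unit_0: "bailey 0 (\<lambda>n. sgn_pow n * q powi tri n) 0 = 1"
proof -
  have "bailey 0 (\<lambda>n. sgn_pow n * q powi tri n) 0 = (\<Sum>n=0-1..0. sgn_pow n * q powi tri n * rq (0 - n) * rq (0 + n + 0))"
    by (subst bailey_eq_sum[of _ _ 0]) auto
  also have "{0-1..0::int} = {-1,0}" by auto
  finally show ?thesis by (simp add: rq_neg tri_def)
qed

text \<open>One Bailey step applied to the unit pair, of which only s = 0 survives. The exponent n^2
  + tri n is the pentagonal number n (3 n - 1) / 2.\<close>

lemma finite_pentagonal:
  assumes "N \<ge> 0"
  shows "bailey 0 (\<lambda>n. sgn_pow n * q powi (n\<^sup>2 + tri n)) N = rq N"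
proof -
  let ?\<alpha> = "\<lambda>n. sgn_pow n * q powi tri n"
  have "bailey 0 (\<lambda>n. sgn_pow n * q powi (n\<^sup>2 + tri n)) N = bailey 0 (\<lambda>n. q powi (n\<^sup>2 + 0 * n) * ?\<alpha> n) N"
    by (simp add: powi_mult[symmetric] algebra_simps)
  also have "\<dots> = (\<Sum>s=0..N. q powi (s\<^sup>2 + 0 * s) * rq (N - s) * bailey 0 ?\<alpha> s)"
    using assms by (intro bailey_step[symmetric]) auto
  also have "\<dots> = (\<Sum>s\<in>{0}. q powi (s\<^sup>2 + 0 * s) * rq (N - s) * bailey 0 ?\<alpha> s)"
    using assms by (intro sum.mono_neutral_right) (auto simp: bailey_unit)
  finally show ?thesis by (simp add: bailey_unit_0)
qed

text \<open>The multiple sum built from the inside out: N is the outer index left free, and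
  \<open>e j\<close>, later 0 or 1, switches the linear term of N_(k-1-j).\<close>

fun chain :: "(nat \<Rightarrow> nat) \<Rightarrow> nat \<Rightarrow> nat \<Rightarrow> complex" where
  "chain e 0 N = 1 / qpoch (q\<^sup>2) (q\<^sup>2) N"
| "chain e (Suc j) N = (\<Sum>s\<le>N. q ^ (s\<^sup>2 + e j * s) * rq (int N - int s) * chain e j s)"

abbreviation bterm :: "int \<Rightarrow> int \<Rightarrow> int \<Rightarrow> complex" where
  "bterm a b n \<equiv> sgn_pow n * q powi (a * n\<^sup>2 + b * n)"

text \<open>When the quadratic coefficient exceeds the linear one by 1, n -> -n-1 raises the
  exponent by exactly 2 n + 1. A step with a linear term adds n^2 + n and so preserves this
  relation, which allows the change of parameter after any number of such steps.\<close>

lemma bterm_transfer: "bailey 0 (bterm (b + 1) b) N = bailey 1 (bterm (b + 1) b) N"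
proof (rule bailey_transfer)
  fix n
  have "q powi ((b + 1) * (-n-1)\<^sup>2 + b * (-n-1)) = q powi ((b + 1) * n\<^sup>2 + b * n) * q powi (2 * n + 1)"
    unfolding powi_mult by (rule arg_cong[where f = "\<lambda>x. q powi x"])
      (simp add: power2_eq_square algebra_simps)
  moreover have "sgn_pow (-n-1) = - sgn_pow n" using sgn_pow_simps(2)[of "-n"] by (simp add: sgn_pow_simps)
  ultimately show "bterm (b + 1) b (-n-1) = - bterm (b + 1) b n * q powi (2 * n + 1)" by simp
qed

lemma chain_step:
  assumes "\<And>N. chain e j N = bailey (int (e j)) \<alpha> (int N)" "e j \<le> 1"
  shows "chain e (Suc j) N = bailey (int (e j)) (\<lambda>n. q powi (n\<^sup>2 + int (e j) * n) * \<alpha> n) (int N)"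
proof -
  have "chain e (Suc j) N = (\<Sum>s\<le>N. q powi ((int s)\<^sup>2 + int (e j) * int s) * rq (int N - int s) * bailey (int (e j)) \<alpha> (int s))"
    unfolding chain.simps assms(1) by (simp add: power_int_of_nat[symmetric] del: power_int_of_nat)
  also have "\<dots> = (\<Sum>s=0..int N. q powi (s\<^sup>2 + int (e j) * s) * rq (int N - s) * bailey (int (e j)) \<alpha> s)"
    by (rule sum.reindex_bij_witness[of _ nat int]) auto
  also have "\<dots> = bailey (int (e j)) (\<lambda>n. q powi (n\<^sup>2 + int (e j) * n) * \<alpha> n) (int N)"
    using assms(2) by (intro bailey_step) auto
  finally show ?thesis .
qed

lemma chain_lower:
  assumes "\<And>j'. j' < j \<Longrightarrow> e j' = 1"
  shows "chain e j N = bailey 1 (bterm (int j + 1) (int j)) (int N)"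
  using assms
proof (induction j arbitrary: N)
  case 0
  then show ?case using bailey_sq[of N] bterm_transfer[of 0 "int N"] by simp
next
  case (Suc j)
  have "chain e (Suc j) N = bailey (int (e j)) (\<lambda>n. q powi (n\<^sup>2 + int (e j) * n) * bterm (int j + 1) (int j) n) (int N)"
    using Suc by (intro chain_step) auto
  also have "\<dots> = bailey 1 (bterm (int (Suc j) + 1) (int (Suc j))) (int N)"
    using Suc.prems[of j] unfolding bailey_def
    by (intro infsum_cong) (simp add: powi_mult powi_mult' algebra_simps)
  finally show ?case .
qed

text \<open>The c innermost steps run relative to q and contribute n^2 + n each; after the change
  back to the parameter 1 every further step contributes n^2 only. So c survives as the linear
  coefficient.\<close>

lemma chain_upper:
  assumes "\<And>j'. j' < c \<Longrightarrow> e j' = 1" "\<And>j'. j' \<ge> c \<Longrightarrow> e j' = 0"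
  shows "chain e (c + j) N = bailey 0 (bterm (int (c + j) + 1) (int c)) (int N)"
proof (induction j arbitrary: N)
  case 0
  then show ?case using chain_lower[of c e N] assms bterm_transfer[of "int c" "int N"] by simp
next
  case (Suc j)
  have "chain e (Suc (c + j)) N = bailey (int (e (c + j))) (\<lambda>n. q powi (n\<^sup>2 + int (e (c + j)) * n) * bterm (int (c + j) + 1) (int c) n) (int N)"
    using Suc assms by (intro chain_step) auto
  also have "\<dots> = bailey 0 (bterm (int (c + Suc j) + 1) (int c)) (int N)"
    using assms(2)[of "c + j"] unfolding bailey_def
    by (intro infsum_cong) (simp add: powi_mult powi_mult' algebra_simps)
  finally show ?case by simp
qed

end


section \<open>Limits of Bailey pairs\<close>

text \<open>Tannery's theorem, obtained as dominated convergence for the counting measure.\<close>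

lemma infsum_dominated_convergence:
  fixes f :: "nat \<Rightarrow> 'a \<Rightarrow> 'b::{banach,second_countable_topology}"
  assumes g: "g summable_on A"
    and lim: "\<And>n. n \<in> A \<Longrightarrow> (\<lambda>N. f N n) \<longlonglongrightarrow> h n"
    and bd: "\<And>N n. n \<in> A \<Longrightarrow> norm (f N n) \<le> g n"
  shows "(\<lambda>N. infsum (f N) A) \<longlonglongrightarrow> infsum h A"
proof -
  have hbd: "norm (h n) \<le> g n" if "n \<in> A" for n
    using lim[OF that] bd[OF that] by (intro LIMSEQ_le_const2[OF tendsto_norm]) auto
  have g0: "g n \<ge> 0" if "n \<in> A" for n using bd[OF that, of 0] by (rule order_trans[OF norm_ge_zero])
  have ab: "Infinite_Set_Sum.abs_summable_on u A" if "\<And>n. n \<in> A \<Longrightarrow> norm (u n) \<le> g n" for u :: "'a \<Rightarrow> 'b"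
  proof -
    have "(\<lambda>n. norm (u n)) summable_on A"
      using that by (intro summable_on_comparison_test[OF g]) auto
    then show ?thesis using abs_summable_equivalent by blast
  qed
  have gi: "integrable (count_space A) g"
  proof -
    have "(\<lambda>n. norm (g n)) summable_on A \<longleftrightarrow> g summable_on A"
      using g0 by (intro summable_on_cong) auto
    then show ?thesis using g abs_summable_equivalent[of g A] by (simp add: Infinite_Set_Sum.abs_summable_on_def)
  qed
  have "(\<lambda>N. integral\<^sup>L (count_space A) (f N)) \<longlonglongrightarrow> integral\<^sup>L (count_space A) h"
    using lim bd by (intro integral_dominated_convergence[OF _ _ gi]) (auto intro!: AE_I2)
  then show ?thesis
    using infsetsum_infsum[OF ab[OF bd]] infsetsum_infsum[OF ab[OF hbd]] by (simp add: infsetsum_def)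
qed

lemma summable_on_nat_bij_int:
  fixes f :: "int \<Rightarrow> real"
  assumes "summable (\<lambda>n. f (int n))" "summable (\<lambda>n. f (- int n))" "\<And>n. f n \<ge> 0"
  shows "f summable_on UNIV"
proof -
  have 1: "f summable_on (range int)"
    using assms by (subst summable_on_reindex)
      (auto simp: o_def summable_on_UNIV_nonneg_real_iff)
  have 2: "f summable_on (range (\<lambda>n. - int n))"
    using assms by (subst summable_on_reindex)
      (auto simp: o_def inj_on_def summable_on_UNIV_nonneg_real_iff)
  have 3: "(UNIV :: int set) = range int \<union> range (\<lambda>n. - int n)"
  proof safe
    fix x :: int assume "x \<notin> range (\<lambda>n. - int n)"
    then show "x \<in> range int" by (metis int_cases2 rangeI)
  qed auto
  show ?thesis unfolding 3
    using 1 2 by (rule summable_on_union)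
qed

lemma summable_geometric_int:
  assumes "0 \<le> r" "r < 1"
  shows "(\<lambda>n::int. r ^ nat \<bar>n\<bar> :: real) summable_on UNIV"
  using assms by (intro summable_on_nat_bij_int) (auto intro: summable_geometric)

lemma int_le_square: "(s::int) \<le> s\<^sup>2"
proof -
  have "0 \<le> s * (s - 1)" by (cases "s \<ge> 1") (auto intro: mult_nonneg_nonneg mult_nonpos_nonpos)
  then show ?thesis by (simp add: power2_eq_square algebra_simps)
qed

context nome begin

text \<open>The limit \<rho> is 1/(q;q)_infinity, the inverse of a convergent product without zero
  factors. Later the pentagonal series takes the place of 1/\<rho>.\<close>

lemma rq_limit:
  obtains \<rho> where "\<rho> \<noteq> 0" "(\<lambda>N. rq (int N)) \<longlonglongrightarrow> \<rho>"
proof -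
  have nz: "1 - q * q ^ l \<noteq> 0" for l using one_minus_power_nz[of "Suc l"] by simp
  have "summable (\<lambda>l. norm (1 - q * q ^ l - 1))"
    using q_lt_1 by (simp add: norm_mult norm_power summable_geometric summable_mult)
  then have "convergent_prod (\<lambda>l. 1 - q * q ^ l)"
    by (intro abs_convergent_prod_imp_convergent_prod summable_imp_abs_convergent_prod)
  then obtain L where L: "(\<lambda>n. \<Prod>i\<le>n. 1 - q * q ^ i) \<longlonglongrightarrow> L" "L \<noteq> 0"
    using convergent_prod_iff_nz_lim[of "\<lambda>l. 1 - q * q ^ l"] nz by auto
  from L(1) have "(\<lambda>n. qpoch q q (Suc n)) \<longlonglongrightarrow> L"
    unfolding qpoch_def lessThan_Suc_atMost .
  then have "(\<lambda>n. qpoch q q n) \<longlonglongrightarrow> L" by (rule LIMSEQ_imp_Suc)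
  then have "(\<lambda>N. rq (int N)) \<longlonglongrightarrow> 1 / L"
    unfolding rq_nat using L(2) by (intro tendsto_divide) auto
  then show thesis using L(2) by (intro that[of "1 / L"]) auto
qed

lemma rq_bounded:
  obtains C where "C > 0" "\<And>m. norm (rq m) \<le> C"
proof -
  obtain \<rho> where "(\<lambda>N. rq (int N)) \<longlonglongrightarrow> \<rho>" by (rule rq_limit)
  then have "Bseq (\<lambda>N. rq (int N))" by (metis convergentI convergent_imp_Bseq)
  then obtain C where C: "C > 0" "\<And>N. norm (rq (int N)) \<le> C" by (auto simp: Bseq_def)
  have "norm (rq m) \<le> C" for m
    using C(2)[of "nat m"] C(1) by (cases "m \<ge> 0") (auto simp: rq_neg)
  then show thesis using C(1) that by blast
qed

lemma rq_limit_shift: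
  assumes "(\<lambda>N. rq (int N)) \<longlonglongrightarrow> \<rho>"
  shows "(\<lambda>N. rq (int N + c)) \<longlonglongrightarrow> \<rho>"
proof -
  have "filterlim (\<lambda>N. nat (int N + c)) at_top sequentially"
  proof (rule filterlim_at_top_mono[of "\<lambda>N. N - nat \<bar>c\<bar>"])
    show "filterlim (\<lambda>N. N - nat \<bar>c\<bar>) at_top sequentially"
      by (rule filterlim_minus_const_nat_at_top)
  qed (auto intro!: always_eventually)
  from filterlim_compose[OF assms this]
  show ?thesis
  proof (rule Lim_transform_eventually)
    show "\<forall>\<^sub>F N in sequentially. rq (int (nat (int N + c))) = rq (int N + c)"
      using eventually_ge_at_top[of "nat \<bar>c\<bar>"] by eventually_elim (rule arg_cong[where f = rq], simp)
  qed
qed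

lemma norm_powi_summable:
  fixes f :: "int \<Rightarrow> int"
  assumes "\<And>n. f n \<ge> \<bar>n\<bar> - D"
  shows "(\<lambda>n. norm (sgn_pow n * q powi f n)) summable_on UNIV"
proof (rule summable_on_comparison_test)
  let ?r = "norm q"
  show "(\<lambda>n. ?r powi (- D) * ?r ^ nat \<bar>n\<bar>) summable_on UNIV"
    using q_lt_1 by (intro summable_on_cmult_right summable_geometric_int) auto
  fix n :: int
  have "norm (sgn_pow n * q powi f n) = ?r powi f n"
    by (simp add: norm_mult norm_power_int)
  also have "\<dots> \<le> ?r powi (\<bar>n\<bar> - D)"
    using q_nz q_lt_1 assms[of n] by (intro power_int_decreasing) auto
  also have "\<dots> = ?r powi (- D) * ?r powi \<bar>n\<bar>"
    using q_nz by (simp add: power_int_add[symmetric])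
  also have "?r powi \<bar>n\<bar> = ?r ^ nat \<bar>n\<bar>" by (simp add: power_int_def)
  finally show "norm (sgn_pow n * q powi f n) \<le> ?r powi (- D) * ?r ^ nat \<bar>n\<bar>" .
qed auto

lemma bterm_summable:
  assumes "a \<ge> 1"
  shows "(\<lambda>n. norm (bterm a b n)) summable_on UNIV"
proof (rule norm_powi_summable)
  fix n :: int
  have "n\<^sup>2 \<le> a * n\<^sup>2" using assms mult_right_mono[of 1 a "n\<^sup>2"] by simp
  moreover have "b * n \<ge> - (\<bar>b\<bar> * \<bar>n\<bar>)" by (metis abs_ge_minus_self abs_mult minus_le_iff)
  \<comment> \<open>The square absorbs any linear term up to a constant: n^2 - c |n| + c^2 \<ge> 0
    for c = |b| + 1.\<close>
  moreover have "\<bar>n\<bar> * (\<bar>b\<bar> + 1) \<le> n\<^sup>2 + (\<bar>b\<bar> + 1)\<^sup>2"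
  proof -
    have "0 \<le> (\<bar>n\<bar> - (\<bar>b\<bar> + 1))\<^sup>2 + (\<bar>n\<bar> * (\<bar>b\<bar> + 1))" by (intro add_nonneg_nonneg mult_nonneg_nonneg) auto
    then show ?thesis by (simp add: power2_eq_square algebra_simps)
  qed
  ultimately show "a * n\<^sup>2 + b * n \<ge> \<bar>n\<bar> - (\<bar>b\<bar> + 1)\<^sup>2" by (simp add: algebra_simps)
qed

lemma bailey_limit:
  assumes sm: "(\<lambda>n. norm (\<alpha> n)) summable_on UNIV" and \<rho>: "(\<lambda>N. rq (int N)) \<longlonglongrightarrow> \<rho>"
  shows "(\<lambda>N. bailey e \<alpha> (int N)) \<longlonglongrightarrow> \<rho>\<^sup>2 * (\<Sum>\<^sub>\<infinity>n. \<alpha> n)"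
proof -
  obtain C where C: "C > 0" "\<And>m. norm (rq m) \<le> C" by (rule rq_bounded) blast
  have "(\<lambda>N. bailey e \<alpha> (int N)) \<longlonglongrightarrow> (\<Sum>\<^sub>\<infinity>n. \<alpha> n * \<rho> * \<rho>)"
    unfolding bailey_def
  proof (rule infsum_dominated_convergence)
    show "(\<lambda>n. norm (\<alpha> n) * (C * C)) summable_on UNIV" by (intro summable_on_cmult_left sm)
    fix n :: int
    show "(\<lambda>N. \<alpha> n * rq (int N - n) * rq (int N + n + e)) \<longlonglongrightarrow> \<alpha> n * \<rho> * \<rho>"
      using rq_limit_shift[OF \<rho>, of "-n"] rq_limit_shift[OF \<rho>, of "n+e"]
      by (intro tendsto_mult tendsto_const) (simp_all add: algebra_simps)
    show "norm (\<alpha> n * rq (int N - n) * rq (int N + n + e)) \<le> norm (\<alpha> n) * (C * C)" for N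
      using C by (auto simp: norm_mult mult.assoc intro!: mult_mono mult_left_mono)
  qed
  also have "(\<Sum>\<^sub>\<infinity>n. \<alpha> n * \<rho> * \<rho>) = (\<Sum>\<^sub>\<infinity>n. \<rho>\<^sup>2 * \<alpha> n)"
    by (intro infsum_cong) (simp add: power2_eq_square)
  also have "\<dots> = \<rho>\<^sup>2 * (\<Sum>\<^sub>\<infinity>n. \<alpha> n)" by (rule infsum_cmult_right')
  finally show ?thesis .
qed

text \<open>The limit of \<open>finite_pentagonal\<close>: its right side tends to \<rho>, its left
  side to \<rho>^2 times the series, by \<open>bailey_limit\<close>. This is Euler's pentagonal
  number theorem.\<close>

lemma pentagonal:
  assumes \<rho>: "(\<lambda>N. rq (int N)) \<longlonglongrightarrow> \<rho>" and "\<rho> \<noteq> 0"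
  shows "(\<Sum>\<^sub>\<infinity>n. sgn_pow n * q powi (n\<^sup>2 + tri n)) = 1 / \<rho>"
proof -
  have "(\<lambda>N. rq (int N)) \<longlonglongrightarrow> \<rho>\<^sup>2 * (\<Sum>\<^sub>\<infinity>n. sgn_pow n * q powi (n\<^sup>2 + tri n))"
  proof -
    have "\<bar>n\<bar> - 0 \<le> n\<^sup>2 + tri n" for n
      using tri_nonneg[of n] int_le_square[of "\<bar>n\<bar>"] by simp
    from bailey_limit[OF norm_powi_summable[OF this] \<rho>, of 0] show ?thesis
      by (simp add: finite_pentagonal)
  qed
  from LIMSEQ_unique[OF this \<rho>] show ?thesis using \<open>\<rho> \<noteq> 0\<close>
    by (simp add: power2_eq_square field_simps)
qed

lemma chain_bounded:
  obtains C where "C \<ge> 0" "\<And>N. norm (chain e j N) \<le> C"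
proof -
  have "\<exists>C\<ge>0. \<forall>N. norm (chain e j N) \<le> C"
  proof (induction j)
    case 0
    \<comment> \<open>1/(q^2;q^2)_N is the \<open>rq\<close> of the nome q^2, so the bound already
      proved applies to it.\<close>
    interpret sq: nome "q\<^sup>2"
      using q_nz q_lt_1 by unfold_locales (auto simp: norm_power power_less_one_iff)
    obtain C where C: "C > 0" "\<And>m. norm (sq.rq m) \<le> C" by (rule sq.rq_bounded) blast
    show ?case using C(1) C(2)[of "int _"] by (intro exI[of _ C]) (simp add: sq.rq_nat)
  next
    case (Suc j)
    then obtain B where B: "B \<ge> 0" "\<And>N. norm (chain e j N) \<le> B" by blast
    obtain C where C: "C > 0" "\<And>m. norm (rq m) \<le> C" by (rule rq_bounded) blast
    have "norm (chain e (Suc j) N) \<le> (1 / (1 - norm q)) * (C * B)" for N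
    proof -
      have "norm (chain e (Suc j) N) \<le> (\<Sum>s\<le>N. norm q ^ s * (C * B))"
        unfolding chain.simps
      proof (intro sum_norm_le)
        fix s
        have "norm q ^ (s\<^sup>2 + e j * s) \<le> norm q ^ s"
          using q_lt_1 by (intro power_decreasing) (auto simp: power2_eq_square trans_le_add1)
        then show "norm (q ^ (s\<^sup>2 + e j * s) * rq (int N - int s) * chain e j s) \<le> norm q ^ s * (C * B)"
          unfolding norm_mult norm_power mult.assoc using B C by (intro mult_mono) auto
      qed
      also have "\<dots> = (\<Sum>s\<le>N. norm q ^ s) * (C * B)" by (simp add: sum_distrib_right)
      also have "\<dots> \<le> (1 / (1 - norm q)) * (C * B)"
      proof (intro mult_right_mono)
        have "(\<Sum>s\<le>N. norm q ^ s) \<le> (\<Sum>s. norm q ^ s)"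
          using q_lt_1 by (intro sum_le_suminf summable_geometric) auto
        then show "(\<Sum>s\<le>N. norm q ^ s) \<le> 1 / (1 - norm q)"
          using q_lt_1 by (simp add: suminf_geometric)
      qed (use B C in auto)
      finally show ?thesis .
    qed
    then show ?case using B C q_lt_1 by (intro exI[of _ "(1 / (1 - norm q)) * (C * B)"]) auto
  qed
  then show thesis using that by blast
qed

lemma chain_limit:
  assumes \<rho>: "(\<lambda>N. rq (int N)) \<longlonglongrightarrow> \<rho>"
  shows "(\<lambda>N. chain e (Suc j) N) \<longlonglongrightarrow> \<rho> * (\<Sum>\<^sub>\<infinity>s. q ^ (s\<^sup>2 + e j * s) * chain e j s)"
proof -
  obtain B where B: "B \<ge> 0" "\<And>N. norm (chain e j N) \<le> B" by (rule chain_bounded[of e j]) blast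
  obtain C where C: "C > 0" "\<And>m. norm (rq m) \<le> C" by (rule rq_bounded) blast
  let ?f = "\<lambda>N s. q ^ (s\<^sup>2 + e j * s) * rq (int N - int s) * chain e j s"
  have eq: "chain e (Suc j) N = (\<Sum>\<^sub>\<infinity>s. ?f N s)" for N
  proof -
    have "(\<Sum>\<^sub>\<infinity>s. ?f N s) = infsum (?f N) {..N}"
      by (intro infsum_cong_neutral) (auto simp: rq_neg)
    then show ?thesis by simp
  qed
  have "(\<lambda>N. \<Sum>\<^sub>\<infinity>s. ?f N s) \<longlonglongrightarrow> (\<Sum>\<^sub>\<infinity>s. q ^ (s\<^sup>2 + e j * s) * \<rho> * chain e j s)"
  proof (rule infsum_dominated_convergence)
    show "(\<lambda>s. norm q ^ s * (C * B)) summable_on UNIV"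
      using q_lt_1 by (intro summable_on_cmult_left) (auto simp: summable_on_UNIV_nonneg_real_iff intro: summable_geometric)
    fix s :: nat
    show "(\<lambda>N. ?f N s) \<longlonglongrightarrow> q ^ (s\<^sup>2 + e j * s) * \<rho> * chain e j s"
      using rq_limit_shift[OF \<rho>, of "- int s"] by (intro tendsto_mult tendsto_const) simp
    have "norm q ^ (s\<^sup>2 + e j * s) \<le> norm q ^ s"
      using q_lt_1 by (intro power_decreasing) (auto simp: power2_eq_square trans_le_add1)
    then show "norm (?f N s) \<le> norm q ^ s * (C * B)" for N
      unfolding norm_mult norm_power mult.assoc using B C by (intro mult_mono) auto
  qed
  also have "(\<Sum>\<^sub>\<infinity>s. q ^ (s\<^sup>2 + e j * s) * \<rho> * chain e j s) = (\<Sum>\<^sub>\<infinity>s. \<rho> * (q ^ (s\<^sup>2 + e j * s) * chain e j s))"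
    by (intro infsum_cong) simp
  also have "\<dots> = \<rho> * (\<Sum>\<^sub>\<infinity>s. q ^ (s\<^sup>2 + e j * s) * chain e j s)" by (rule infsum_cmult_right')
  finally show ?thesis unfolding eq .
qed

text \<open>The limit of \<open>chain e (Suc j) N\<close> is computed twice. In the nested sum N
  occurs in one \<open>rq\<close>, giving one factor \<rho>; in the bilateral sum it occurs in two,
  giving \<rho>^2. The quotient 1/\<rho> is the pentagonal series.\<close>

theorem bressoud_chain:
  assumes c: "\<And>j'. j' < c \<Longrightarrow> e j' = 1" "\<And>j'. j' \<ge> c \<Longrightarrow> e j' = 0" and "c \<le> Suc j"
  shows "(\<Sum>\<^sub>\<infinity>n. sgn_pow n * q powi (n\<^sup>2 + tri n)) * (\<Sum>\<^sub>\<infinity>s. q ^ (s\<^sup>2 + e j * s) * chain e j s)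
       = (\<Sum>\<^sub>\<infinity>n. bterm (int j + 2) (int c) n)"
proof -
  obtain \<rho> where \<rho>: "\<rho> \<noteq> 0" "(\<lambda>N. rq (int N)) \<longlonglongrightarrow> \<rho>" by (rule rq_limit)
  have "chain e (Suc j) N = bailey 0 (bterm (int j + 2) (int c)) (int N)" for N
  proof -
    have "chain e (c + (Suc j - c)) N = bailey 0 (bterm (int (c + (Suc j - c)) + 1) (int c)) (int N)"
      by (rule chain_upper) (use c in auto)
    moreover have "c + (Suc j - c) = Suc j" using \<open>c \<le> Suc j\<close> by simp
    moreover have "int (Suc j) + 1 = int j + 2" by simp
    ultimately show ?thesis by metis
  qed
  then have "(\<lambda>N. chain e (Suc j) N) \<longlonglongrightarrow> \<rho>\<^sup>2 * (\<Sum>\<^sub>\<infinity>n. bterm (int j + 2) (int c) n)"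
    using bailey_limit[OF bterm_summable \<rho>(2), of "int j + 2" 0 "int c"] by simp
  from LIMSEQ_unique[OF this chain_limit[OF \<rho>(2)]]
  show ?thesis unfolding pentagonal[OF \<rho>(2,1)] using \<rho>(1)
    by (simp add: power2_eq_square field_simps)
qed

end


section \<open>Bressoud's identity\<close>

lemma tail_sum_rec: "l \<le> k - 1 \<Longrightarrow> tail_sum k n l = n l + tail_sum k n (Suc l)"
  unfolding tail_sum_def by (rule sum.atLeast_Suc_atMost)

lemma tail_sum_cong: "(\<And>m. l \<le> m \<Longrightarrow> m \<le> k - 1 \<Longrightarrow> n m = n' m) \<Longrightarrow> tail_sum k n l = tail_sum k n' l"
  by (simp add: tail_sum_def)

definition tuples :: "nat \<Rightarrow> nat \<Rightarrow> nat \<Rightarrow> (nat \<Rightarrow> nat) set" where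
  "tuples k l N = {n \<in> {l..k-1} \<rightarrow>\<^sub>E UNIV. tail_sum k n l = N}"

lemma tuples_last: "tuples k (k-1) N = {(\<lambda>_. undefined)(k-1 := N)}"
proof (intro equalityI subsetI)
  fix n assume n: "n \<in> tuples k (k-1) N"
  have "n m = ((\<lambda>_. undefined)(k-1 := N)) m" for m
    using n by (cases "m = k - 1") (auto simp: tuples_def tail_sum_def PiE_def extensional_def)
  then show "n \<in> {(\<lambda>_. undefined)(k-1 := N)}" by blast
qed (auto simp: tuples_def tail_sum_def PiE_def extensional_def)

text \<open>Since n_l = N_l - N_(l+1), fixing N_l = N leaves N_(l+1) = s \<le> N and the later
  entries free: peeling off one index is one step of \<open>chain\<close>.\<close>

lemma sum_tuples_Suc:
  assumes "Suc l \<le> k - 1"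
    and fin: "\<And>s. finite (tuples k (Suc l) s)"
  shows "finite (tuples k l N)"
    and "(\<Sum>n\<in>tuples k l N. f n) = (\<Sum>s\<le>N. \<Sum>n\<in>tuples k (Suc l) s. f (n(l := N - s)))"
proof -
  let ?S = "Sigma {..N} (tuples k (Suc l))"
  let ?g = "\<lambda>(s, n). n(l := N - s)"
  have bij: "bij_betw ?g ?S (tuples k l N)"
  \<comment> \<open>Tuples are extensional, so forgetting the entry at l means resetting it to
    \<open>undefined\<close>.\<close>
  proof (rule bij_betwI[where g = "\<lambda>n. (tail_sum k n (Suc l), n(l := undefined))"])
    show "?g \<in> ?S \<rightarrow> tuples k l N"
    proof safe
      fix s n assume *: "s \<le> N" "n \<in> tuples k (Suc l) s"
      have "tail_sum k (n(l := N - s)) (Suc l) = s"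
        using *(2) tail_sum_cong[of "Suc l" k "n(l := N - s)" n] by (simp add: tuples_def)
      then show "n(l := N - s) \<in> tuples k l N"
        using * assms(1) by (auto simp: tuples_def tail_sum_rec[of l] PiE_def extensional_def)
    qed
    show "(\<lambda>n. (tail_sum k n (Suc l), n(l := undefined))) \<in> tuples k l N \<rightarrow> ?S"
    proof safe
      fix n assume *: "n \<in> tuples k l N"
      show "tail_sum k n (Suc l) \<le> N" using * assms(1) by (auto simp: tuples_def tail_sum_rec[of l])
      show "n(l := undefined) \<in> tuples k (Suc l) (tail_sum k n (Suc l))"
        using * tail_sum_cong[of "Suc l" k "n(l := undefined)" n]
        by (auto simp: tuples_def PiE_def extensional_def)
    qed
    fix x assume "x \<in> ?S"
    then obtain s n where x: "x = (s, n)" "s \<le> N" "n \<in> tuples k (Suc l) s" by auto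
    have "tail_sum k (n(l := N - s)) (Suc l) = s"
      using x(3) tail_sum_cong[of "Suc l" k "n(l := N - s)" n] by (simp add: tuples_def)
    moreover have "n(l := undefined) = n" using x(3) by (auto simp: tuples_def PiE_def extensional_def)
    ultimately show "(tail_sum k (?g x) (Suc l), (?g x)(l := undefined)) = x" using x(1) by simp
  next
    fix n assume "n \<in> tuples k l N"
    then have "n l + tail_sum k n (Suc l) = N"
      using assms(1) by (simp add: tuples_def tail_sum_rec[of l])
    then show "?g (tail_sum k n (Suc l), n(l := undefined)) = n" by auto
  qed
  have fS: "finite ?S" by (intro finite_SigmaI fin) auto
  then show "finite (tuples k l N)" using bij_betw_finite[OF bij] by simp
  have "(\<Sum>n\<in>tuples k l N. f n) = (\<Sum>x\<in>?S. f (?g x))"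
    by (rule sum.reindex_bij_betw[OF bij, symmetric])
  also have "\<dots> = (\<Sum>s\<le>N. \<Sum>n\<in>tuples k (Suc l) s. f (n(l := N - s)))"
    by (subst sum.Sigma) (auto simp: fin case_prod_unfold)
  finally show "(\<Sum>n\<in>tuples k l N. f n) = (\<Sum>s\<le>N. \<Sum>n\<in>tuples k (Suc l) s. f (n(l := N - s)))" .
qed

lemma bij_betw_tuples: "bij_betw snd (Sigma UNIV (tuples k 1)) ({1..k-1} \<rightarrow>\<^sub>E UNIV)"
  unfolding bij_betw_def
proof
  show "inj_on snd (Sigma UNIV (tuples k 1))"
    by (rule inj_onI) (unfold tuples_def, clarsimp)
  show "snd ` Sigma UNIV (tuples k 1) = {1..k-1} \<rightarrow>\<^sub>E UNIV"
  proof (intro equalityI subsetI)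
    fix n assume "n \<in> snd ` Sigma UNIV (tuples k 1)"
    then obtain N where "n \<in> tuples k 1 N" by force
    then show "n \<in> {1..k-1} \<rightarrow>\<^sub>E UNIV" unfolding tuples_def by blast
  next
    fix n :: "nat \<Rightarrow> nat" assume "n \<in> {1..k-1} \<rightarrow>\<^sub>E UNIV"
    then have "n \<in> tuples k 1 (tail_sum k n 1)" unfolding tuples_def by blast
    then show "n \<in> snd ` Sigma UNIV (tuples k 1)" by (intro image_eqI[of _ _ "(tail_sum k n 1, n)"] SigmaI) simp_all
  qed
qed

context nome begin

text \<open>The q-power starts at \<open>Suc l\<close> although the product starts at l: with N_l
  fixed, its own power belongs to the next outer summation, exactly as in
  \<open>chain\<close>.\<close>

definition tweight :: "nat \<Rightarrow> (nat \<Rightarrow> nat) \<Rightarrow> nat \<Rightarrow> (nat \<Rightarrow> nat) \<Rightarrow> complex" where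
  "tweight k e l n = q ^ (\<Sum>j=Suc l..k-1. (tail_sum k n j)\<^sup>2 + e (k-1-j) * tail_sum k n j) /
     ((\<Prod>m=l..k-2. qpoch q q (n m)) * qpoch (q\<^sup>2) (q\<^sup>2) (n (k-1)))"

lemma tweight_Suc:
  assumes "Suc l \<le> k - 1" "n \<in> tuples k (Suc l) s" "s \<le> N"
  shows "tweight k e l (n(l := N - s)) = q ^ (s\<^sup>2 + e (k-2-l) * s) * rq (int N - int s) * tweight k e (Suc l) n"
proof -
  have t: "tail_sum k (n(l := N - s)) j = tail_sum k n j" if "j > l" for j
    using that by (intro tail_sum_cong) auto
  have s: "tail_sum k n (Suc l) = s" using assms(2) by (simp add: tuples_def)
  have "(\<Sum>j=Suc l..k-1. (tail_sum k (n(l := N - s)) j)\<^sup>2 + e (k-1-j) * tail_sum k (n(l := N - s)) j)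
      = (\<Sum>j=Suc l..k-1. (tail_sum k n j)\<^sup>2 + e (k-1-j) * tail_sum k n j)"
    by (intro sum.cong refl) (simp add: t)
  also have "\<dots> = s\<^sup>2 + e (k-2-l) * s + (\<Sum>j=Suc (Suc l)..k-1. (tail_sum k n j)\<^sup>2 + e (k-1-j) * tail_sum k n j)"
  proof -
    have "k - 1 - Suc l = k - 2 - l" by simp
    then show ?thesis using assms(1) s by (simp add: sum.atLeast_Suc_atMost[of "Suc l"])
  qed
  finally have 1: "(\<Sum>j=Suc l..k-1. (tail_sum k (n(l := N - s)) j)\<^sup>2 + e (k-1-j) * tail_sum k (n(l := N - s)) j)
     = s\<^sup>2 + e (k-2-l) * s + (\<Sum>j=Suc (Suc l)..k-1. (tail_sum k n j)\<^sup>2 + e (k-1-j) * tail_sum k n j)" .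
  have "l \<le> k - 2" using assms(1) by simp
  then have "(\<Prod>m=l..k-2. qpoch q q ((n(l := N - s)) m))
     = qpoch q q ((n(l := N - s)) l) * (\<Prod>m=Suc l..k-2. qpoch q q ((n(l := N - s)) m))"
    by (rule prod.atLeast_Suc_atMost)
  also have "\<dots> = qpoch q q (N - s) * (\<Prod>m=Suc l..k-2. qpoch q q (n m))"
    by (intro arg_cong2[where f = "(*)"] prod.cong) auto
  finally have 2: "(\<Prod>m=l..k-2. qpoch q q ((n(l := N - s)) m)) = qpoch q q (N - s) * (\<Prod>m=Suc l..k-2. qpoch q q (n m))" .
  have 3: "rq (int N - int s) = 1 / qpoch q q (N - s)"
    using rq_nat[of "N - s"] assms(3) by (simp add: of_nat_diff)
  have 4: "(n(l := N - s)) (k-1) = n (k-1)" using assms(1) by auto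
  show ?thesis unfolding tweight_def 1 2 3 4 by (simp add: power_add)
qed

lemma sum_tweight:
  assumes "k \<ge> 2" "d \<le> k - 1"
  shows "finite (tuples k (k-1-d) N) \<and> (\<Sum>n\<in>tuples k (k-1-d) N. tweight k e (k-1-d) n) = chain e d N"
  using assms(2)
proof (induction d arbitrary: N)
  case 0
  \<comment> \<open>For k \<ge> 2 the product over \<open>{k-1..k-2}\<close> is empty, which leaves
    only the factor for n_(k-1).\<close>
  have "\<not> k - 1 \<le> k - 2" using assms(1) by simp
  then show ?case using tuples_last[of k N] by (simp add: tweight_def)
next
  case (Suc d)
  define l where "l = k - 1 - Suc d"
  have l: "Suc l = k - 1 - d" "Suc l \<le> k - 1" "k - 2 - l = d" using Suc.prems by (auto simp: l_def)
  have IH: "finite (tuples k (Suc l) s)" "(\<Sum>n\<in>tuples k (Suc l) s. tweight k e (Suc l) n) = chain e d s" for s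
    using Suc.IH[of s] Suc.prems unfolding l(1) by auto
  have "(\<Sum>n\<in>tuples k l N. tweight k e l n)
     = (\<Sum>s\<le>N. \<Sum>n\<in>tuples k (Suc l) s. q ^ (s\<^sup>2 + e d * s) * rq (int N - int s) * tweight k e (Suc l) n)"
    unfolding sum_tuples_Suc(2)[OF l(2) IH(1)]
  proof (rule sum.cong[OF refl], rule sum.cong[OF refl])
    fix s n assume "s \<in> {..N}" "n \<in> tuples k (Suc l) s"
    then show "tweight k e l (n(l := N - s)) = q ^ (s\<^sup>2 + e d * s) * rq (int N - int s) * tweight k e (Suc l) n"
      using tweight_Suc[OF l(2), of n s N e] unfolding l(3) by simp
  qed
  also have "\<dots> = chain e (Suc d) N"
    by (simp add: sum_distrib_left[symmetric] IH(2))
  finally show ?case using sum_tuples_Suc(1)[OF l(2) IH(1)] unfolding l_def by simp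
qed

text \<open>The factor q^(N_1) alone dominates: N_1 is the sum of all n_m, so its norm is a product
  of geometric terms, one per coordinate, while the reciprocal q-factorials are bounded and the
  remaining power has norm at most 1.\<close>

lemma tweight_summable:
  assumes "k \<ge> 2"
  shows "(\<lambda>n. norm (q ^ ((tail_sum k n 1)\<^sup>2 + e (k-2) * tail_sum k n 1) * tweight k e 1 n))
           summable_on ({1..k-1} \<rightarrow>\<^sub>E UNIV)"
proof -
  interpret sq: nome "q\<^sup>2"
    using q_nz q_lt_1 by unfold_locales (auto simp: norm_power power_less_one_iff)
  obtain B where B: "B > 0" "\<And>m. norm (sq.rq m) \<le> B" by (rule sq.rq_bounded) blast
  obtain C where C: "C > 0" "\<And>m. norm (rq m) \<le> C" by (rule rq_bounded) blast
  have "Infinite_Set_Sum.abs_summable_on (\<lambda>g. \<Prod>m\<in>{1..k-1}. norm q ^ g m) ({1..k-1} \<rightarrow>\<^sub>E (UNIV::nat set))"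
  proof (rule abs_summable_on_prod_PiE)
    have "(\<lambda>n. norm (norm q ^ n)) summable_on (UNIV :: nat set)"
      using q_lt_1 by (auto simp: summable_on_UNIV_nonneg_real_iff intro: summable_geometric)
    then show "Infinite_Set_Sum.abs_summable_on (\<lambda>n. norm q ^ n) (UNIV::nat set)"
      using abs_summable_equivalent by blast
  qed auto
  then have "(\<lambda>g. norm (\<Prod>m\<in>{1..k-1}. norm q ^ g m)) summable_on ({1..k-1} \<rightarrow>\<^sub>E (UNIV::nat set))"
    by (rule iffD2[OF abs_summable_equivalent[of "\<lambda>g. \<Prod>m\<in>{1..k-1}. norm q ^ g m" "{1..k-1} \<rightarrow>\<^sub>E (UNIV::nat set)"]])
  then have sm: "(\<lambda>g. norm (\<Prod>m\<in>{1..k-1}. norm q ^ g m) * (C ^ card {1..k-2} * B)) summable_on ({1..k-1} \<rightarrow>\<^sub>E (UNIV::nat set))"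
    by (rule summable_on_cmult_left)
  show ?thesis
  proof (rule summable_on_comparison_test[OF sm])
    fix n :: "nat \<Rightarrow> nat" assume "n \<in> {1..k-1} \<rightarrow>\<^sub>E UNIV"
    have "norm (q ^ ((tail_sum k n 1)\<^sup>2 + e (k-2) * tail_sum k n 1) * tweight k e 1 n)
      = norm q ^ ((tail_sum k n 1)\<^sup>2 + e (k-2) * tail_sum k n 1) *
        norm q ^ (\<Sum>j=Suc 1..k-1. (tail_sum k n j)\<^sup>2 + e (k-1-j) * tail_sum k n j) *
        ((\<Prod>m=1..k-2. norm (rq (int (n m)))) * norm (sq.rq (int (n (k-1)))))"
      by (simp add: tweight_def rq_nat sq.rq_nat norm_mult norm_divide norm_power prod_norm prod_dividef)
    also have "\<dots> \<le> norm q ^ (tail_sum k n 1) * 1 * (C ^ card {1..k-2} * B)"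
    proof (intro mult_mono mult_nonneg_nonneg prod_nonneg)
      show "norm q ^ ((tail_sum k n 1)\<^sup>2 + e (k-2) * tail_sum k n 1) \<le> norm q ^ tail_sum k n 1"
        using q_lt_1 by (intro power_decreasing) (auto simp: power2_eq_square trans_le_add1)
      show "norm q ^ (\<Sum>j=Suc 1..k-1. (tail_sum k n j)\<^sup>2 + e (k-1-j) * tail_sum k n j) \<le> 1"
        using q_lt_1 by (intro power_le_one) auto
      show "(\<Prod>m=1..k-2. norm (rq (int (n m)))) \<le> C ^ card {1..k-2}"
        using prod_mono[of "{1..k-2}" "\<lambda>m. norm (rq (int (n m)))" "\<lambda>_. C"] C by (simp only: prod_constant) auto
      show "norm (sq.rq (int (n (k-1)))) \<le> B" by (rule B)
    qed (use B C in auto)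
    also have "norm q ^ tail_sum k n 1 = norm (\<Prod>m\<in>{1..k-1}. norm q ^ n m)"
      by (simp add: tail_sum_def power_sum abs_prod)
    finally show "norm (q ^ ((tail_sum k n 1)\<^sup>2 + e (k-2) * tail_sum k n 1) * tweight k e 1 n)
      \<le> norm (\<Prod>m\<in>{1..k-1}. norm q ^ n m) * (C ^ card {1..k-2} * B)" by simp
  qed auto
qed

text \<open>Grouping the tuples by N_1 leaves finite inner sums, which are chains. Because N_j
  carries the switch \<open>e (k-1-j)\<close>, the linear terms with j \<ge> i are the chain
  positions below k - i.\<close>

lemma x2k_eq_chain:
  assumes k: "k \<ge> 2" and i: "1 \<le> i" "i \<le> k"
  defines "e \<equiv> \<lambda>j. if j < k - i then 1 else 0"
  shows "x2k k i q = (\<Sum>\<^sub>\<infinity>s. q ^ (s\<^sup>2 + e (k-2) * s) * chain e (k-2) s)"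
proof -
  let ?P = "{1..k-1} \<rightarrow>\<^sub>E (UNIV :: nat set)"
  let ?t = "\<lambda>n. q ^ ((tail_sum k n 1)\<^sup>2 + e (k-2) * tail_sum k n 1) * tweight k e 1 n"
  have "x2k k i q = infsum ?t ?P"
    unfolding x2k_def
  proof (rule infsum_cong)
    fix n
    have "(\<Sum>j=i..k-1. tail_sum k n j) = (\<Sum>j=1..k-1. e (k-1-j) * tail_sum k n j)"
      unfolding e_def using i by (intro sum.mono_neutral_cong_left) auto
    then have "(\<Sum>j=1..k-1. (tail_sum k n j)\<^sup>2) + (\<Sum>j=i..k-1. tail_sum k n j)
       = (\<Sum>j=1..k-1. (tail_sum k n j)\<^sup>2 + e (k-1-j) * tail_sum k n j)"
      by (simp add: sum.distrib)
    also have "\<dots> = (tail_sum k n 1)\<^sup>2 + e (k-2) * tail_sum k n 1 +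
        (\<Sum>j=Suc 1..k-1. (tail_sum k n j)\<^sup>2 + e (k-1-j) * tail_sum k n j)"
      using k sum.atLeast_Suc_atMost[of 1 "k-1" "\<lambda>j. (tail_sum k n j)\<^sup>2 + e (k-1-j) * tail_sum k n j"]
      unfolding diff_diff_left one_add_one by linarith
    finally show "q ^ ((\<Sum>j=1..k-1. (tail_sum k n j)\<^sup>2) + (\<Sum>j=i..k-1. tail_sum k n j)) /
     ((\<Prod>m=1..k-2. qpoch q q (n m)) * qpoch (q\<^sup>2) (q\<^sup>2) (n (k-1))) = ?t n"
      unfolding tweight_def by (simp add: power_add)
  qed
  also have "\<dots> = (\<Sum>\<^sub>\<infinity>x\<in>Sigma UNIV (tuples k 1). ?t (snd x))"
    by (rule infsum_reindex_bij_betw[OF bij_betw_tuples, symmetric])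
  also have "\<dots> = (\<Sum>\<^sub>\<infinity>s. \<Sum>\<^sub>\<infinity>n\<in>tuples k 1 s. ?t n)"
  proof (subst infsum_Sigma_banach[symmetric])
    have "(?t summable_on ?P)" using tweight_summable[OF k, of e] by (rule abs_summable_summable)
    then show "(\<lambda>x. ?t (snd x)) summable_on Sigma UNIV (tuples k 1)"
      using summable_on_reindex_bij_betw[OF bij_betw_tuples, of ?t k] by blast
  qed simp
  also have "\<dots> = (\<Sum>\<^sub>\<infinity>s. q ^ (s\<^sup>2 + e (k-2) * s) * chain e (k-2) s)"
  proof (rule infsum_cong)
    fix s
    have l: "k - 1 - (k - 2) = 1" using k by simp
    have *: "finite (tuples k 1 s)" "(\<Sum>n\<in>tuples k 1 s. tweight k e 1 n) = chain e (k-2) s"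
      using sum_tweight[OF k, of "k-2" s e] unfolding l by auto
    have "(\<Sum>\<^sub>\<infinity>n\<in>tuples k 1 s. ?t n) = (\<Sum>n\<in>tuples k 1 s. q ^ (s\<^sup>2 + e (k-2) * s) * tweight k e 1 n)"
      using *(1) by (subst infsum_finite) (auto simp: tuples_def intro!: sum.cong)
    then show "(\<Sum>\<^sub>\<infinity>n\<in>tuples k 1 s. ?t n) = q ^ (s\<^sup>2 + e (k-2) * s) * chain e (k-2) s"
      unfolding sum_distrib_left[symmetric] *(2) .
  qed
  finally show ?thesis .
qed

text \<open>The number k - i of linear terms becomes the linear coefficient; i \<ge> 1 keeps it
  within the k - 1 steps.\<close>

theorem bressoud:
  assumes "k \<ge> 2" "1 \<le> i" "i \<le> k"
  shows "(\<Sum>\<^sub>\<infinity>n. sgn_pow n * q powi (n\<^sup>2 + tri n)) * x2k k i q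
       = (\<Sum>\<^sub>\<infinity>n. bterm (int k) (int (k - i)) n)"
proof -
  have "int (k - 2) + 2 = int k" using assms by simp
  then show ?thesis
    using bressoud_chain[of "k - i" "\<lambda>j. if j < k - i then 1 else 0" "k - 2"] assms
    unfolding x2k_eq_chain[OF assms] by simp
qed

lemma pentagonal_nonzero: "(\<Sum>\<^sub>\<infinity>n. sgn_pow n * q powi (n\<^sup>2 + tri n)) \<noteq> 0"
proof -
  obtain \<rho> where \<rho>: "\<rho> \<noteq> 0" "(\<lambda>N. rq (int N)) \<longlonglongrightarrow> \<rho>" by (rule rq_limit)
  then show ?thesis using pentagonal[OF \<rho>(2,1)] by simp
qed

end


section \<open>Poisson summation for the Gaussian\<close>

lemma infsum_integral_interchange:
  fixes f :: "int \<Rightarrow> real \<Rightarrow> real"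
  assumes cont: "\<And>n. continuous_on {0..1} (f n)"
    and bd: "\<And>n x. x \<in> {0..1} \<Longrightarrow> \<bar>f n x\<bar> \<le> B n" and B: "B summable_on UNIV"
  shows "continuous_on {0..1} (\<lambda>x. \<Sum>\<^sub>\<infinity>n. f n x)"
    and "((\<lambda>n. integral {0..1} (f n)) has_sum integral {0..1} (\<lambda>x. \<Sum>\<^sub>\<infinity>n. f n x)) UNIV"
proof -
  have ul: "uniform_limit {0..1} (\<lambda>X x. \<Sum>n\<in>X. f n x) (\<lambda>x. \<Sum>\<^sub>\<infinity>n. f n x) (finite_subsets_at_top UNIV)"
    by (rule Weierstrass_m_test_general[OF _ B]) (use bd in auto)
  have ct: "continuous_on {0..1} (\<lambda>x. \<Sum>n\<in>X. f n x)" for X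
    by (intro continuous_intros cont)
  show "continuous_on {0..1} (\<lambda>x. \<Sum>\<^sub>\<infinity>n. f n x)"
    by (rule uniform_limit_theorem[OF _ ul]) (auto intro!: always_eventually ct)
  obtain I J where I: "\<And>X. ((\<lambda>x. \<Sum>n\<in>X. f n x) has_integral I X) {0..1}"
    and J: "((\<lambda>x. \<Sum>\<^sub>\<infinity>n. f n x) has_integral J) {0..1}" and IJ: "(I \<longlongrightarrow> J) (finite_subsets_at_top UNIV)"
    by (rule uniform_limit_integral[OF ul ct]) auto
  have fi: "f n integrable_on {0..1}" for n by (intro integrable_continuous_real cont)
  have "\<forall>\<^sub>F X in finite_subsets_at_top UNIV. I X = (\<Sum>n\<in>X. integral {0..1} (f n))"
    by (rule eventually_mono[OF eventually_finite_subsets_at_top_weakI[of _ "\<lambda>X. finite X"]])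
      (simp_all add: integral_sum[symmetric] fi integral_unique[OF I])
  from Lim_transform_eventually[OF IJ this] J
  show "((\<lambda>n. integral {0..1} (f n)) has_sum integral {0..1} (\<lambda>x. \<Sum>\<^sub>\<infinity>n. f n x)) UNIV"
    unfolding has_sum_def by (simp add: integral_unique)
qed

text \<open>The symmetry about 1/2 makes h a continuous function of cos (2 pi x). Approximating that
  function uniformly by polynomials, to which h is orthogonal, bounds the integral of h^2 by e times
  the integral of |h| for every e > 0.\<close>

lemma even_fourier_zero:
  fixes h :: "real \<Rightarrow> real"
  assumes cont: "continuous_on {0..1} h" and even: "\<And>x. x \<in> {0..1} \<Longrightarrow> h (1 - x) = h x"
    and coeff: "\<And>m::int. integral {0..1} (\<lambda>x. h x * cos (2 * pi * m * x)) = 0"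
    and x: "x \<in> {0..1}"
  shows "h x = 0"
proof -
  note ci = continuous_intros cont integrable_continuous_real
  \<comment> \<open>The power of the cosine can be raised since the product formula replaces m by 1
    - m and 1 + m, both covered by the induction hypothesis.\<close>
  have pow: "integral {0..1} (\<lambda>x. h x * cos (2 * pi * x) ^ i * cos (2 * pi * real_of_int m * x)) = 0" for i m
  proof (induction i arbitrary: m)
    case 0
    then show ?case using coeff[of m] by simp
  next
    case (Suc i)
    have "integral {0..1} (\<lambda>x. h x * cos (2 * pi * x) ^ Suc i * cos (2 * pi * real_of_int m * x))
      = integral {0..1} (\<lambda>x. (h x * cos (2 * pi * x) ^ i * cos (2 * pi * real_of_int (1 - m) * x)
          + h x * cos (2 * pi * x) ^ i * cos (2 * pi * real_of_int (1 + m) * x)) / 2)"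
    proof (rule integral_cong)
      fix x
      have "cos (2 * pi * x) * cos (2 * pi * real_of_int m * x)
        = (cos (2 * pi * real_of_int (1 - m) * x) + cos (2 * pi * real_of_int (1 + m) * x)) / 2"
        unfolding cos_times_cos by (simp add: algebra_simps)
      then have "h x * cos (2 * pi * x) ^ i * (cos (2 * pi * x) * cos (2 * pi * real_of_int m * x))
        = h x * cos (2 * pi * x) ^ i * ((cos (2 * pi * real_of_int (1 - m) * x) + cos (2 * pi * real_of_int (1 + m) * x)) / 2)"
        by simp
      then show "h x * cos (2 * pi * x) ^ Suc i * cos (2 * pi * real_of_int m * x)
       = (h x * cos (2 * pi * x) ^ i * cos (2 * pi * real_of_int (1 - m) * x)
          + h x * cos (2 * pi * x) ^ i * cos (2 * pi * real_of_int (1 + m) * x)) / 2"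
        unfolding power_Suc by (simp only: distrib_left mult.assoc mult.left_commute times_divide_eq_right)
    qed
    also have "\<dots> = (integral {0..1} (\<lambda>x. h x * cos (2 * pi * x) ^ i * cos (2 * pi * real_of_int (1 - m) * x))
          + integral {0..1} (\<lambda>x. h x * cos (2 * pi * x) ^ i * cos (2 * pi * real_of_int (1 + m) * x))) / 2"
      unfolding integral_divide by (subst integral_add) (auto intro!: ci)
    also have "\<dots> = 0" unfolding Suc.IH by simp
    finally show ?case .
  qed
  define H where "H u = h (arccos u / (2 * pi))" for u
  have contH: "continuous_on {-1..1} H"
    unfolding H_def
  proof (rule continuous_on_compose2[OF cont])
    show "continuous_on {-1..1} (\<lambda>u. arccos u / (2 * pi))" by (intro continuous_intros) auto
    show "(\<lambda>u. arccos u / (2 * pi)) ` {-1..1} \<subseteq> {0..1}"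
    proof safe
      fix u :: real assume "u \<in> {-1..1}"
      then show "arccos u / (2 * pi) \<in> {0..1}"
        using arccos_lbound[of u] arccos_ubound[of u] by simp
    qed
  qed
  have H: "H (cos (2 * pi * x)) = h x" if "x \<in> {0..1}" for x
  proof (cases "x \<le> 1 / 2")
    case True
    then have "arccos (cos (2 * pi * x)) = 2 * pi * x"
      using that by (intro arccos_cos) (auto simp: mult_le_cancel_left_pos)
    then show ?thesis by (simp add: H_def)
  next
    case False
    have "cos (2 * pi * x) = cos (2 * pi - 2 * pi * x)" by (simp add: cos_diff)
    also have "\<dots> = cos (2 * pi * (1 - x))" by (simp add: algebra_simps)
    also have "arccos \<dots> = 2 * pi * (1 - x)"
      using that False by (intro arccos_cos) (auto simp: mult_le_cancel_left_pos)
    finally show ?thesis using even[OF that] by (simp add: H_def)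
  qed
  have ih: "(\<lambda>x. h x * cos (2 * pi * x) ^ i) integrable_on {0..1}" for i by (intro ci)
  have hh: "(\<lambda>x. h x * h x) integrable_on {0..1}" by (intro ci)
  have hb: "(\<lambda>x. \<bar>h x\<bar>) integrable_on {0..1}" by (intro ci)
  have small: "integral {0..1} (\<lambda>x. h x * h x) \<le> e * integral {0..1} (\<lambda>x. \<bar>h x\<bar>)" if e: "e > 0" for e
  proof -
    obtain p where p: "real_polynomial_function p" "\<And>u. u \<in> {-1..1} \<Longrightarrow> \<bar>H u - p u\<bar> < e"
      using Stone_Weierstrass_real_polynomial_function[OF compact_Icc contH e] by blast
    obtain a n where an: "p = (\<lambda>u. \<Sum>i\<le>n. a i * u ^ i)"
      using p(1) unfolding real_polynomial_function_iff_sum by blast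
    have "((\<lambda>x. h x * p (cos (2 * pi * x))) has_integral (\<Sum>i\<le>n. a i * 0)) {0..1}"
    proof -
      have "((\<lambda>x. \<Sum>i\<le>n. a i * (h x * cos (2 * pi * x) ^ i)) has_integral (\<Sum>i\<le>n. a i * 0)) {0..1}"
      proof (intro has_integral_sum has_integral_mult_right)
        fix i
        show "((\<lambda>x. h x * cos (2 * pi * x) ^ i) has_integral 0) {0..1}"
          using integrable_integral[OF ih[of i]] pow[of i 0] by simp
      qed auto
      then show ?thesis unfolding an by (simp add: sum_distrib_left algebra_simps)
    qed
    then have p0: "integral {0..1} (\<lambda>x. h x * p (cos (2 * pi * x))) = 0"
      and pI: "(\<lambda>x. h x * p (cos (2 * pi * x))) integrable_on {0..1}"
      by (auto simp: integral_unique has_integral_integrable)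
    have "integral {0..1} (\<lambda>x. h x * h x) = integral {0..1} (\<lambda>x. h x * h x - h x * p (cos (2 * pi * x)))"
      using p0 by (simp add: integral_diff[OF hh pI])
    also have "\<dots> \<le> integral {0..1} (\<lambda>x. e * \<bar>h x\<bar>)"
    proof (rule integral_le)
      show "(\<lambda>x. h x * h x - h x * p (cos (2 * pi * x))) integrable_on {0..1}"
        by (intro integrable_diff hh pI)
      show "(\<lambda>x. e * \<bar>h x\<bar>) integrable_on {0..1}" by (intro ci)
      fix x :: real assume x: "x \<in> {0..1}"
      have "\<bar>h x - p (cos (2 * pi * x))\<bar> \<le> e"
        using p(2)[of "cos (2 * pi * x)"] H[OF x] by simp
      have "h x * h x - h x * p (cos (2 * pi * x)) = h x * (h x - p (cos (2 * pi * x)))"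
        by (simp add: algebra_simps)
      also have "\<dots> \<le> \<bar>h x\<bar> * \<bar>h x - p (cos (2 * pi * x))\<bar>" by (metis abs_ge_self abs_mult)
      also have "\<dots> \<le> \<bar>h x\<bar> * e"
        using \<open>\<bar>h x - p (cos (2 * pi * x))\<bar> \<le> e\<close> by (intro mult_left_mono) auto
      finally show "h x * h x - h x * p (cos (2 * pi * x)) \<le> e * \<bar>h x\<bar>" by (simp add: mult.commute)
    qed
    also have "\<dots> = e * integral {0..1} (\<lambda>x. \<bar>h x\<bar>)" by simp
    finally show ?thesis .
  qed
  have "integral {0..1} (\<lambda>x. h x * h x) \<le> 0"
  proof (rule ccontr)
    let ?I = "integral {0..1} (\<lambda>x. h x * h x)" and ?A = "integral {0..1} (\<lambda>x. \<bar>h x\<bar>)"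
    assume "\<not> ?I \<le> 0"
    moreover have A: "?A \<ge> 0" by (intro integral_nonneg hb) auto
    \<comment> \<open>The choice e = I / (2 (A + 1)) gives e A < I, with A + 1 keeping the
      denominator positive.\<close>
    ultimately have "?I \<le> ?I / (2 * (?A + 1)) * ?A" by (intro small) auto
    also have "\<dots> < ?I"
    proof -
      have "?A * ?I \<ge> 0" using \<open>\<not> ?I \<le> 0\<close> A by (intro mult_nonneg_nonneg) auto
      then have "0 < 2 * ?I + ?A * ?I" using \<open>\<not> ?I \<le> 0\<close> by linarith
      then show ?thesis using A by (simp add: field_simps)
    qed
    finally show False by simp
  qed
  moreover have "integral {0..1} (\<lambda>x. h x * h x) \<ge> 0" by (intro integral_nonneg hh) auto
  ultimately have "integral {0..1} (\<lambda>x. h x * h x) = 0" by simp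
  moreover have "continuous_on {0..1} (\<lambda>x. h x * h x)" by (intro continuous_intros cont)
  ultimately have "h x * h x = 0"
    using integral_eq_0_iff[of 0 1 "\<lambda>x. h x * h x"] x by simp
  then show ?thesis by simp
qed

text \<open>The characteristic function of the standard normal distribution settles a = 1/2 through
  its real part; a linear substitution yields the other a.\<close>

lemma gaussian_cos_integral:
  fixes a b :: real
  assumes "a > 0"
  shows "integrable lborel (\<lambda>x. exp (- a * x\<^sup>2) * cos (b * x))"
    and "(LINT x|lborel. exp (- a * x\<^sup>2) * cos (b * x)) = sqrt (pi / a) * exp (- b\<^sup>2 / (4 * a))"
proof -
  have std: "integrable lborel (\<lambda>x. std_normal_density x * cos (s * x))" for s
  proof (rule Bochner_Integration.integrable_bound)
    show "integrable lborel std_normal_density" by simp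
    show "AE x in lborel. norm (std_normal_density x * cos (s * x)) \<le> norm (std_normal_density x)"
      by (intro AE_I2) (simp add: abs_mult mult_left_le)
  qed simp
  have stdi: "integrable lborel (\<lambda>x. std_normal_density x *\<^sub>R iexp (s * x))" for s
  proof (rule Bochner_Integration.integrable_bound)
    show "integrable lborel std_normal_density" by simp
    show "AE x in lborel. norm (std_normal_density x *\<^sub>R iexp (s * x)) \<le> norm (std_normal_density x)"
      by (intro AE_I2) (simp add: norm_exp_i_times)
  qed simp
  have val: "(LINT x|lborel. std_normal_density x * cos (s * x)) = exp (- s\<^sup>2 / 2)" for s
  proof -
    have "complex_of_real (exp (- s\<^sup>2 / 2)) = (LINT x|std_normal_distribution. iexp (s * x))"
      using char_std_normal_distribution by (simp add: char_def fun_eq_iff)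
    also have "\<dots> = (LINT x|lborel. std_normal_density x *\<^sub>R iexp (s * x))"
      by (intro integral_density) auto
    finally have "exp (- s\<^sup>2 / 2) = Re (LINT x|lborel. std_normal_density x *\<^sub>R iexp (s * x))"
      by (metis Re_complex_of_real)
    also have "\<dots> = (LINT x|lborel. Re (std_normal_density x *\<^sub>R iexp (s * x)))"
      by (rule integral_Re[symmetric, OF stdi])
    also have "\<dots> = (LINT x|lborel. std_normal_density x * cos (s * x))"
      by (simp add: Re_exp)
    finally show ?thesis by simp
  qed
  \<comment> \<open>Chosen so that a (c x)^2 = x^2 / 2.\<close>
  define c where "c = 1 / sqrt (2 * a)"
  have c: "c > 0" "c\<^sup>2 = 1 / (2 * a)" using assms by (simp_all add: c_def power_divide)
  have eq: "exp (- a * (0 + c * x)\<^sup>2) * cos (b * (0 + c * x)) = sqrt (2 * pi) * (std_normal_density x * cos ((b * c) * x))" for x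
    using c assms by (simp add: std_normal_density_def power_mult_distrib mult_ac)
  show "integrable lborel (\<lambda>x. exp (- a * x\<^sup>2) * cos (b * x))"
  proof -
    have "integrable lborel (\<lambda>x. exp (- a * (0 + c * x)\<^sup>2) * cos (b * (0 + c * x)))"
      unfolding eq by (intro Bochner_Integration.integrable_mult_right std)
    then show ?thesis
      using lborel_integrable_real_affine_iff[of c "\<lambda>x. exp (- a * x\<^sup>2) * cos (b * x)" 0] c(1) by blast
  qed
  have "(LINT x|lborel. exp (- a * x\<^sup>2) * cos (b * x)) = \<bar>c\<bar> *\<^sub>R (LINT x|lborel. exp (- a * (0 + c * x)\<^sup>2) * cos (b * (0 + c * x)))"
    using c(1) by (intro lborel_integral_real_affine) auto
  also have "\<dots> = c * (sqrt (2 * pi) * exp (- (b * c)\<^sup>2 / 2))"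
    unfolding eq using c(1) val[of "b * c"] by simp
  also have "(b * c)\<^sup>2 / 2 = b\<^sup>2 / (4 * a)" using c(2) by (simp add: power_mult_distrib)
  then have "- (b * c)\<^sup>2 / 2 = - b\<^sup>2 / (4 * a)" by simp
  also have "c * (sqrt (2 * pi) * exp (- b\<^sup>2 / (4 * a))) = sqrt (pi / a) * exp (- b\<^sup>2 / (4 * a))"
    using assms by (simp add: c_def real_sqrt_mult real_sqrt_divide)
  finally show "(LINT x|lborel. exp (- a * x\<^sup>2) * cos (b * x)) = sqrt (pi / a) * exp (- b\<^sup>2 / (4 * a))" .
qed

text \<open>From (n + 2 x)^2 \<ge> 0 follows (n + x)^2 \<ge> n^2 / 2 - x^2, and n^2 \<ge> |n| leaves
  a geometric majorant.\<close>

lemma gauss_bound: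
  fixes n :: int and x a :: real
  assumes "a > 0"
  shows "exp (- a * (n + x)\<^sup>2) \<le> exp (a * x\<^sup>2) * exp (- (a / 2)) ^ nat \<bar>n\<bar>"
proof -
  have "real_of_int \<bar>n\<bar> \<le> real_of_int (n\<^sup>2)"
    using int_le_square[of "\<bar>n\<bar>"] by (subst of_int_le_iff) simp
  moreover have "0 \<le> (n + 2 * x)\<^sup>2" by simp
  ultimately have "(n + x)\<^sup>2 \<ge> \<bar>n\<bar> / 2 - x\<^sup>2"
    by (simp add: power2_eq_square algebra_simps)
  then have "a * (n + x)\<^sup>2 \<ge> a * (\<bar>n\<bar> / 2 - x\<^sup>2)" using assms by (intro mult_left_mono) auto
  then have "exp (- a * (n + x)\<^sup>2) \<le> exp (a * x\<^sup>2 + (- (a / 2)) * \<bar>n\<bar>)"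
    by (simp add: algebra_simps)
  also have "\<dots> = exp (a * x\<^sup>2) * exp (- (a / 2)) ^ nat \<bar>n\<bar>"
    unfolding exp_add by (simp add: exp_of_nat_mult[symmetric] mult.commute)
  finally show ?thesis .
qed

lemma gauss_bound_summable:
  fixes C a :: real
  assumes "a > 0"
  shows "(\<lambda>n::int. C * exp (- (a / 2)) ^ nat \<bar>n\<bar>) summable_on UNIV"
  using assms by (intro summable_on_cmult_right summable_geometric_int) auto

text \<open>The half-open range matches the unit intervals [n, n + 1] that tile [-N, N].\<close>

lemma has_sum_int_limit:
  fixes g :: "int \<Rightarrow> real"
  assumes "(g has_sum S) UNIV"
  shows "(\<lambda>N. \<Sum>n\<in>{-int N..<int N}. g n) \<longlonglongrightarrow> S"
proof -
  have "filterlim (\<lambda>N. {-int N..<int N}) (finite_subsets_at_top UNIV) sequentially"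
    unfolding filterlim_finite_subsets_at_top
  proof safe
    fix X :: "int set" assume X: "finite X"
    define K where "K = Max (insert 0 (abs ` X))"
    have K: "\<bar>x\<bar> \<le> K" if "x \<in> X" for x using X that by (auto simp: K_def)
    show "\<forall>\<^sub>F y in sequentially. finite {- int y..<int y} \<and> X \<subseteq> {- int y..<int y} \<and> {- int y..<int y} \<subseteq> UNIV"
      using eventually_gt_at_top[of "nat K"]
    proof eventually_elim
      case (elim y)
      have "- int y \<le> x \<and> x < int y" if "x \<in> X" for x
        using K[OF that] elim by linarith
      then show ?case by auto
    qed
  qed
  with assms show ?thesis unfolding has_sum_def by (rule filterlim_compose)
qed

lemma integral_unit_pieces:
  fixes F :: "real \<Rightarrow> real"
  assumes "continuous_on UNIV F"
  shows "(\<Sum>n\<in>{-int N..<int N}. integral {real_of_int n..n + 1} F) = integral {- real N..real N} F"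
proof (induction N)
  case (Suc N)
  have int: "F integrable_on {a..b}" for a b
    by (rule integrable_continuous_real) (rule continuous_on_subset[OF assms], simp)
  have "{-int (Suc N)..<int (Suc N)} = insert (-int (Suc N)) (insert (int N) {-int N..<int N})" by auto
  then have "(\<Sum>n\<in>{-int (Suc N)..<int (Suc N)}. integral {real_of_int n..n + 1} F)
     = integral {- real (Suc N)..- real N} F + (integral {real N..real (Suc N)} F + integral {- real N..real N} F)"
    using Suc.IH by (simp add: algebra_simps)
  also have "integral {real N..real (Suc N)} F + integral {- real N..real N} F = integral {- real N..real (Suc N)} F"
    using Henstock_Kurzweil_Integration.integral_combine[of "- real N" "real N" "real (Suc N)" F] int
    by (simp add: add.commute)
  also have "integral {- real (Suc N)..- real N} F + \<dots> = integral {- real (Suc N)..real (Suc N)} F"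
    using int by (intro Henstock_Kurzweil_Integration.integral_combine) auto
  finally show ?case .
qed simp

lemma integral_Icc_limit:
  fixes F :: "real \<Rightarrow> real"
  assumes "integrable lborel F"
  shows "(\<lambda>N. integral {- real N..real N} F) \<longlonglongrightarrow> (LINT x|lborel. F x)"
proof -
  have [measurable]: "F \<in> borel_measurable borel" using assms by auto
  have "(\<lambda>N. LINT x|lborel. indicator {- real N..real N} x *\<^sub>R F x) \<longlonglongrightarrow> (LINT x|lborel. F x)"
  proof (rule integral_dominated_convergence[where w = "\<lambda>x. norm (F x)"])
    show "integrable lborel (\<lambda>x. norm (F x))" using assms by simp
    show "AE x in lborel. (\<lambda>N. indicator {- real N..real N} x *\<^sub>R F x) \<longlonglongrightarrow> F x"
    proof (rule AE_I2)
      fix x :: real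
      obtain M :: nat where M: "\<bar>x\<bar> \<le> real M" using real_arch_simple by blast
      show "(\<lambda>N. indicator {- real N..real N} x *\<^sub>R F x) \<longlonglongrightarrow> F x"
      proof (rule tendsto_eventually, use eventually_ge_at_top[of M] in eventually_elim)
        case (elim N)
        then have "x \<le> real N" "- real N \<le> x" using M by linarith+
        then show ?case by simp
      qed
    qed
    show "AE x in lborel. norm (indicator {- real N..real N} x *\<^sub>R F x) \<le> norm (F x)" for N
      by (intro AE_I2) (auto simp: indicator_def)
  qed auto
  moreover have "(LINT x|lborel. indicator {- real N..real N} x *\<^sub>R F x) = integral {- real N..real N} F" for N
    using set_borel_integral_eq_integral(2)[of "{- real N..real N}" F]
      integrable_mult_indicator[OF _ assms, of "{- real N..real N}"]
    by (simp add: set_integrable_def set_lebesgue_integral_def)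
  ultimately show ?thesis by simp
qed

lemma integral_cos_int:
  "((\<lambda>x. cos (2 * pi * real_of_int j * x)) has_integral (if j = 0 then 1 else 0)) {0..1}"
proof (cases "j = 0")
  case True
  then show ?thesis using has_integral_const_real[of "1::real" 0 1] by simp
next
  case False
  have "((\<lambda>x. cos (2 * pi * real_of_int j * x)) has_integral
     (sin (2 * pi * real_of_int j * 1) / (2 * pi * j) - sin (2 * pi * real_of_int j * 0) / (2 * pi * j))) {0..1}"
    using False by (intro fundamental_theorem_of_calculus)
      (auto intro!: derivative_eq_intros simp: has_real_derivative_iff_has_vector_derivative[symmetric])
  moreover have "sin (2 * pi * real_of_int j) = 0" using sin_int_2pin[of j] by (simp add: mult_ac)
  ultimately show ?thesis using False by simp
qed

lemma integral_cos_cos: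
  "integral {0..1} (\<lambda>x. cos (2 * pi * real_of_int k * x) * cos (2 * pi * real_of_int m * x))
    = ((if k = m then 1 else 0) + (if k = - m then 1 else 0)) / 2"
proof -
  have "(\<lambda>x. cos (2 * pi * real_of_int k * x) * cos (2 * pi * real_of_int m * x))
     = (\<lambda>x. (cos (2 * pi * real_of_int (k - m) * x) + cos (2 * pi * real_of_int (k + m) * x)) / 2)"
    unfolding cos_times_cos by (simp add: algebra_simps)
  moreover have "((\<lambda>x. (cos (2 * pi * real_of_int (k - m) * x) + cos (2 * pi * real_of_int (k + m) * x)) / 2)
     has_integral ((if k - m = 0 then 1 else 0) + (if k + m = 0 then 1 else 0)) / 2) {0..1}"
    by (intro has_integral_divide has_integral_add integral_cos_int)
  ultimately have "integral {0..1} (\<lambda>x. cos (2 * pi * real_of_int k * x) * cos (2 * pi * real_of_int m * x))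
    = ((if k - m = 0 then 1 else 0) + (if k + m = 0 then 1 else 0)) / 2"
    by (simp only: integral_unique)
  then show ?thesis by (simp add: eq_neg_iff_add_eq_0)
qed

text \<open>Both sides are continuous, even and 1-periodic in x, so by
  \<open>even_fourier_zero\<close> it suffices to compare their cosine coefficients.\<close>

lemma gauss_poisson_real:
  fixes t x :: real
  assumes t: "t > 0"
  shows "(\<Sum>\<^sub>\<infinity>n::int. exp (- (pi * t) * (n + x)\<^sup>2))
       = sqrt (1 / t) * (\<Sum>\<^sub>\<infinity>m::int. exp (- (pi / t) * m\<^sup>2) * cos (2 * pi * m * x))"
proof -
  define f where "f x = (\<Sum>\<^sub>\<infinity>n::int. exp (- (pi * t) * (n + x)\<^sup>2))" for x :: real
  define g where "g x = (\<Sum>\<^sub>\<infinity>m::int. exp (- (pi / t) * m\<^sup>2) * cos (2 * pi * m * x))" for x :: real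
  have a: "pi * t > 0" "pi / t > 0" using t by auto
  have bf: "exp (- (pi * t) * (real_of_int n + x)\<^sup>2) \<le> exp (pi * t) * exp (- (pi * t / 2)) ^ nat \<bar>n\<bar>"
    if "x \<in> {0..1}" for n x
  proof -
    have "exp (pi * t * x\<^sup>2) \<le> exp (pi * t)" using that a by (simp add: mult_left_le power_le_one)
    then show ?thesis
      using gauss_bound[OF a(1), of n x] by (meson exp_ge_zero mult_right_mono order_trans zero_le_power)
  qed
  have bg: "exp (- (pi / t) * (real_of_int n)\<^sup>2) \<le> 1 * exp (- (pi / t / 2)) ^ nat \<bar>n\<bar>" for n
    using gauss_bound[OF a(2), of n 0] by simp
  have mc: "\<bar>u * cos v\<bar> \<le> w" if "\<bar>u\<bar> \<le> w" for u v w :: real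
    using that mult_left_le[of "\<bar>cos v\<bar>" "\<bar>u\<bar>"] by (simp add: abs_mult)
  have contf: "continuous_on {0..1} f" unfolding f_def
    by (rule infsum_integral_interchange(1)[OF _ _ gauss_bound_summable[OF a(1), of "exp (pi * t)"]])
      (use bf in \<open>auto intro!: continuous_intros\<close>)
  have contg: "continuous_on {0..1} g" unfolding g_def
    by (rule infsum_integral_interchange(1)[OF _ _ gauss_bound_summable[OF a(2), of 1]])
      (use bg in \<open>auto intro!: continuous_intros mc\<close>)
  have f_add_int: "f (x + real_of_int k) = f x" for x k
    unfolding f_def using infsum_int_shift[of "\<lambda>n. exp (- (pi * t) * (n + x)\<^sup>2)" k] by (simp add: algebra_simps)
  have g_add_int: "g (x + real_of_int k) = g x" for x k
  proof -
    have "cos (2 * pi * real_of_int m * (x + real_of_int k)) = cos (2 * pi * m * x)" for m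
    proof -
      have "2 * pi * real_of_int m * (x + real_of_int k) = 2 * pi * m * x + 2 * pi * real_of_int (m * k)"
        by (simp add: algebra_simps)
      then show ?thesis
        by (simp add: cos_add sin_int_2pin cos_int_2pin del: of_int_mult)
    qed
    then show ?thesis unfolding g_def by simp
  qed
  have f_minus: "f (- x) = f x" for x
  proof -
    have "(real_of_int (0 - n) + x)\<^sup>2 = (real_of_int n + - x)\<^sup>2" for n
      by (simp add: power2_eq_square algebra_simps)
    then show ?thesis
      unfolding f_def using infsum_int_reflect[of "\<lambda>n. exp (- (pi * t) * (n + x)\<^sup>2)" 0] by simp
  qed
  have g_minus: "g (- x) = g x" for x
    unfolding g_def by simp
  define h where "h x = f x - sqrt (1 / t) * g x" for x
  have hz: "h x = 0" if "x \<in> {0..1}" for x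
  proof (rule even_fourier_zero[OF _ _ _ that])
    show "continuous_on {0..1} h" unfolding h_def by (intro continuous_intros contf contg)
    show "h (1 - x) = h x" for x
      using f_add_int[of "-x" 1] g_add_int[of "-x" 1] by (simp add: h_def f_minus g_minus)
    fix m :: int
    let ?F = "\<lambda>y. exp (- (pi * t) * y\<^sup>2) * cos (2 * pi * m * y)"
    let ?v = "sqrt (1 / t) * exp (- (pi / t) * m\<^sup>2)"
    have If: "integral {0..1} (\<lambda>x. f x * cos (2 * pi * m * x)) = ?v"
    proof -
      let ?f = "\<lambda>(n::int) x. exp (- (pi * t) * (n + x)\<^sup>2) * cos (2 * pi * m * x)"
      have hs: "((\<lambda>n. integral {0..1} (?f n)) has_sum integral {0..1} (\<lambda>x. \<Sum>\<^sub>\<infinity>n. ?f n x)) UNIV"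
        by (rule infsum_integral_interchange(2)[OF _ _ gauss_bound_summable[OF a(1), of "exp (pi * t)"]])
          (use bf in \<open>auto intro!: continuous_intros mc\<close>)
      \<comment> \<open>The cosine has period 1, so translating by n turns the n-th coefficient
        integral into the piece over [n, n + 1] of the Fourier integral over the line.\<close>
      have pieces: "integral {0..1} (?f n) = integral {real_of_int n..n + 1} ?F" for n
      proof -
        have "cos (2 * pi * real_of_int m * (n + x)) = cos (2 * pi * m * x)" for x :: real
        proof -
          have "2 * pi * real_of_int m * (n + x) = 2 * pi * m * x + 2 * pi * real_of_int (m * n)"
            by (simp add: algebra_simps)
          then show ?thesis by (simp add: cos_add sin_int_2pin cos_int_2pin del: of_int_mult)
        qed
        then have "?F \<circ> (+) (real_of_int n) = ?f n" by (simp add: fun_eq_iff)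
        then show ?thesis using integral_shift_Icc_real[of 0 1 ?F "real_of_int n"] by (simp add: add.commute)
      qed
      have "(\<lambda>N. integral {- real N..real N} ?F) \<longlonglongrightarrow> integral {0..1} (\<lambda>x. \<Sum>\<^sub>\<infinity>n. ?f n x)"
        using has_sum_int_limit[OF hs] unfolding pieces
        by (subst (asm) integral_unit_pieces) (auto intro!: continuous_intros)
      moreover have "(\<lambda>N. integral {- real N..real N} ?F) \<longlonglongrightarrow> (LINT y|lborel. ?F y)"
        by (rule integral_Icc_limit) (rule gaussian_cos_integral(1)[OF a(1), of "2 * pi * m"])
      ultimately have "integral {0..1} (\<lambda>x. \<Sum>\<^sub>\<infinity>n. ?f n x) = (LINT y|lborel. ?F y)"
        by (rule LIMSEQ_unique)
      also have "\<dots> = sqrt (pi / (pi * t)) * exp (- (2 * pi * m)\<^sup>2 / (4 * (pi * t)))"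
        by (rule gaussian_cos_integral(2)[OF a(1), of "2 * pi * m"])
      also have "\<dots> = ?v" using t by (simp add: power2_eq_square field_simps)
      also have "(\<lambda>x. \<Sum>\<^sub>\<infinity>n. ?f n x) = (\<lambda>x. f x * cos (2 * pi * m * x))"
        unfolding f_def by (simp add: infsum_cmult_left')
      finally show ?thesis .
    qed
    have Ig: "integral {0..1} (\<lambda>x. g x * cos (2 * pi * m * x)) = exp (- (pi / t) * m\<^sup>2)"
    proof -
      let ?g = "\<lambda>(k::int) x. exp (- (pi / t) * k\<^sup>2) * cos (2 * pi * k * x) * cos (2 * pi * m * x)"
      \<comment> \<open>For nonzero m the indices m and -m contribute one half each; for m = 0 they
        coincide and both conditions hold.\<close>
      define w :: "int \<Rightarrow> real" where "w k = exp (- (pi / t) * k\<^sup>2) * (((if k = m then 1 else 0) + (if k = - m then 1 else 0)) / 2)" for k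
      have hs: "((\<lambda>k. integral {0..1} (?g k)) has_sum integral {0..1} (\<lambda>x. \<Sum>\<^sub>\<infinity>k. ?g k x)) UNIV"
        by (rule infsum_integral_interchange(2)[OF _ _ gauss_bound_summable[OF a(2), of 1]])
          (use bg in \<open>auto intro!: continuous_intros mc\<close>)
      have val: "integral {0..1} (?g k) = w k" for k
        unfolding w_def integral_cos_cos[symmetric] by (simp add: mult.assoc)
      have "integral {0..1} (\<lambda>x. \<Sum>\<^sub>\<infinity>k. ?g k x)
         = infsum w UNIV"
        using infsumI[OF hs] unfolding val by simp
      also have "\<dots> = infsum w {m, -m}"
        by (rule infsum_cong_neutral) (auto simp: w_def)
      also have "\<dots> = exp (- (pi / t) * m\<^sup>2)" by (cases "m = 0") (auto simp: w_def)
      also have "(\<lambda>x. \<Sum>\<^sub>\<infinity>k. ?g k x) = (\<lambda>x. g x * cos (2 * pi * m * x))"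
        unfolding g_def by (simp add: infsum_cmult_left')
      finally show ?thesis .
    qed
    have "(\<lambda>x. h x * cos (2 * pi * m * x))
        = (\<lambda>x. f x * cos (2 * pi * m * x) - sqrt (1 / t) * (g x * cos (2 * pi * m * x)))"
      by (simp add: h_def algebra_simps)
    then have "integral {0..1} (\<lambda>x. h x * cos (2 * pi * m * x))
       = integral {0..1} (\<lambda>x. f x * cos (2 * pi * m * x)) - sqrt (1 / t) * integral {0..1} (\<lambda>x. g x * cos (2 * pi * m * x))"
      by (subst integral_mult_right[symmetric], simp only:, intro integral_diff)
        (auto intro!: integrable_continuous_real continuous_intros contf contg)
    then show "integral {0..1} (\<lambda>x. h x * cos (2 * pi * m * x)) = 0" using If Ig by simp
  qed
  have "h x = h (frac x + real_of_int \<lfloor>x\<rfloor>)" by (simp add: frac_def)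
  also have "\<dots> = h (frac x)" by (simp only: h_def f_add_int g_add_int)
  also have "\<dots> = 0" using frac_lt_1[of x] by (intro hz) auto
  finally show ?thesis by (simp add: h_def f_def g_def)
qed

lemma Im_minus_inverse_pos: "Im z > 0 \<Longrightarrow> Im (- 1 / z) > 0"
proof -
  assume "Im z > 0"
  moreover from this have "(Re z)\<^sup>2 + (Im z)\<^sup>2 > 0" by (simp add: sum_power2_gt_zero_iff)
  ultimately show "Im (- 1 / z) > 0" by (simp add: Im_divide)
qed

text \<open>Division by a positive real preserves the half-plane that defines the principal
  branch.\<close>

lemma csqrt_divide_nat:
  assumes "M > 0"
  shows "csqrt (z / of_nat M) = csqrt z / of_real (sqrt M)"
proof (rule csqrt_unique)
  show "(csqrt z / of_real (sqrt M))\<^sup>2 = z / of_nat M"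
    using assms by (simp add: power_divide flip: of_real_power)
  define w where "w = csqrt z"
  have "0 < Re w \<or> Re w = 0 \<and> 0 \<le> Im w" unfolding w_def by (rule csqrt_principal)
  then show "0 < Re (csqrt z / of_real (sqrt M)) \<or>
      Re (csqrt z / of_real (sqrt M)) = 0 \<and> 0 \<le> Im (csqrt z / of_real (sqrt M))"
    unfolding w_def[symmetric] using assms by (auto simp: Re_divide_of_real Im_divide_of_real)
qed

lemma infsum_complex_of_real: "(\<Sum>\<^sub>\<infinity>x\<in>A. complex_of_real (f x)) = of_real (\<Sum>\<^sub>\<infinity>x\<in>A. f x)"
  by (intro infsum_bounded_linear_strong bounded_linear_of_real
      summable_on_bounded_linear_iff[OF bounded_linear_of_real bounded_linear_Re]) simp

lemma infsum_sum_swap: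
  fixes f :: "'a \<Rightarrow> 'b \<Rightarrow> complex"
  assumes "\<And>a. a \<in> A \<Longrightarrow> f a summable_on B"
  shows "(\<Sum>\<^sub>\<infinity>j\<in>B. \<Sum>a\<in>A. f a j) = (\<Sum>a\<in>A. infsum (f a) B)"
proof -
  have "((\<lambda>j. \<Sum>a\<in>A. f a j) has_sum (\<Sum>a\<in>A. infsum (f a) B)) B"
    using assms by (induction A rule: infinite_finite_induct) (auto intro!: has_sum_add)
  then show ?thesis by (rule infsumI)
qed

section \<open>Gaussian series on the upper half-plane\<close>

definition gsum :: "(int \<Rightarrow> complex) \<Rightarrow> real \<Rightarrow> complex \<Rightarrow> complex" where
  "gsum c x \<tau> = (\<Sum>\<^sub>\<infinity>n. c n * exp (of_real pi * \<i> * \<tau> * of_real ((of_int n + x)\<^sup>2)))"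

lemma norm_gauss_term:
  "norm (exp (of_real pi * \<i> * \<tau> * of_real r)) = exp (- (pi * Im \<tau>) * r)"
  by (simp add: norm_exp_eq_Re)

lemma gauss_term_bound:
  assumes c: "\<And>n. norm (c n) \<le> C" and d: "d > 0" "d \<le> Im \<tau>"
  shows "norm (c n * exp (of_real pi * \<i> * \<tau> * of_real ((of_int n + x)\<^sup>2)))
    \<le> (C * exp (pi * d * x\<^sup>2)) * exp (- (pi * d / 2)) ^ nat \<bar>n\<bar>"
proof -
  have "C \<ge> 0" using c[of 0] by (meson norm_ge_zero order_trans)
  have "exp (- (pi * Im \<tau>) * (of_int n + x)\<^sup>2) \<le> exp (- (pi * d) * (of_int n + x)\<^sup>2)"
    using d by (auto intro!: mult_right_mono)
  also have "\<dots> \<le> exp (pi * d * x\<^sup>2) * exp (- (pi * d / 2)) ^ nat \<bar>n\<bar>"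
    using gauss_bound[of "pi * d" n x] d by simp
  finally have "norm (c n) * exp (- (pi * Im \<tau>) * (of_int n + x)\<^sup>2)
      \<le> C * (exp (pi * d * x\<^sup>2) * exp (- (pi * d / 2)) ^ nat \<bar>n\<bar>)"
    using c[of n] \<open>C \<ge> 0\<close> by (intro mult_mono) auto
  then show ?thesis unfolding norm_mult norm_gauss_term by (simp only: mult.assoc)
qed

lemma gsum_summable:
  assumes c: "\<And>n. norm (c n) \<le> C" and "Im \<tau> > 0"
  shows "(\<lambda>n. norm (c n * exp (of_real pi * \<i> * \<tau> * of_real ((of_int n + x)\<^sup>2)))) summable_on UNIV"
  by (rule summable_on_comparison_test[OF gauss_bound_summable[of "pi * Im \<tau>" "C * exp (pi * Im \<tau> * x\<^sup>2)"]])
    (use gauss_term_bound[OF c assms(2) order_refl] assms(2) in auto)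

lemma gsum_holomorphic:
  assumes c: "\<And>n. norm (c n) \<le> C"
  shows "gsum c x holomorphic_on {\<tau>. Im \<tau> > 0}"
proof -
  have "gsum c x field_differentiable at z" if z: "Im z > 0" for z
  proof -
    \<comment> \<open>The closed disc of radius Im z / 2 stays at height at least d, so one majorant
      serves all its points.\<close>
    define d where "d = Im z / 2"
    have d: "d > 0" using z by (simp add: d_def)
    let ?f = "\<lambda>n \<tau>. c n * exp (of_real pi * \<i> * \<tau> * of_real ((of_int n + x)\<^sup>2))"
    have im: "d \<le> Im w" if "w \<in> cball z d" for w
    proof -
      have "\<bar>Im (z - w)\<bar> \<le> d" using that abs_Im_le_cmod[of "z - w"] by (simp add: dist_norm)
      then have "Im z - Im w \<le> d" by (simp add: abs_le_iff)
      then show ?thesis unfolding d_def by linarith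
    qed
    have "uniform_limit (cball z d) (\<lambda>X \<tau>. \<Sum>n\<in>X. ?f n \<tau>) (gsum c x) (finite_subsets_at_top UNIV)"
      unfolding gsum_def
      by (rule Weierstrass_m_test_general[OF gauss_term_bound[OF c d im] gauss_bound_summable]) (use d in auto)
    then obtain "gsum c x holomorphic_on ball z d"
      by (rule holomorphic_uniform_limit[rotated]) (auto intro!: always_eventually holomorphic_intros continuous_intros)
    then show ?thesis using d by (intro holomorphic_on_imp_differentiable_at) auto
  qed
  then show ?thesis by (auto simp: holomorphic_on_def intro: field_differentiable_at_within)
qed

text \<open>The general case follows from the imaginary axis by analytic continuation.\<close>

theorem gsum_inversion:
  assumes "Im \<tau> > 0"
  shows "gsum (\<lambda>_. 1) x (- 1 / \<tau>) = csqrt (- \<i> * \<tau>) * gsum (\<lambda>m. of_real (cos (2 * pi * of_int m * x))) 0 \<tau>"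
proof -
  let ?H = "{\<tau>::complex. Im \<tau> > 0}"
  let ?c = "\<lambda>m. complex_of_real (cos (2 * pi * of_int m * x))"
  let ?D = "\<lambda>\<tau>. gsum (\<lambda>_. 1) x (- 1 / \<tau>) - csqrt (- \<i> * \<tau>) * gsum ?c 0 \<tau>"
  have "?D \<tau> = 0"
  proof (rule analytic_continuation[where f = ?D and S = ?H and U = "{\<i> * of_real s |s. s > 0}" and \<xi> = \<i>])
    have "(\<lambda>\<tau>. gsum (\<lambda>_. 1) x (- 1 / \<tau>)) holomorphic_on ?H"
    proof -
      have "(gsum (\<lambda>_. 1) x \<circ> (\<lambda>\<tau>. - 1 / \<tau>)) holomorphic_on ?H"
      proof (rule holomorphic_on_compose_gen[OF _ gsum_holomorphic[of _ 1]])
        show "(\<lambda>\<tau>. - 1 / \<tau>) holomorphic_on ?H" by (auto intro!: holomorphic_intros)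
      qed (use Im_minus_inverse_pos in auto)
      then show ?thesis by (simp add: o_def)
    qed
    moreover have "(\<lambda>\<tau>. csqrt (- \<i> * \<tau>)) holomorphic_on ?H"
      by (intro holomorphic_intros) (auto simp: complex_nonpos_Reals_iff complex_nonneg_Reals_iff)
    ultimately show "?D holomorphic_on ?H"
      by (intro holomorphic_on_diff holomorphic_on_mult gsum_holomorphic[of _ 1]) auto
    show "open ?H" by (rule open_halfspace_Im_gt)
    show "connected ?H" by (intro convex_connected convex_halfspace_Im_gt)
    show "\<i> islimpt {\<i> * of_real s |s. s > 0}"
      unfolding islimpt_approachable
    proof (intro allI impI)
      fix e :: real assume e: "e > 0"
      have "\<i> * of_real (1 + e / 2) \<in> {\<i> * of_real s |s. s > 0}" using e by (auto intro!: exI[of _ "1 + e / 2"])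
      moreover have "\<i> * of_real (1 + e / 2) \<noteq> \<i>" using e by (auto simp: complex_eq_iff)
      moreover have "dist (\<i> * of_real (1 + e / 2)) \<i> < e"
        using e by (simp add: dist_norm algebra_simps norm_mult)
      ultimately show "\<exists>x'\<in>{\<i> * of_real s |s. s > 0}. x' \<noteq> \<i> \<and> dist x' \<i> < e" by blast
    qed
    fix z assume "z \<in> {\<i> * complex_of_real s |s. s > 0}"
    then obtain s where s: "z = \<i> * of_real s" "s > 0" by auto
    \<comment> \<open>On the imaginary axis -1/(\<i> s) = \<i>/s, so the real identity is taken at t
      = 1 / s, where its prefactor sqrt (1 / t) is sqrt s.\<close>
    have e1: "exp (of_real pi * \<i> * (- 1 / z) * of_real r) = of_real (exp (- (pi / s) * r))" for r
      unfolding s(1) exp_of_real[symmetric] using s(2) by (simp add: field_simps)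
    have e2: "exp (of_real pi * \<i> * z * of_real r) = of_real (exp (- (pi * s) * r))" for r
      unfolding s(1) exp_of_real[symmetric] by (simp add: algebra_simps)
    have 1: "gsum (\<lambda>_. 1) x (- 1 / z) = of_real (\<Sum>\<^sub>\<infinity>n::int. exp (- (pi / s) * (n + x)\<^sup>2))"
      unfolding gsum_def e1 by (simp only: mult_1_left infsum_complex_of_real)
    have 2: "gsum ?c 0 z = of_real (\<Sum>\<^sub>\<infinity>m::int. exp (- (pi * s) * m\<^sup>2) * cos (2 * pi * m * x))"
      unfolding gsum_def e2 of_real_mult[symmetric] infsum_complex_of_real by (simp add: mult.commute)
    have 3: "csqrt (- \<i> * z) = of_real (sqrt s)" using s by (simp add: csqrt_of_real_nonneg)
    show "?D z = 0"
      unfolding 1 2 3 using gauss_poisson_real[of "1 / s" x] s(2) by (simp add: mult.commute)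
  qed (use assms in auto)
  then show ?thesis by simp
qed

section \<open>Theta series with periodic coefficients\<close>

text \<open>The exponents m^2 / M are scaled so that m = M n + a gives M (n + a / M)^2: each residue
  class modulo M is a \<open>gsum\<close> with shift a / M, and inversion returns to the same
  M.\<close>

definition fsum :: "nat \<Rightarrow> (int \<Rightarrow> complex) \<Rightarrow> complex \<Rightarrow> complex" where
  "fsum M c \<tau> = (\<Sum>\<^sub>\<infinity>m. c m * exp (of_real pi * \<i> * \<tau> * of_real ((of_int m)\<^sup>2 / of_nat M)))"

lemma infsum_int_residues:
  fixes f :: "int \<Rightarrow> complex"
  assumes M: "M > 0" and f: "f summable_on UNIV"
  shows "(\<Sum>\<^sub>\<infinity>m. f m) = (\<Sum>a<M. \<Sum>\<^sub>\<infinity>n. f (int M * n + int a))"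
proof -
  have bij: "bij_betw (\<lambda>(a, n). int M * n + int a) ({..<M} \<times> UNIV) UNIV"
    by (rule bij_betwI[where g = "\<lambda>m. (nat (m mod int M), m div int M)"]) (use M in \<open>auto simp: nat_less_iff\<close>)
  have "(\<lambda>(a, n). f (int M * n + int a)) summable_on {..<M} \<times> UNIV"
    using summable_on_reindex_bij_betw[OF bij, of f] f by (simp add: case_prod_unfold)
  then have "(\<Sum>\<^sub>\<infinity>a\<in>{..<M}. \<Sum>\<^sub>\<infinity>n. f (int M * n + int a)) = (\<Sum>\<^sub>\<infinity>(a, n)\<in>{..<M} \<times> UNIV. f (int M * n + int a))"
    by (rule infsum_Sigma'_banach)
  also have "\<dots> = (\<Sum>\<^sub>\<infinity>m. f m)"
    using infsum_reindex_bij_betw[OF bij, of f] by (simp add: case_prod_unfold)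
  finally show ?thesis by simp
qed

lemma periodic_mult:
  fixes c :: "int \<Rightarrow> 'a"
  assumes "\<And>m. c (m + p) = c m"
  shows "c (p * n + a) = c a"
proof (induction n rule: int_induct[where k = 0])
  case (step1 n) then show ?case using assms[of "p * n + a"] by (simp add: algebra_simps)
next
  case (step2 n) then show ?case using assms[of "p * (n - 1) + a"] by (simp add: algebra_simps)
qed simp

lemma periodic_bounded:
  fixes c :: "int \<Rightarrow> complex"
  assumes M: "M > 0" and per: "\<And>m. c (m + int M) = c m"
  shows "norm (c n) \<le> (\<Sum>a<M. norm (c (int a)))"
proof -
  have "c n = c (int M * (n div int M) + n mod int M)" by simp
  also have "\<dots> = c (n mod int M)" by (rule periodic_mult[of c "int M", OF per])
  also have "n mod int M = int (nat (n mod int M))" using M by simp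
  finally have "norm (c n) = norm (c (int (nat (n mod int M))))" by simp
  also have "\<dots> \<le> (\<Sum>a<M. norm (c (int a)))"
    using M by (intro member_le_sum) (auto simp: nat_less_iff)
  finally show ?thesis .
qed

lemma fsum_summable:
  assumes "\<And>n. norm (c n) \<le> C" "Im \<tau> > 0" "M > 0"
  shows "(\<lambda>m. c m * exp (of_real pi * \<i> * \<tau> * of_real ((of_int m)\<^sup>2 / of_nat M))) summable_on UNIV"
proof -
  have "Im (\<tau> / of_nat M) > 0" using assms by (simp add: Im_divide_of_nat)
  from abs_summable_summable[OF gsum_summable[where c = c and x = 0, OF assms(1) this]]
  show ?thesis by (simp add: field_simps)
qed

text \<open>\<open>gsum_inversion\<close> is applied at \<tau> / M in every residue class. Only the
  cosine part of the discrete Fourier transform appears, because m and -m carry the same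
  exponential.\<close>

theorem fsum_inversion:
  assumes M: "M > 0" and per: "\<And>m. c (m + int M) = c m" and \<tau>: "Im \<tau> > 0"
  shows "fsum M c (- 1 / \<tau>) = csqrt (- \<i> * \<tau>) / of_real (sqrt M) *
     fsum M (\<lambda>j. \<Sum>a<M. c (int a) * of_real (cos (2 * pi * a * j / M))) \<tau>"
proof -
  have im: "Im (- 1 / \<tau>) > 0" by (rule Im_minus_inverse_pos[OF \<tau>])
  have imM: "Im (\<tau> / of_nat M) > 0" using \<tau> M by (simp add: Im_divide_of_nat)
  have sq: "csqrt (- \<i> * (\<tau> / of_nat M)) = csqrt (- \<i> * \<tau>) / of_real (sqrt M)"
    using csqrt_divide_nat[OF M, of "- \<i> * \<tau>"] by simp
  let ?e = "\<lambda>m. exp (of_real pi * \<i> * \<tau> * of_real ((of_int m)\<^sup>2 / of_nat M))"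
  have "fsum M c (- 1 / \<tau>) = (\<Sum>a<M. \<Sum>\<^sub>\<infinity>n. c (int M * n + int a) *
      exp (of_real pi * \<i> * (- 1 / \<tau>) * of_real ((of_int (int M * n + int a))\<^sup>2 / of_nat M)))"
    unfolding fsum_def
    by (rule infsum_int_residues[OF M fsum_summable[OF periodic_bounded[of M c, OF M per] im M]])
  also have "\<dots> = (\<Sum>a<M. \<Sum>\<^sub>\<infinity>n. c (int a) *
      (1 * exp (of_real pi * \<i> * (- 1 / (\<tau> / of_nat M)) * of_real ((of_int n + a / M)\<^sup>2))))"
  proof (intro sum.cong refl infsum_cong)
    fix a :: nat and n :: int
    have "c (int M * n + int a) = c (int a)" by (rule periodic_mult[of c "int M", OF per])
    moreover have "(- 1 / \<tau>) * of_real ((of_int (int M * n + int a))\<^sup>2 / of_nat M)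
        = (- 1 / (\<tau> / of_nat M)) * of_real ((of_int n + a / M)\<^sup>2)"
    proof -
      have "(real_of_int (int M * n + int a))\<^sup>2 / real M = real M * (of_int n + a / M)\<^sup>2"
        using M by (simp add: field_simps power2_eq_square)
      then show ?thesis by (simp only: of_real_mult of_real_of_nat_eq) simp
    qed
    ultimately show "c (int M * n + int a) *
      exp (of_real pi * \<i> * (- 1 / \<tau>) * of_real ((of_int (int M * n + int a))\<^sup>2 / of_nat M)) =
      c (int a) * (1 * exp (of_real pi * \<i> * (- 1 / (\<tau> / of_nat M)) * of_real ((of_int n + a / M)\<^sup>2)))"
      by (simp only: mult.assoc mult_1_left)
  qed
  also have "\<dots> = (\<Sum>a<M. c (int a) * gsum (\<lambda>_. 1) (a / M) (- 1 / (\<tau> / of_nat M)))"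
    unfolding gsum_def infsum_cmult_right' ..
  also have "\<dots> = (\<Sum>a<M. csqrt (- \<i> * (\<tau> / of_nat M)) *
      (\<Sum>\<^sub>\<infinity>j. c (int a) * of_real (cos (2 * pi * a * j / M)) * ?e j))"
  proof (intro sum.cong refl)
    fix a :: nat
    have "gsum (\<lambda>m. of_real (cos (2 * pi * of_int m * (a / M)))) 0 (\<tau> / of_nat M)
      = (\<Sum>\<^sub>\<infinity>j. of_real (cos (2 * pi * a * j / M)) * ?e j)"
      unfolding gsum_def by (intro infsum_cong) (simp add: field_simps)
    then show "c (int a) * gsum (\<lambda>_. 1) (a / M) (- 1 / (\<tau> / of_nat M)) = csqrt (- \<i> * (\<tau> / of_nat M)) *
      (\<Sum>\<^sub>\<infinity>j. c (int a) * of_real (cos (2 * pi * a * j / M)) * ?e j)"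
      unfolding gsum_inversion[OF imM] mult.assoc infsum_cmult_right' by (simp only: mult.left_commute)
  qed
  also have "\<dots> = csqrt (- \<i> * (\<tau> / of_nat M)) *
      (\<Sum>a<M. \<Sum>\<^sub>\<infinity>j. c (int a) * of_real (cos (2 * pi * a * j / M)) * ?e j)"
    by (rule sum_distrib_left[symmetric])
  also have "(\<Sum>a<M. \<Sum>\<^sub>\<infinity>j. c (int a) * of_real (cos (2 * pi * a * j / M)) * ?e j)
     = (\<Sum>\<^sub>\<infinity>j. \<Sum>a<M. c (int a) * of_real (cos (2 * pi * a * j / M)) * ?e j)"
  proof (rule infsum_sum_swap[symmetric])
    fix a :: nat
    show "(\<lambda>j. c (int a) * of_real (cos (2 * pi * a * j / M)) * ?e j) summable_on UNIV"
      by (rule fsum_summable[of _ "norm (c (int a))", OF _ \<tau> M]) (simp add: norm_mult mult_left_le)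
  qed
  also have "\<dots> = fsum M (\<lambda>j. \<Sum>a<M. c (int a) * of_real (cos (2 * pi * a * j / M))) \<tau>"
    unfolding fsum_def sum_distrib_right ..
  finally show ?thesis unfolding sq .
qed


text \<open>The coefficients with \<open>tc p r (p n + r) = (-1)\<^sup>n\<close>, so that \<open>th p r \<tau>\<close> below is
  \<open>\<Sum>\<^sub>n (-1)\<^sup>n exp (\<pi> \<i> \<tau> (p n + r)\<^sup>2 / (2 p))\<close>: \<open>p = 6\<close>, \<open>r = -1\<close> gives \<open>\<eta>(\<tau>)\<close>, and \<open>p = 2 k\<close>
  at \<open>2 \<tau>\<close> gives \<open>\<theta>\<^sub>r(\<tau>)\<close>.\<close>

definition tc :: "nat \<Rightarrow> int \<Rightarrow> int \<Rightarrow> complex" where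
  "tc p r m = (if int p dvd m - r then sgn_pow ((m - r) div int p) else 0)"

lemma tc_anti: "p > 0 \<Longrightarrow> tc p r (m + int p) = - tc p r m"
proof -
  assume p: "p > 0"
  have e: "m + int p - r = (m - r) + int p" by simp
  show ?thesis unfolding tc_def e using p by (simp add: sgn_pow_simps(1))
qed

lemma tc_periodic: "p > 0 \<Longrightarrow> tc p r (m + int (2 * p)) = tc p r m"
  using tc_anti[of p r m] tc_anti[of p r "m + int p"] by (simp add: algebra_simps)

lemma norm_tc: "norm (tc p r m) \<le> 1"
  by (simp add: tc_def norm_power_int)

definition th :: "nat \<Rightarrow> int \<Rightarrow> complex \<Rightarrow> complex" where
  "th p r = fsum (2 * p) (tc p r)"

lemma th_series:
  assumes p: "p > 0"
  shows "th p r \<tau> = (\<Sum>\<^sub>\<infinity>n. sgn_pow n * exp (of_real pi * \<i> * \<tau> * of_real ((of_int (int p * n + r))\<^sup>2 / of_nat (2 * p))))"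
proof -
  let ?f = "\<lambda>m. tc p r m * exp (of_real pi * \<i> * \<tau> * of_real ((of_int m)\<^sup>2 / of_nat (2 * p)))"
  have bij: "bij_betw (\<lambda>n. int p * n + r) UNIV {m. int p dvd m - r}"
    by (rule bij_betwI[where g = "\<lambda>m. (m - r) div int p"]) (use p in auto)
  have "th p r \<tau> = infsum ?f {m. int p dvd m - r}"
    unfolding th_def fsum_def by (intro infsum_cong_neutral) (auto simp: tc_def)
  also have "\<dots> = (\<Sum>\<^sub>\<infinity>n. ?f (int p * n + r))"
    by (rule infsum_reindex_bij_betw[OF bij, symmetric])
  also have "\<dots> = (\<Sum>\<^sub>\<infinity>n. sgn_pow n * exp (of_real pi * \<i> * \<tau> * of_real ((of_int (int p * n + r))\<^sup>2 / of_nat (2 * p))))"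
    using p by (intro infsum_cong) (simp add: tc_def)
  finally show ?thesis .
qed

lemma th_uminus:
  assumes p: "p > 0"
  shows "th p (- r) \<tau> = th p r \<tau>"
proof -
  let ?f = "\<lambda>n. sgn_pow n * exp (of_real pi * \<i> * \<tau> * of_real ((of_int (int p * n + r))\<^sup>2 / of_nat (2 * p)))"
  have "th p r \<tau> = (\<Sum>\<^sub>\<infinity>n. ?f (0 - n))" unfolding th_series[OF p] by (rule infsum_int_reflect[symmetric])
  also have "\<dots> = th p (- r) \<tau>"
    unfolding th_series[OF p]
  proof (rule infsum_cong)
    fix n
    have "(real_of_int (int p * (0 - n) + r))\<^sup>2 = (real_of_int (int p * n + - r))\<^sup>2"
      by (simp add: power2_eq_square algebra_simps)
    then show "?f (0 - n) = sgn_pow n * exp (of_real pi * \<i> * \<tau> * of_real ((of_int (int p * n + - r))\<^sup>2 / of_nat (2 * p)))"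
      by (simp only: diff_0 sgn_pow_simps(3))
  qed
  finally show ?thesis by simp
qed

lemma th_shift:
  assumes p: "p > 0"
  shows "th p (r + int p) \<tau> = - th p r \<tau>"
proof -
  have "tc p (r + int p) m = - tc p r m" for m
    using tc_anti[OF p, of "r" "m - int p"] by (simp add: tc_def algebra_simps)
  then show ?thesis unfolding th_def fsum_def by (simp add: infsum_uminus)
qed

text \<open>A full period 2 p meets the support of \<open>tc p r\<close> only in the classes of r
  and r + p, with values 1 and -1.\<close>

lemma sum_tc:
  fixes g :: "int \<Rightarrow> complex"
  assumes p: "p > 0" and g: "\<And>m. g (m + int (2 * p)) = g m"
  shows "(\<Sum>a<2*p. tc p r (int a) * g (int a)) = g r - g (r + int p)"
proof -
  define c where "c = (\<lambda>m. tc p r m * g m)"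
  have c: "c (m + int (2 * p)) = c m" for m unfolding c_def using tc_periodic[OF p, of r m] g[of m] by simp
  define a0 where "a0 = nat (r mod int (2 * p))"
  define a1 where "a1 = nat ((r + int p) mod int (2 * p))"
  have lt: "a0 < 2 * p" "a1 < 2 * p" using p by (simp_all add: a0_def a1_def nat_less_iff)
  have i: "int a0 = r mod int (2 * p)" "int a1 = (r + int p) mod int (2 * p)"
    using p by (simp_all add: a0_def a1_def)
  have per: "c (m mod int (2 * p)) = c m" for m
    using periodic_mult[of c "int (2 * p)" "m div int (2 * p)" "m mod int (2 * p)", OF c] by simp
  have c0: "c (int a0) = g r" unfolding i per by (simp add: c_def tc_def)
  have c1: "c (int a1) = - g (r + int p)" unfolding i per using p by (simp add: c_def tc_def)
  have ne: "a0 \<noteq> a1"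
  proof
    assume "a0 = a1"
    then have "r mod int (2 * p) = (r + int p) mod int (2 * p)" using i by simp
    then have "int (2 * p) dvd (r + int p) - r" by (metis mod_eq_dvd_iff)
    then have "2 * p dvd p" by (simp add: int_dvd_int_iff[symmetric] del: int_dvd_int_iff)
    then show False using p by (auto dest: dvd_imp_le)
  qed
  have zero: "c (int a) = 0" if "a < 2 * p" "a \<noteq> a0" "a \<noteq> a1" for a
  proof (rule ccontr)
    assume "c (int a) \<noteq> 0"
    then have "int p dvd int a - r" by (auto simp: c_def tc_def split: if_splits)
    then obtain t where t: "int a = r + int p * t" by (metis add.commute diff_eq_eq dvdE)
    have "int a = int a mod int (2 * p)" using that by simp
    show False
    proof (cases "even t")
      case True
      then obtain s where "t = 2 * s" by (elim evenE)
      then have "int a = r + int (2 * p) * s" using t by simp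
      then have "int a mod int (2 * p) = r mod int (2 * p)" by simp
      then show False using \<open>int a = int a mod int (2 * p)\<close> i that by simp
    next
      case False
      then obtain s where "t = 2 * s + 1" by (elim oddE)
      then have "int a = (r + int p) + int (2 * p) * s" using t by (simp add: algebra_simps)
      then have "int a mod int (2 * p) = (r + int p) mod int (2 * p)" by simp
      then show False using \<open>int a = int a mod int (2 * p)\<close> i that by simp
    qed
  qed
  have "(\<Sum>a<2*p. c (int a)) = (\<Sum>a\<in>{a0, a1}. c (int a))"
    using lt zero by (intro sum.mono_neutral_right) auto
  also have "\<dots> = g r - g (r + int p)" using ne c0 c1 by simp
  finally show ?thesis by (simp add: c_def)
qed

lemma cos_add_int_pi: "cos (x + real_of_int n * pi) = (if even n then cos x else - cos x)"
proof (cases "even n")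
  case True
  then obtain m where "n = 2 * m" by (elim evenE)
  then have "x + real_of_int n * pi = x + 2 * pi * real_of_int m" by simp
  then show ?thesis using True by (simp only: cos_add sin_int_2pin cos_int_2pin) simp
next
  case False
  then obtain m where "n = 2 * m + 1" by (elim oddE)
  then have "x + real_of_int n * pi = (x + 2 * pi * real_of_int m) + pi" by (simp add: algebra_simps)
  then show ?thesis using False by (simp only: cos_periodic_pi cos_add sin_int_2pin cos_int_2pin) simp
qed

text \<open>For g m = cos (pi m j / p) one has g (m + p) = (-1)^j g m, so the difference in
  \<open>sum_tc\<close> vanishes for even j and doubles for odd j.\<close>

theorem th_inversion:
  assumes p: "p > 0" and \<tau>: "Im \<tau> > 0"
  shows "th p r (- 1 / \<tau>) = csqrt (- \<i> * \<tau>) / of_real (sqrt (2 * p)) *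
     fsum (2 * p) (\<lambda>j. if odd j then of_real (2 * cos (pi * r * j / p)) else 0) \<tau>"
proof -
  have inner: "(\<Sum>a<2*p. tc p r (int a) * of_real (cos (2 * pi * a * j / (2 * p))))
      = (if odd j then of_real (2 * cos (pi * r * j / p)) else 0)" for j :: int
  proof -
    let ?g = "\<lambda>m::int. complex_of_real (cos (pi * m * j / p))"
    have g: "?g (m + int p) = (if even j then ?g m else - ?g m)" for m
    proof -
      have "pi * real_of_int (m + int p) * j / p = pi * m * j / p + real_of_int j * pi"
        using p by (simp add: field_simps)
      then show ?thesis by (simp only: cos_add_int_pi) simp
    qed
    have g2: "?g (m + int (2 * p)) = ?g m" for m
      using g[of m] g[of "m + int p"] by (simp only: int_ops add.assoc[symmetric] mult_2) (auto split: if_splits)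
    have "(\<Sum>a<2*p. tc p r (int a) * of_real (cos (2 * pi * a * j / (2 * p)))) = (\<Sum>a<2*p. tc p r (int a) * ?g (int a))"
      by (intro sum.cong refl) (simp add: mult_ac)
    also have "\<dots> = ?g r - ?g (r + int p)" by (rule sum_tc[of p ?g r, OF p g2])
    finally show ?thesis unfolding g by simp
  qed
  show ?thesis
    unfolding th_def using p \<tau> tc_periodic[OF p, of r]
    by (subst fsum_inversion) (simp_all add: inner del: of_nat_mult)
qed

section \<open>The Dedekind eta function\<close>

definition eta :: "complex \<Rightarrow> complex" where "eta = th 6 (-1)"

text \<open>The sum of the two \<open>tc\<close> is the even primitive character modulo 12, with
  values 1, -1, -1, 1 at 1, 5, 7, 11. It is an eigenvector of the cosine transform, which is why eta
  inverts to itself. Both sides have period 12, so twelve residues are compared.\<close>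

lemma tc_6_sum:
  "of_real (sqrt 3) * (tc 6 (-1) j + tc 6 1 j) = (if odd j then of_real (2 * cos (pi * real_of_int (-1) * real_of_int j / real 6)) else 0)"
  (is "?L j = ?R j")
proof -
  have L: "?L (m + 12) = ?L m" for m
    using tc_periodic[of 6 "-1" m] tc_periodic[of 6 1 m] by simp
  have R: "?R (m + 12) = ?R m" for m
  proof -
    have "pi * real_of_int (-1) * real_of_int (m + 12) / real 6 = pi * real_of_int (-1) * real_of_int m / real 6 + real_of_int (-2) * pi"
      by (simp add: field_simps)
    then show ?thesis by (simp only: cos_add_int_pi) simp
  qed
  have red: "?L (j mod 12) = ?L j" "?R (j mod 12) = ?R j"
  proof -
    show "?L (j mod 12) = ?L j"
      using periodic_mult[of ?L 12 "j div 12" "j mod 12", OF L] unfolding mult_div_mod_eq by (rule sym)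
    show "?R (j mod 12) = ?R j"
      using periodic_mult[of ?R 12 "j div 12" "j mod 12", OF R] unfolding mult_div_mod_eq by (rule sym)
  qed
  define s where "s = j mod 12"
  have c: "cos (pi * 5 / 6) = - sqrt 3 / 2" "cos (pi * 7 / 6) = - sqrt 3 / 2" "cos (pi * 11 / 6) = sqrt 3 / 2"
     "cos (pi * 9 / 6) = 0" "cos (pi * 3 / 6) = 0" "cos (pi / 6) = sqrt 3 / 2"
  proof -
    show "cos (pi / 6) = sqrt 3 / 2" by (rule cos_30)
    have "pi * 5 / 6 = - (pi / 6) + pi" "pi * 7 / 6 = pi / 6 + pi" "pi * 11 / 6 = - (pi / 6) + 2 * pi"
      "pi * 9 / 6 = pi / 2 + pi" "pi * 3 / 6 = pi / 2" by simp_all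
    then show "cos (pi * 5 / 6) = - sqrt 3 / 2" "cos (pi * 7 / 6) = - sqrt 3 / 2" "cos (pi * 11 / 6) = sqrt 3 / 2"
     "cos (pi * 9 / 6) = 0" "cos (pi * 3 / 6) = 0"
      by (simp_all only: cos_periodic_pi cos_periodic cos_minus cos_30 cos_pi_half)
  qed
  have "s \<in> {0..11}" by (simp add: s_def)
  then have "s \<in> {0,1,2,3,4,5,6,7,8,9,10,11}" unfolding atLeastAtMost_iff insert_iff empty_iff by presburger
  then have "?L s = ?R s" using c
    by (elim insertE emptyE) (simp_all add: tc_def c)
  then show ?thesis unfolding s_def red .
qed

lemma th_summable:
  assumes "p > 0" "Im \<tau> > 0"
  shows "(\<lambda>m. tc p r m * exp (of_real pi * \<i> * \<tau> * of_real ((of_int m)\<^sup>2 / of_nat (2 * p)))) summable_on UNIV"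
  using assms by (intro fsum_summable[OF norm_tc]) auto

text \<open>\<open>th 6 1\<close> equals \<open>th 6 (-1)\<close>, so the transformed series is 2
  sqrt 3 times eta, and 2 sqrt 3 = sqrt 12 cancels the normalisation.\<close>

theorem eta_inversion:
  assumes \<tau>: "Im \<tau> > 0"
  shows "eta (- 1 / \<tau>) = csqrt (- \<i> * \<tau>) * eta \<tau>"
proof -
  let ?e = "\<lambda>m. exp (of_real pi * \<i> * \<tau> * of_real ((of_int m)\<^sup>2 / of_nat (2 * 6)))"
  have "fsum (2 * 6) (\<lambda>j. if odd j then of_real (2 * cos (pi * real_of_int (-1) * real_of_int j / real 6)) else 0) \<tau>
     = (\<Sum>\<^sub>\<infinity>m. of_real (sqrt 3) * (tc 6 (-1) m * ?e m + tc 6 1 m * ?e m))"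
    unfolding fsum_def tc_6_sum[symmetric] by (simp only: distrib_right mult.assoc distrib_left)
  also have "\<dots> = of_real (sqrt 3) * (th 6 (-1) \<tau> + th 6 1 \<tau>)"
    unfolding infsum_cmult_right' th_def fsum_def
    by (subst infsum_add) (use th_summable[OF _ \<tau>, of 6] in auto)
  also have "\<dots> = of_real (2 * sqrt 3) * eta \<tau>"
    using th_uminus[of 6 1 \<tau>] by (simp add: eta_def)
  finally have f: "fsum (2 * 6) (\<lambda>j. if odd j then of_real (2 * cos (pi * real_of_int (-1) * real_of_int j / real 6)) else 0) \<tau>
     = of_real (2 * sqrt 3) * eta \<tau>" .
  have "sqrt (real (2 * 6)) = 2 * sqrt 3"
    using real_sqrt_mult[of 4 3] by simp
  then show ?thesis
    unfolding eta_def using th_inversion[of 6 \<tau> "-1", OF _ \<tau>] unfolding f eta_def by simp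
qed

lemma exp_2pi_int: "exp (2 * of_real pi * \<i> * of_int n) = 1"
  by (metis (no_types, lifting) exp_2pi_1_int mult.commute mult.assoc of_int_mult of_int_numeral of_real_of_int_eq)


text \<open>(6 n - 1)^2 is 1 modulo 24 for every n, as n (3 n - 1) is even, so all terms acquire the
  same phase.\<close>

lemma eta_translate: "eta (\<tau> + of_int b) = exp (of_real pi * \<i> * of_int b / 12) * eta \<tau>"
proof -
  have *: "exp (of_real pi * \<i> * (\<tau> + of_int b) * of_real ((of_int (int 6 * n + -1))\<^sup>2 / of_nat (2 * 6)))
     = exp (of_real pi * \<i> * of_int b / 12) * exp (of_real pi * \<i> * \<tau> * of_real ((of_int (int 6 * n + -1))\<^sup>2 / of_nat (2 * 6)))" for n :: int
  proof -
    have "even (3 * n\<^sup>2 - n)" by simp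
    then obtain s where s: "3 * n\<^sup>2 - n = 2 * s" by (elim evenE)
    have "(6 * n - 1)\<^sup>2 = 12 * (3 * n\<^sup>2 - n) + 1" by (simp add: power2_eq_square algebra_simps)
    then have "(int 6 * n + -1)\<^sup>2 = 24 * s + 1" unfolding s by simp
    then have "(real_of_int (int 6 * n + -1))\<^sup>2 = 24 * real_of_int s + 1"
      by (metis of_int_add of_int_mult of_int_numeral of_int_1 of_int_power)
    then have "of_real pi * \<i> * of_int b * of_real ((of_int (int 6 * n + -1))\<^sup>2 / of_nat (2 * 6))
        = of_real pi * \<i> * of_int b / 12 + 2 * of_real pi * \<i> * of_int (b * s)"
      by (simp add: field_simps)
    then have "exp (of_real pi * \<i> * of_int b * of_real ((of_int (int 6 * n + -1))\<^sup>2 / of_nat (2 * 6)))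
       = exp (of_real pi * \<i> * of_int b / 12)" by (simp only: exp_add exp_2pi_int mult_1_right)
    then show ?thesis by (simp only: distrib_left distrib_right exp_add mult.commute)
  qed
  have six: "(6::nat) > 0" by simp
  show ?thesis unfolding eta_def th_series[OF six] *
    by (subst infsum_cmult_right'[symmetric]) (simp only: mult.left_commute)
qed

text \<open>(2 k n + r)^2 / (4 k) and r^2 / (4 k) differ by the integer k n^2 + n r, so one phase
  serves all terms.\<close>

lemma theta_translate:
  assumes k: "k > 0"
  shows "th (2 * k) r (2 * (\<tau> + of_int b)) = exp (of_real pi * \<i> * of_int b * (of_int r)\<^sup>2 / (2 * of_nat k)) * th (2 * k) r (2 * \<tau>)"
proof -
  have *: "exp (of_real pi * \<i> * (2 * (\<tau> + of_int b)) * of_real ((of_int (int (2 * k) * n + r))\<^sup>2 / of_nat (2 * (2 * k))))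
     = exp (of_real pi * \<i> * of_int b * (of_int r)\<^sup>2 / (2 * of_nat k)) *
       exp (of_real pi * \<i> * (2 * \<tau>) * of_real ((of_int (int (2 * k) * n + r))\<^sup>2 / of_nat (2 * (2 * k))))" for n :: int
  proof -
    have "(real_of_int (int (2 * k) * n + r))\<^sup>2 / of_nat (2 * (2 * k)) = of_int (int k * n\<^sup>2 + n * r) + (of_int r)\<^sup>2 / (4 * k)"
      using k by (simp add: power2_eq_square field_simps)
    then have "of_real pi * \<i> * (2 * of_int b) * of_real ((of_int (int (2 * k) * n + r))\<^sup>2 / of_nat (2 * (2 * k)))
      = of_real pi * \<i> * (2 * of_int b) * (of_int (int k * n\<^sup>2 + n * r) + (of_int r)\<^sup>2 / (4 * of_nat k))" by simp
    also have "\<dots> = of_real pi * \<i> * of_int b * (of_int r)\<^sup>2 / (2 * of_nat k) + 2 * of_real pi * \<i> * of_int (b * (int k * n\<^sup>2 + n * r))"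
      using k by (simp add: field_simps)
    finally have "exp (of_real pi * \<i> * (2 * of_int b) * of_real ((of_int (int (2 * k) * n + r))\<^sup>2 / of_nat (2 * (2 * k))))
       = exp (of_real pi * \<i> * of_int b * (of_int r)\<^sup>2 / (2 * of_nat k))" by (simp only: exp_add exp_2pi_int mult_1_right)
    then show ?thesis by (simp only: distrib_left distrib_right exp_add mult.commute)
  qed
  have k2: "2 * k > 0" using k by simp
  show ?thesis unfolding th_series[OF k2] *
    by (subst infsum_cmult_right'[symmetric]) (simp only: mult.left_commute)
qed

text \<open>The sequences \<open>tc p a\<close> with 0 \<le> a < p form a basis of the
  p-antiperiodic ones, and the coordinates of c are its values at these a. This is how the second
  inversion ends in theta series again.\<close>

lemma fsum_antiperiodic:
  assumes p: "p > 0" and c: "\<And>m. c (m + int p) = - c m" and \<tau>: "Im \<tau> > 0"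
  shows "fsum (2 * p) c \<tau> = (\<Sum>a<p. c (int a) * th p (int a) \<tau>)"
proof -
  let ?e = "\<lambda>m. exp (of_real pi * \<i> * \<tau> * of_real ((of_int m)\<^sup>2 / of_nat (2 * p)))"
  have anti: "c (int p * t + r) = sgn_pow t * c r" for t r
  proof (induction t rule: int_induct[where k = 0])
    case (step1 t)
    have "c (int p * (t + 1) + r) = - c (int p * t + r)" using c[of "int p * t + r"] by (simp add: algebra_simps)
    then show ?case using step1 by (simp add: sgn_pow_simps(1))
  next
    case (step2 t)
    have "c (int p * t + r) = - c (int p * (t - 1) + r)" using c[of "int p * (t - 1) + r"] by (simp add: algebra_simps)
    moreover have "sgn_pow t = - sgn_pow (t - 1)" using sgn_pow_simps(1)[of "t - 1"] by simp
    ultimately show ?case using step2 by simp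
  qed simp
  have exp: "c m = (\<Sum>a<p. c (int a) * tc p (int a) m)" for m
  proof -
    have m: "int (nat (m mod int p)) = m mod int p" using p by simp
    have lt: "nat (m mod int p) < p" using p by (simp add: nat_less_iff)
    have "(\<Sum>a<p. c (int a) * tc p (int a) m) = (\<Sum>a\<in>{nat (m mod int p)}. c (int a) * tc p (int a) m)"
    proof (rule sum.mono_neutral_right)
      show "\<forall>a\<in>{..<p} - {nat (m mod int p)}. c (int a) * tc p (int a) m = 0"
      proof
        fix a assume a: "a \<in> {..<p} - {nat (m mod int p)}"
        have "\<not> int p dvd m - int a"
        proof
          assume "int p dvd m - int a"
          then have "m mod int p = int a mod int p" by (simp add: mod_eq_dvd_iff)
          moreover have "int a mod int p = int a" using a by (simp add: of_nat_mod[symmetric] del: of_nat_mod)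
          ultimately show False using a by simp
        qed
        then show "c (int a) * tc p (int a) m = 0" by (simp add: tc_def)
      qed
    qed (use lt in auto)
    also have "\<dots> = c (m mod int p) * tc p (m mod int p) m" using m by simp
    also have "\<dots> = sgn_pow (m div int p) * c (m mod int p)"
      by (simp add: tc_def minus_mod_eq_mult_div)
    also have "\<dots> = c m" using anti[of "m div int p" "m mod int p"] by simp
    finally show ?thesis by simp
  qed
  have "fsum (2 * p) c \<tau> = (\<Sum>\<^sub>\<infinity>m. \<Sum>a<p. c (int a) * (tc p (int a) m * ?e m))"
    unfolding fsum_def
    by (intro infsum_cong, subst exp) (simp only: sum_distrib_right mult.assoc)
  also have "\<dots> = (\<Sum>a<p. \<Sum>\<^sub>\<infinity>m. c (int a) * (tc p (int a) m * ?e m))"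
    by (intro infsum_sum_swap summable_on_cmult_right th_summable p \<tau>)
  also have "\<dots> = (\<Sum>a<p. c (int a) * th p (int a) \<tau>)"
    unfolding th_def fsum_def infsum_cmult_right' ..
  finally show ?thesis .
qed

section \<open>Two inversions with a translation in between\<close>

lemma sum_odd_filter:
  fixes f :: "nat \<Rightarrow> complex"
  shows "(\<Sum>n<2*N. if odd n then f n else 0) = (\<Sum>j<N. f (2 * j + 1))"
  by (induction N) auto

text \<open>The kernel of the composite transformation: the cosines of the two inversions over the
  odd residues 2 j + 1 below 2 k, weighted by the phases of the translation in between.\<close>

definition theta_coeff :: "nat \<Rightarrow> int \<Rightarrow> int \<Rightarrow> int \<Rightarrow> complex" where
  "theta_coeff k m r a = (\<Sum>j<k. of_real (cos (pi * r * (2 * real j + 1) / real (2 * k)) * cos (pi * a * (2 * real j + 1) / real (2 * k)))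
      * exp (- (of_real pi * \<i> * of_int m * of_real ((2 * real j + 1)\<^sup>2) / (2 * of_nat k))))"

definition quot :: "nat \<Rightarrow> int \<Rightarrow> complex \<Rightarrow> complex" where
  "quot k r \<tau> = th (2 * k) r (2 * \<tau>) / eta \<tau>"

lemma exp_quadratic_periodic:
  assumes k: "k > 0"
  shows "exp (- (of_real pi * \<i> * of_int m * (of_int (j + int (2 * k)))\<^sup>2 / (2 * of_nat k)))
    = exp (- (of_real pi * \<i> * of_int m * (of_int j)\<^sup>2 / (2 * of_nat k)))"
proof -
  have "- (of_real pi * \<i> * of_int m * (of_int (j + int (2 * k)))\<^sup>2 / (2 * of_nat k))
      = - (of_real pi * \<i> * of_int m * (of_int j)\<^sup>2 / (2 * of_nat k)) + 2 * of_real pi * \<i> * of_int (- m * (j + int k))"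
    using k by (simp add: field_simps power2_eq_square)
  then show ?thesis by (simp only: exp_add exp_2pi_int mult_1_right)
qed

text \<open>The coefficients c on the left live on odd j, so their transform \<open>ch\<close> is
  2k-antiperiodic and expands in theta series; and c (j + 2 k) = (-1)^r c j, so \<open>ch\<close>
  vanishes off the parity of r. The factor 4 is the 2 inside c times the 2 from pairing n with n + 2
  k.\<close>

theorem theta_transform:
  assumes k: "k > 0" and \<tau>: "Im \<tau> > 0"
  shows "fsum (4 * k) (\<lambda>j. (if odd j then of_real (2 * cos (pi * r * j / real (2 * k))) else 0) *
             exp (- (of_real pi * \<i> * of_int m * (of_int j)\<^sup>2 / (2 * of_nat k)))) (- 1 / (2 * \<tau>))
     = csqrt (- \<i> * (2 * \<tau>)) / of_real (sqrt (real (4 * k))) *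
       (\<Sum>a<2*k. if even (int a - r) then 4 * theta_coeff k m r (int a) * th (2 * k) (int a) (2 * \<tau>) else 0)"
proof -
  define E where "E j = exp (- (of_real pi * \<i> * of_int m * (of_int j)\<^sup>2 / (2 * of_nat k)))" for j :: int
  have E2: "E (j + int (2 * k)) = E j" for j unfolding E_def by (rule exp_quadratic_periodic[OF k])
  define c where "c j = (if odd j then of_real (2 * cos (pi * r * j / real (2 * k))) else 0) * E j" for j :: int
  have cos_shift: "cos (pi * real_of_int s * real_of_int (j + int (2 * k)) / real (2 * k))
      = (if even s then cos (pi * s * j / real (2 * k)) else - cos (pi * s * j / real (2 * k)))" for s j
  proof -
    have "pi * real_of_int s * real_of_int (j + int (2 * k)) / (2 * k) = pi * s * j / real (2 * k) + real_of_int s * pi"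
      using k by (simp add: field_simps)
    then show ?thesis by (simp only: cos_add_int_pi)
  qed
  have c2: "c (j + int (2 * k)) = (if even r then c j else - c j)" for j
    unfolding c_def E2 cos_shift by simp
  have c4: "c (j + int (4 * k)) = c j" for j
  proof -
    have "j + int (4 * k) = (j + int (2 * k)) + int (2 * k)" by simp
    then show ?thesis by (simp only: c2) simp
  qed
  define ch where "ch j = (\<Sum>a<4*k. c (int a) * of_real (cos (2 * pi * a * j / real (4 * k))))" for j :: int
  let ?t = "\<lambda>j n. c (int n) * of_real (cos (pi * real_of_int j * real_of_int (int n) / real (2 * k)))"
  have ch_eq: "ch j = (\<Sum>n<k. ?t j (2 * n + 1) + ?t j (2 * n + 1 + 2 * k))" for j
  proof -
    have "ch j = (\<Sum>n<2*(2*k). if odd n then ?t j n else 0)"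
      unfolding ch_def by (intro sum.cong) (auto simp: c_def mult_ac)
    also have "\<dots> = (\<Sum>n<2*k. ?t j (2 * n + 1))" by (rule sum_odd_filter)
    also have "\<dots> = (\<Sum>n<k. ?t j (2 * n + 1)) + (\<Sum>n\<in>{k..<2*k}. ?t j (2 * n + 1))"
      by (subst sum.union_disjoint[symmetric]) (auto intro: sum.cong)
    also have "(\<Sum>n\<in>{k..<2*k}. ?t j (2 * n + 1)) = (\<Sum>n<k. ?t j (2 * n + 1 + 2 * k))"
      by (rule sum.reindex_bij_witness[of _ "\<lambda>n. n + k" "\<lambda>n. n - k"]) auto
    finally show ?thesis by (simp only: sum.distrib)
  qed
  have shift: "?t j (n + 2 * k) = (if even (j - r) then ?t j n else - ?t j n)" for j n
  proof -
    have i: "int (n + 2 * k) = int n + int (2 * k)" by simp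
    show ?thesis unfolding i c2 cos_shift by auto
  qed
  have ch_val: "ch j = (if even (j - r) then 4 * theta_coeff k m r j else 0)" for j
  proof (cases "even (j - r)")
    case True
    have "ch j = (\<Sum>n<k. 2 * ?t j (2 * n + 1))" unfolding ch_eq shift using True by (simp only: if_True mult_2)
    also have "\<dots> = (\<Sum>n<k. 4 * (of_real (cos (pi * r * (2 * real n + 1) / real (2 * k)) * cos (pi * j * (2 * real n + 1) / real (2 * k)))
      * exp (- (of_real pi * \<i> * of_int m * of_real ((2 * real n + 1)\<^sup>2) / (2 * of_nat k)))))"
      by (intro sum.cong refl) (simp add: c_def E_def mult_ac add.commute)
    also have "\<dots> = 4 * theta_coeff k m r j" unfolding theta_coeff_def sum_distrib_left ..
    finally show ?thesis using True by simp
  next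
    case False
    then show ?thesis unfolding ch_eq shift by simp
  qed
  have ch_anti: "ch (j + int (2 * k)) = - ch j" for j
  proof -
    have "cos (2 * pi * real a * real_of_int (j + int (2 * k)) / real (4 * k)) = - cos (2 * pi * a * j / real (4 * k))" if "odd a" for a :: nat
    proof -
      have "2 * pi * real a * real_of_int (j + int (2 * k)) / real (4 * k) = 2 * pi * a * j / real (4 * k) + real_of_int (int a) * pi"
        using k by (simp add: field_simps)
      then show ?thesis using that by (simp only: cos_add_int_pi) simp
    qed
    then have "c (int a) * of_real (cos (2 * pi * real a * real_of_int (j + int (2 * k)) / real (4 * k)))
        = - (c (int a) * of_real (cos (2 * pi * a * j / real (4 * k))))" for a :: nat
      by (cases "odd a") (simp_all add: c_def)
    then show ?thesis unfolding ch_def by (simp only: sum_negf)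
  qed
  have im: "Im (2 * \<tau>) > 0" using \<tau> by simp
  have "fsum (4 * k) c (- 1 / (2 * \<tau>)) = csqrt (- \<i> * (2 * \<tau>)) / of_real (sqrt (real (4 * k))) * fsum (4 * k) ch (2 * \<tau>)"
    unfolding ch_def using fsum_inversion[of "4 * k" c "2 * \<tau>", OF _ c4 im] k by simp
  also have "fsum (4 * k) ch (2 * \<tau>) = (\<Sum>a<2*k. ch (int a) * th (2 * k) (int a) (2 * \<tau>))"
    using fsum_antiperiodic[of "2 * k" ch "2 * \<tau>", OF _ ch_anti im] k by simp
  also have "\<dots> = (\<Sum>a<2*k. if even (int a - r) then 4 * theta_coeff k m r (int a) * th (2 * k) (int a) (2 * \<tau>) else 0)"
    by (intro sum.cong refl) (simp add: ch_val)
  finally show ?thesis unfolding c_def E_def .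
qed

text \<open>The numerator is inverted at \<sigma> / 2 and at 2 \<tau>, the denominator at \<sigma>
  and at \<tau>, so the factors csqrt cancel. The two normalisations sqrt (4 k) against the factor 4
  leave 1 / k, and translating eta by -4 m gives exp (pi \<i> m / 3).\<close>

theorem quot_transform:
  assumes k: "k > 0" and \<tau>: "Im \<tau> > 0" and eta_nz: "eta \<tau> \<noteq> 0"
  shows "quot k r (\<tau> / (4 * of_int m * \<tau> + 1)) = exp (of_real pi * \<i> * of_int m / 3) / of_nat k *
      (\<Sum>a<2*k. if even (int a - r) then theta_coeff k m r (int a) * quot k (int a) \<tau> else 0)"
proof -
  define \<sigma> where "\<sigma> = - 1 / \<tau> + of_int (- 4 * m)"
  have \<tau>0: "\<tau> \<noteq> 0" using \<tau> by auto
  have im1: "Im (- 1 / \<tau>) > 0" by (rule Im_minus_inverse_pos[OF \<tau>])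
  have im\<sigma>: "Im \<sigma> > 0" using im1 by (simp add: \<sigma>_def)
  then have \<sigma>0: "\<sigma> \<noteq> 0" by auto
  have "\<sigma> * \<tau> = - (4 * of_int m * \<tau> + 1)" using \<tau>0 by (simp add: \<sigma>_def field_simps)
  then have target: "\<tau> / (4 * of_int m * \<tau> + 1) = - 1 / \<sigma>"
    using \<tau>0 \<sigma>0 by (metis (no_types, lifting) divide_divide_eq_left divide_minus_left divide_minus_right
        div_self minus_minus mult.commute mult_minus_right nonzero_divide_mult_cancel_left)
  have 2: "2 * (- 1 / \<sigma>) = - 1 / (\<sigma> / of_nat 2)" by simp
  have im\<sigma>2: "Im (\<sigma> / of_nat 2) > 0" using im\<sigma> by simp
  let ?c = "\<lambda>j. if odd j then complex_of_real (2 * cos (pi * r * real_of_int j / real (2 * k))) else 0"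
  have k2: "2 * k > 0" using k by simp
  have cs: "csqrt (- \<i> * (\<sigma> / of_nat 2)) = csqrt (- \<i> * \<sigma>) / of_real (sqrt 2)"
    using csqrt_divide_nat[of 2 "- \<i> * \<sigma>"] by simp
  have cs2: "csqrt (- \<i> * (2 * \<tau>)) = of_real (sqrt 2) * csqrt (- \<i> * \<tau>)"
    using csqrt_divide_nat[of 2 "- \<i> * (2 * \<tau>)"] by (simp add: field_simps)
  have num: "th (2 * k) r (2 * (- 1 / \<sigma>)) = csqrt (- \<i> * \<sigma>) / of_real (sqrt 2) / of_real (sqrt (real (4 * k))) * fsum (4 * k) ?c (\<sigma> / 2)"
  proof -
    have "2 * (2 * k) = 4 * k" by simp
    then show ?thesis
      unfolding 2 using th_inversion[OF k2 im\<sigma>2, of r] unfolding cs by simp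
  qed
  \<comment> \<open>\<sigma> / 2 = -1/(2 \<tau>) - 2 m, and against j^2 / (4 k) the translation
    becomes the phase exp (-pi \<i> m j^2 / (2 k)).\<close>
  have tr: "fsum (4 * k) ?c (\<sigma> / 2) = fsum (4 * k) (\<lambda>j. ?c j * exp (- (of_real pi * \<i> * of_int m * (of_int j)\<^sup>2 / (2 * of_nat k)))) (- 1 / (2 * \<tau>))"
    unfolding fsum_def
  proof (rule infsum_cong)
    fix j :: int
    have "of_real pi * \<i> * (\<sigma> / 2) * of_real ((of_int j)\<^sup>2 / of_nat (4 * k))
        = - (of_real pi * \<i> * of_int m * (of_int j)\<^sup>2 / (2 * of_nat k)) + of_real pi * \<i> * (- 1 / (2 * \<tau>)) * of_real ((of_int j)\<^sup>2 / of_nat (4 * k))"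
      using k \<tau>0 by (simp add: \<sigma>_def field_simps)
    then show "?c j * exp (of_real pi * \<i> * (\<sigma> / 2) * of_real ((of_int j)\<^sup>2 / of_nat (4 * k))) =
      ?c j * exp (- (of_real pi * \<i> * of_int m * (of_int j)\<^sup>2 / (2 * of_nat k))) *
      exp (of_real pi * \<i> * (- 1 / (2 * \<tau>)) * of_real ((of_int j)\<^sup>2 / of_nat (4 * k)))"
      by (simp only: exp_add mult.assoc)
  qed
  define S where "S = (\<Sum>a<2*k. if even (int a - r) then theta_coeff k m r (int a) * th (2 * k) (int a) (2 * \<tau>) else 0)"
  have S4: "(\<Sum>a<2*k. if even (int a - r) then 4 * theta_coeff k m r (int a) * th (2 * k) (int a) (2 * \<tau>) else 0) = 4 * S"
    unfolding S_def sum_distrib_left by (intro sum.cong) auto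
  have den: "eta (- 1 / \<sigma>) = csqrt (- \<i> * \<sigma>) * (exp (- (of_real pi * \<i> * of_int m / 3)) * (csqrt (- \<i> * \<tau>) * eta \<tau>))"
  proof -
    have "eta \<sigma> = exp (of_real pi * \<i> * of_int (- 4 * m) / 12) * eta (- 1 / \<tau>)"
      unfolding \<sigma>_def by (rule eta_translate)
    moreover have "of_real pi * \<i> * of_int (- 4 * m) / 12 = - (of_real pi * \<i> * of_int m / 3)" by simp
    ultimately show ?thesis unfolding eta_inversion[OF im\<sigma>] eta_inversion[OF \<tau>] by (simp add: mult_ac)
  qed
  have nz: "csqrt (- \<i> * \<sigma>) \<noteq> 0" "csqrt (- \<i> * \<tau>) \<noteq> 0" using \<sigma>0 \<tau>0 by simp_all
  have sq: "complex_of_real (sqrt (real (4 * k))) * complex_of_real (sqrt (real (4 * k))) = 4 * of_nat k"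
    unfolding of_real_mult[symmetric] by simp
  have num': "th (2 * k) r (2 * (- 1 / \<sigma>)) = csqrt (- \<i> * \<sigma>) * csqrt (- \<i> * \<tau>) * S / of_nat k"
  proof -
    have "th (2 * k) r (2 * (- 1 / \<sigma>)) = csqrt (- \<i> * \<sigma>) * csqrt (- \<i> * \<tau>) * (4 * S) *
        (of_real (sqrt 2) / of_real (sqrt 2)) / (complex_of_real (sqrt (real (4 * k))) * complex_of_real (sqrt (real (4 * k))))"
      unfolding num tr theta_transform[OF k \<tau>] S4 cs2 by (simp only: times_divide_eq_left times_divide_eq_right divide_divide_eq_left mult_ac)
    then show ?thesis unfolding sq using k by simp
  qed
  have "quot k r (- 1 / \<sigma>) = exp (of_real pi * \<i> * of_int m / 3) / of_nat k * (S / eta \<tau>)"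
    unfolding quot_def num' den using nz eta_nz k by (simp add: exp_minus field_simps)
  also have "S / eta \<tau> = (\<Sum>a<2*k. if even (int a - r) then theta_coeff k m r (int a) * quot k (int a) \<tau> else 0)"
    unfolding S_def quot_def sum_divide_distrib by (intro sum.cong) auto
  finally show ?thesis unfolding target .
qed


section \<open>The components of the vectors as quotients of theta series\<close>

lemma qpow_powi: "qpow 1 \<tau> powi e = exp (2 * of_real pi * \<i> * \<tau> * of_int e)"
  unfolding qpow_def by (simp add: exp_power_int mult_ac)

lemma nome_qpow: "Im \<tau> > 0 \<Longrightarrow> nome (qpow 1 \<tau>)"
  by unfold_locales (simp_all add: qpow_def norm_exp_eq_Re)

text \<open>24 (n^2 + tri n) + 1 = (6 n - 1)^2.\<close>

lemma eta_pentagonal: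
  "eta \<tau> = qpow (1 / 24) \<tau> * (\<Sum>\<^sub>\<infinity>n. sgn_pow n * qpow 1 \<tau> powi (n\<^sup>2 + tri n))"
proof -
  have six: "(6::nat) > 0" by simp
  have *: "exp (of_real pi * \<i> * \<tau> * of_real ((of_int (int 6 * n + -1))\<^sup>2 / of_nat (2 * 6)))
     = qpow (1 / 24) \<tau> * qpow 1 \<tau> powi (n\<^sup>2 + tri n)" for n :: int
  proof -
    have t: "2 * tri n = n * n - n" using two_tri[of n] by (simp add: right_diff_distrib)
    have "24 * (n\<^sup>2 + tri n) + 1 = 24 * (n * n) + 12 * (2 * tri n) + 1"
      by (simp add: power2_eq_square distrib_left)
    also have "\<dots> = 24 * (n * n) + 12 * (n * n - n) + 1" unfolding t ..
    also have "\<dots> = (int 6 * n + -1)\<^sup>2" by (simp add: power2_eq_square algebra_simps)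
    finally have "(int 6 * n + -1)\<^sup>2 = 24 * (n\<^sup>2 + tri n) + 1" by (rule sym)
    then have "(real_of_int (int 6 * n + -1))\<^sup>2 = 24 * real_of_int (n\<^sup>2 + tri n) + 1"
      by (simp only: of_int_power[symmetric])
    then have "of_real pi * \<i> * \<tau> * of_real ((of_int (int 6 * n + -1))\<^sup>2 / of_nat (2 * 6))
       = 2 * of_real pi * \<i> * of_real (1 / 24) * \<tau> + 2 * of_real pi * \<i> * \<tau> * of_int (n\<^sup>2 + tri n)"
      by (simp add: field_simps)
    then show ?thesis unfolding qpow_powi by (simp only: qpow_def exp_add)
  qed
  show ?thesis
    unfolding eta_def th_series[OF six] *
    by (subst infsum_cmult_right'[symmetric]) (simp only: mult.left_commute)
qed

lemma eta_nonzero: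
  assumes "Im \<tau> > 0"
  shows "eta \<tau> \<noteq> 0"
proof -
  interpret nome "qpow 1 \<tau>" by (rule nome_qpow[OF assms])
  have "qpow (1 / 24) \<tau> \<noteq> 0" by (simp add: qpow_def)
  with pentagonal_nonzero show ?thesis unfolding eta_pentagonal by (rule no_zero_divisors[rotated])
qed

text \<open>Completing the square, (2 k n + r)^2 / (4 k) = k n^2 + r n + r^2 / (4 k); this is the
  origin of the prefactors q^(r^2 / (4 k)) of the components.\<close>

lemma theta_bterm:
  assumes k: "k > 0"
  shows "th (2 * k) (int r) (2 * \<tau>) = qpow ((real r)\<^sup>2 / (4 * real k)) \<tau> *
      (\<Sum>\<^sub>\<infinity>n. sgn_pow n * qpow 1 \<tau> powi (int k * n\<^sup>2 + int r * n))"
proof -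
  have k2: "2 * k > 0" using k by simp
  have *: "exp (of_real pi * \<i> * (2 * \<tau>) * of_real ((of_int (int (2 * k) * n + int r))\<^sup>2 / of_nat (2 * (2 * k))))
     = qpow ((real r)\<^sup>2 / (4 * real k)) \<tau> * qpow 1 \<tau> powi (int k * n\<^sup>2 + int r * n)" for n :: int
  proof -
    have "(real_of_int (int (2 * k) * n + int r))\<^sup>2 / of_nat (2 * (2 * k)) = (real r)\<^sup>2 / (4 * real k) + real_of_int (int k * n\<^sup>2 + int r * n)"
      using k by (simp add: power2_eq_square field_simps)
    then have "of_real pi * \<i> * (2 * \<tau>) * of_real ((of_int (int (2 * k) * n + int r))\<^sup>2 / of_nat (2 * (2 * k)))
       = 2 * of_real pi * \<i> * of_real ((real r)\<^sup>2 / (4 * real k)) * \<tau> + 2 * of_real pi * \<i> * \<tau> * of_int (int k * n\<^sup>2 + int r * n)"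
      by (simp only: of_real_add of_real_of_int_eq) (simp add: algebra_simps)
    then show ?thesis unfolding qpow_powi by (simp only: qpow_def exp_add)
  qed
  show ?thesis
    unfolding th_series[OF k2] *
    by (subst infsum_cmult_right'[symmetric]) (simp only: mult.left_commute)
qed

lemma component_eq_quot:
  assumes k: "k \<ge> 2" and r: "r < k" and \<tau>: "Im \<tau> > 0"
  shows "qpow (- 1 / 24) \<tau> * (qpow ((real r)\<^sup>2 / (4 * real k)) \<tau> * x2k k (k - r) (qpow 1 \<tau>)) = quot k (int r) \<tau>"
proof -
  interpret nome "qpow 1 \<tau>" by (rule nome_qpow[OF \<tau>])
  let ?P = "\<Sum>\<^sub>\<infinity>n. sgn_pow n * qpow 1 \<tau> powi (n\<^sup>2 + tri n)"
  have "?P * x2k k (k - r) (qpow 1 \<tau>) = (\<Sum>\<^sub>\<infinity>n. sgn_pow n * qpow 1 \<tau> powi (int k * n\<^sup>2 + int r * n))"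
    using bressoud[OF k, of "k - r"] r by simp
  then have "quot k (int r) \<tau> = qpow ((real r)\<^sup>2 / (4 * real k)) \<tau> * (?P * x2k k (k - r) (qpow 1 \<tau>)) / (qpow (1 / 24) \<tau> * ?P)"
    unfolding quot_def eta_pentagonal using theta_bterm[of k r \<tau>] k by simp
  also have "\<dots> = 1 / qpow (1 / 24) \<tau> * (qpow ((real r)\<^sup>2 / (4 * real k)) \<tau> * x2k k (k - r) (qpow 1 \<tau>))"
  proof -
    have "A * (P * x) / (Q * P) = 1 / Q * (A * x)" if "P \<noteq> 0" for A P x Q :: complex
      using that by simp
    from this[OF pentagonal_nonzero] show ?thesis .
  qed
  also have "1 / qpow (1 / 24) \<tau> = qpow (- 1 / 24) \<tau>"
  proof -
    have "qpow (1 / 24) \<tau> * qpow (- 1 / 24) \<tau> = 1" unfolding qpow_def exp_add[symmetric] by simp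
    from inverse_unique[OF this] show ?thesis by (simp add: inverse_eq_divide)
  qed
  finally show ?thesis by simp
qed

lemma X0_eq:
  assumes k: "k \<ge> 2" and \<tau>: "Im \<tau> > 0"
  shows "X0 k \<tau> = Matrix.vec ((k + 1) div 2) (\<lambda>j. quot k (int (2 * j)) \<tau>)"
proof (rule eq_vecI)
  fix j assume "j < dim_vec (Matrix.vec ((k + 1) div 2) (\<lambda>j. quot k (int (2 * j)) \<tau>))"
  then have j: "j < (k + 1) div 2" by simp
  then have "2 * j < k" by simp
  have "X0 k \<tau> $ j = qpow (- 1 / 24) \<tau> * (qpow ((real (2 * j))\<^sup>2 / (4 * real k)) \<tau> * x2k k (k - 2 * j) (qpow 1 \<tau>))"
    using j unfolding X0_def dim0_eq[OF k] of_nat_mult of_nat_numeral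
    by (simp only: index_smult_vec index_vec dim_vec)
  with component_eq_quot[OF k \<open>2 * j < k\<close> \<tau>] show "X0 k \<tau> $ j = Matrix.vec ((k + 1) div 2) (\<lambda>j. quot k (int (2 * j)) \<tau>) $ j"
    using j by simp
qed (simp only: X0_def index_smult_vec dim_vec dim0_eq[OF k])

lemma X1_eq:
  assumes k: "k \<ge> 2" and \<tau>: "Im \<tau> > 0"
  shows "X1 k \<tau> = Matrix.vec (k div 2) (\<lambda>j. quot k (int (2 * j + 1)) \<tau>)"
proof (rule eq_vecI)
  fix j assume "j < dim_vec (Matrix.vec (k div 2) (\<lambda>j. quot k (int (2 * j + 1)) \<tau>))"
  then have j: "j < k div 2" by simp
  then have r: "2 * j + 1 < k" by simp
  have "real (2 * j + 1) = 2 * real j + 1" by simp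
  then have "X1 k \<tau> $ j = qpow (- 1 / 24) \<tau> * (qpow ((real (2 * j + 1))\<^sup>2 / (4 * real k)) \<tau> * x2k k (k - (2 * j + 1)) (qpow 1 \<tau>))"
    using j unfolding X1_def dim1_eq[OF k]
    by (simp only: index_smult_vec index_vec dim_vec)
  with component_eq_quot[OF k r \<tau>] show "X1 k \<tau> $ j = Matrix.vec (k div 2) (\<lambda>j. quot k (int (2 * j + 1)) \<tau>) $ j"
    using j by simp
qed (simp only: X1_def index_smult_vec dim_vec dim1_eq[OF k])

lemma quot_uminus: "k > 0 \<Longrightarrow> quot k (- r) \<tau> = quot k r \<tau>"
  unfolding quot_def by (simp add: th_uminus)

lemma quot_shift: "k > 0 \<Longrightarrow> quot k (r + int (2 * k)) \<tau> = - quot k r \<tau>"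
  unfolding quot_def using th_shift[of "2 * k" r "2 * \<tau>"] by simp

lemma quot_reflect: "k > 0 \<Longrightarrow> quot k (int (2 * k) - r) \<tau> = - quot k r \<tau>"
  using quot_shift[of k "- r" \<tau>] quot_uminus[of k r \<tau>] by simp

text \<open>r = k is the fixed point of the reflection r -> 2 k - r, which reverses the
  sign.\<close>

lemma quot_middle: "k > 0 \<Longrightarrow> quot k (int k) \<tau> = 0"
  using quot_reflect[of k "int k" \<tau>] by simp

lemma quot_translate:
  assumes k: "k > 0"
  shows "quot k r (\<tau> + of_int b) =
    exp (of_real pi * \<i> * of_int b * (of_int r)\<^sup>2 / (2 * of_nat k)) * exp (- (of_real pi * \<i> * of_int b / 12)) * quot k r \<tau>"
  unfolding quot_def theta_translate[OF k] eta_translate by (simp add: exp_minus field_simps)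

section \<open>Folding the sums over residues\<close>

lemma sum_palindrome:
  fixes g :: "nat \<Rightarrow> complex"
  assumes "\<And>j. j < k \<Longrightarrow> g (k - 1 - j) = g j"
  shows "(\<Sum>j<k. g j) = 2 * (\<Sum>j<k div 2. g j) + (if odd k then g (k div 2) else 0)"
proof -
  have "(\<Sum>j\<in>{k - k div 2..<k}. g j) = (\<Sum>j<k div 2. g j)"
    by (rule sum.reindex_bij_witness[of _ "\<lambda>j. k - 1 - j" "\<lambda>j. k - 1 - j"]) (use assms in auto)
  moreover have "sum g {..<k} = sum g {..<k div 2} + (sum g {k div 2..<k - k div 2} + sum g {k - k div 2..<k})"
    unfolding lessThan_atLeast0 by (simp add: sum.atLeastLessThan_concat)
  moreover have "{k div 2..<k - k div 2} = (if odd k then {k div 2} else {})"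
    by (auto elim!: oddE evenE)
  ultimately show ?thesis by simp
qed

lemma sum_even_filter:
  fixes f :: "nat \<Rightarrow> complex"
  shows "(\<Sum>n<2*N. if even n then f n else 0) = (\<Sum>j<N. f (2 * j))"
  by (induction N) auto

abbreviation gauss_factor :: "nat \<Rightarrow> int \<Rightarrow> nat \<Rightarrow> complex" where
  "gauss_factor k m j \<equiv> exp (- (of_real pi * \<i> * of_int m * of_real ((2 * real j + 1)\<^sup>2) / (2 * of_nat k)))"

text \<open>The odd numbers 2 j + 1 and 2 (k - 1 - j) + 1 add up to 2 k, and the phase is even and
  2k-periodic.\<close>

lemma gauss_factor_reflect:
  assumes "j < k"
  shows "gauss_factor k m (k - 1 - j) = gauss_factor k m j"
proof -
  have k: "k > 0" using assms by simp
  have "exp (- (of_real pi * \<i> * of_int m * (of_int (- (2 * int j + 1) + int (2 * k)))\<^sup>2 / (2 * of_nat k)))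
     = exp (- (of_real pi * \<i> * of_int m * (of_int (- (2 * int j + 1)))\<^sup>2 / (2 * of_nat k)))"
    by (rule exp_quadratic_periodic[OF k])
  moreover have "complex_of_int (- (2 * int j + 1) + int (2 * k)) = of_real (2 * real (k - 1 - j) + 1)"
    using assms by (simp add: of_nat_diff algebra_simps)
  moreover have "(complex_of_int (- (2 * int j + 1)))\<^sup>2 = (of_real (2 * real j + 1))\<^sup>2"
    unfolding of_int_minus power2_minus by simp
  ultimately show ?thesis by (simp only: of_real_power)
qed

lemma cos_reflect:
  assumes "j < k"
  shows "cos (pi * real_of_int r * (2 * real (k - 1 - j) + 1) / real (2 * k))
     = (if even r then cos (pi * real_of_int r * (2 * real j + 1) / real (2 * k)) else - cos (pi * real_of_int r * (2 * real j + 1) / real (2 * k)))"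
proof -
  have "pi * real_of_int r * (2 * real (k - 1 - j) + 1) / real (2 * k) = - (pi * real_of_int r * (2 * real j + 1) / real (2 * k)) + real_of_int r * pi"
    using assms by (simp add: of_nat_diff field_simps)
  then show ?thesis by (simp only: cos_add_int_pi cos_minus)
qed

text \<open>For r and a of equal parity the signs of the two reflected cosines cancel, so j and k -
  1 - j contribute equally. For odd k the middle index is its own partner; its weight 1/2 becomes
  the halved last column of B.\<close>

lemma theta_coeff_fold:
  assumes "even (a - r)"
  shows "theta_coeff k m r a = 2 * (\<Sum>j<(k + 1) div 2. (if odd k \<and> j = k div 2 then 1 / 2 else 1) *
     (of_real (cos (pi * r * (2 * real j + 1) / real (2 * k)) * cos (pi * a * (2 * real j + 1) / real (2 * k))) * gauss_factor k m j))"
proof -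
  define g where "g j = of_real (cos (pi * r * (2 * real j + 1) / real (2 * k)) * cos (pi * a * (2 * real j + 1) / real (2 * k))) * gauss_factor k m j" for j
  have "g (k - 1 - j) = g j" if "j < k" for j
    unfolding g_def cos_reflect[OF that] gauss_factor_reflect[OF that] using assms by auto
  then have "(\<Sum>j<k. g j) = 2 * (\<Sum>j<k div 2. g j) + (if odd k then g (k div 2) else 0)"
    by (rule sum_palindrome)
  also have "\<dots> = 2 * (\<Sum>j<(k + 1) div 2. (if odd k \<and> j = k div 2 then 1 / 2 else 1) * g j)"
  proof (cases "odd k")
    case True
    then have "(k + 1) div 2 = Suc (k div 2)" by presburger
    then show ?thesis using True by simp
  next
    case False
    then have "(k + 1) div 2 = k div 2" by presburger
    then show ?thesis using False by simp
  qed
  finally show ?thesis unfolding g_def theta_coeff_def .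
qed

lemma cos_int_half_pi: "odd r \<Longrightarrow> cos (pi * real_of_int r / 2) = 0"
proof -
  assume "odd r"
  then obtain b where "r = 2 * b + 1" by (elim oddE)
  then have "pi * real_of_int r / 2 = pi / 2 + real_of_int b * pi" by (simp add: field_simps)
  then show ?thesis by (simp only: cos_add_int_pi) simp
qed

text \<open>For odd k the unpaired middle index has 2 j + 1 = k, where the cosine is cos (pi r / 2)
  = 0 for odd r. Hence A has size k div 2 and no halved column.\<close>

lemma theta_coeff_fold_odd:
  assumes "odd r" "odd a" "k > 0"
  shows "theta_coeff k m r a = 2 * (\<Sum>j<k div 2.
     of_real (cos (pi * r * (2 * real j + 1) / real (2 * k)) * cos (pi * a * (2 * real j + 1) / real (2 * k))) * gauss_factor k m j)"
proof -
  have sub: "{..<k div 2} \<subseteq> {..<(k + 1) div 2}" by auto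
  have z: "cos (pi * r * (2 * real j + 1) / real (2 * k)) = 0" if "odd k" "j = k div 2" for j
  proof -
    have "2 * real j + 1 = real k" using that by (auto elim!: oddE)
    then have eq: "pi * r * (2 * real j + 1) / real (2 * k) = pi * real_of_int r / 2" using assms(3) by (simp only:) simp
    show ?thesis unfolding eq by (rule cos_int_half_pi[OF assms(1)])
  qed
  have "even (a - r)" using assms by simp
  have "(\<Sum>j<(k + 1) div 2. (if odd k \<and> j = k div 2 then 1 / 2 else 1) *
   (of_real (cos (pi * r * (2 * real j + 1) / real (2 * k)) * cos (pi * a * (2 * real j + 1) / real (2 * k))) * gauss_factor k m j))
    = (\<Sum>j<k div 2. of_real (cos (pi * r * (2 * real j + 1) / real (2 * k)) * cos (pi * a * (2 * real j + 1) / real (2 * k))) * gauss_factor k m j)"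
  proof (rule sum.mono_neutral_cong_right)
    show "\<forall>j\<in>{..<(k + 1) div 2} - {..<k div 2}. (if odd k \<and> j = k div 2 then 1 / 2 else 1) *
      (of_real (cos (pi * r * (2 * real j + 1) / real (2 * k)) * cos (pi * a * (2 * real j + 1) / real (2 * k))) * gauss_factor k m j) = 0"
    proof
      fix j assume "j \<in> {..<(k + 1) div 2} - {..<k div 2}"
      then have "j < (k + 1) div 2" "\<not> j < k div 2" by auto
      then have "odd k" "j = k div 2" by presburger+
      from z[OF this] show "(if odd k \<and> j = k div 2 then 1 / 2 else 1) *
      (of_real (cos (pi * r * (2 * real j + 1) / real (2 * k)) * cos (pi * a * (2 * real j + 1) / real (2 * k))) * gauss_factor k m j) = 0" by simp
    qed
  qed (use sub in auto)
  with theta_coeff_fold[OF \<open>even (a - r)\<close>, of k m] show ?thesis by simp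
qed

lemma theta_coeff_reflect:
  assumes k: "k > 0"
  shows "theta_coeff k m r (int (2 * k) - a) = - theta_coeff k m r a"
proof -
  have "cos (pi * real_of_int (int (2 * k) - a) * (2 * real j + 1) / real (2 * k)) = - cos (pi * real_of_int a * (2 * real j + 1) / real (2 * k))" for j
  proof -
    have "pi * real_of_int (int (2 * k) - a) * (2 * real j + 1) / real (2 * k)
        = - (pi * real_of_int a * (2 * real j + 1) / real (2 * k)) + real_of_int (2 * int j + 1) * pi"
      using k by (simp add: field_simps)
    then show ?thesis by (simp only: cos_add_int_pi cos_minus) simp
  qed
  then show ?thesis unfolding theta_coeff_def by (simp add: sum_negf)
qed

text \<open>a and 2 k - a contribute equally, since the coefficient and the quotient both change
  sign. Of the unpaired residues, a = 0 gives the weight 1/2, which is the halved first column of C,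
  and a = k gives 0 by \<open>quot_middle\<close>.\<close>

lemma quot_sum_even:
  assumes k: "k \<ge> 2" and r: "even r"
  shows "(\<Sum>a<2*k. if even (int a - r) then theta_coeff k m r (int a) * quot k (int a) \<tau> else 0)
    = 2 * (\<Sum>l<(k + 1) div 2. (if l = 0 then 1 / 2 else 1) * (theta_coeff k m r (int (2 * l)) * quot k (int (2 * l)) \<tau>))"
proof -
  define F where "F a = theta_coeff k m r (int a) * quot k (int a) \<tau>" for a
  have k0: "k > 0" using k by simp
  have refl: "F (2 * k - a) = F a" if "a \<le> 2 * k" for a
    unfolding F_def using theta_coeff_reflect[OF k0, of m r "int a"] quot_reflect[OF k0, of "int a" \<tau>] that
    by (simp add: of_nat_diff)
  have "(\<Sum>a<2*k. if even (int a - r) then F a else 0) = (\<Sum>a<2*k. if even a then F a else 0)"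
    using r by (intro sum.cong) auto
  also have "\<dots> = (\<Sum>l<k. F (2 * l))" by (rule sum_even_filter)
  also have "\<dots> = F 0 + (\<Sum>l<k-1. F (2 * Suc l))"
    using sum.lessThan_Suc_shift[of "\<lambda>l. F (2 * l)" "k - 1"] k by simp
  also have "(\<Sum>l<k-1. F (2 * Suc l)) = 2 * (\<Sum>l<(k-1) div 2. F (2 * Suc l)) + (if odd (k-1) then F (2 * Suc ((k-1) div 2)) else 0)"
  proof (rule sum_palindrome)
    fix l assume l: "l < k - 1"
    then have "2 * Suc (k - 1 - 1 - l) = 2 * k - 2 * Suc l" by simp
    then show "F (2 * Suc (k - 1 - 1 - l)) = F (2 * Suc l)" using refl[of "2 * Suc l"] l by simp
  qed
  also have "(if odd (k-1) then F (2 * Suc ((k-1) div 2)) else 0) = 0"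
  proof (cases "odd (k - 1)")
    case True
    then have "2 * Suc ((k-1) div 2) = k" using k by presburger
    then show ?thesis using quot_middle[OF k0] by (simp add: F_def)
  qed simp
  also have "F 0 + (2 * (\<Sum>l<(k-1) div 2. F (2 * Suc l)) + 0) = 2 * (\<Sum>l<Suc ((k-1) div 2). (if l = 0 then 1 / 2 else 1) * F (2 * l))"
    unfolding sum.lessThan_Suc_shift by simp
  also have "Suc ((k-1) div 2) = (k + 1) div 2" using k by presburger
  finally show ?thesis unfolding F_def .
qed

text \<open>The residue 0 is not odd, and a = k, unpaired when k is odd, contributes 0; so every
  surviving residue has a partner and no weight 1/2 arises.\<close>

lemma quot_sum_odd:
  assumes k: "k \<ge> 2" and r: "odd r"
  shows "(\<Sum>a<2*k. if even (int a - r) then theta_coeff k m r (int a) * quot k (int a) \<tau> else 0)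
    = 2 * (\<Sum>l<k div 2. theta_coeff k m r (int (2 * l + 1)) * quot k (int (2 * l + 1)) \<tau>)"
proof -
  define F where "F a = theta_coeff k m r (int a) * quot k (int a) \<tau>" for a
  have k0: "k > 0" using k by simp
  have refl: "F (2 * k - a) = F a" if "a \<le> 2 * k" for a
    unfolding F_def using theta_coeff_reflect[OF k0, of m r "int a"] quot_reflect[OF k0, of "int a" \<tau>] that
    by (simp add: of_nat_diff)
  have "(\<Sum>a<2*k. if even (int a - r) then F a else 0) = (\<Sum>a<2*k. if odd a then F a else 0)"
    using r by (intro sum.cong) auto
  also have "\<dots> = (\<Sum>l<k. F (2 * l + 1))" by (rule sum_odd_filter)
  also have "\<dots> = 2 * (\<Sum>l<k div 2. F (2 * l + 1)) + (if odd k then F (2 * (k div 2) + 1) else 0)"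
  proof (rule sum_palindrome)
    fix l assume l: "l < k"
    then have "2 * (k - 1 - l) + 1 = 2 * k - (2 * l + 1)" by simp
    then show "F (2 * (k - 1 - l) + 1) = F (2 * l + 1)" using refl[of "2 * l + 1"] l by simp
  qed
  also have "(if odd k then F (2 * (k div 2) + 1) else 0) = 0"
    using quot_middle[OF k0] by (auto simp: F_def)
  finally show ?thesis unfolding F_def by simp
qed


section \<open>Transformation matrices\<close>

text \<open>With indices from 1, the exceptional column for odd k is the general one at 2 j - 1 = k
  times 1/2, so one formula covers both cases.\<close>

lemma B_mat_index:
  assumes "k \<ge> 2" "i < (k + 1) div 2" "j < (k + 1) div 2"
  shows "B_mat k $$ (i, j) = (if odd k \<and> j = k div 2 then 1 / 2 else 1) *
    of_real (cos (pi * real_of_int (int (2 * i)) * (2 * real j + 1) / real (2 * k)))"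
proof (cases "odd k \<and> j = k div 2")
  case True
  then have j: "2 * real j + 1 = real k" by (auto elim!: oddE)
  have "j + 1 = (k + 1) div 2" using True by presburger
  moreover have "pi * real_of_int (int (2 * i)) * (2 * real j + 1) / real (2 * k) = real i * pi"
    unfolding j using assms(1) by simp
  ultimately show ?thesis using True assms(2,3) by (simp add: B_mat_def mat1_def)
next
  case False
  then have "\<not> (odd k \<and> j + 1 = (k + 1) div 2)" by presburger
  moreover have "pi * real_of_int (int (2 * i)) * (2 * real j + 1) / real (2 * k) = (real (i + 1) - 1) * (2 * real (j + 1) - 1) * pi / real k"
    using assms(1) by (simp add: field_simps)
  ultimately show ?thesis using False assms(2,3) unfolding B_mat_def mat1_def by (simp only: index_mat split) auto
qed

lemma C_mat_index:
  assumes "k \<ge> 2" "j < (k + 1) div 2" "l < (k + 1) div 2"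
  shows "C_mat k $$ (j, l) = (if l = 0 then 1 / 2 else 1) *
    of_real (cos (pi * real_of_int (int (2 * l)) * (2 * real j + 1) / real (2 * k)))"
proof -
  have "pi * real_of_int (int (2 * l)) * (2 * real j + 1) / real (2 * k) = (2 * real (j + 1) - 1) * (real (l + 1) - 1) * pi / real k"
    using assms(1) by (simp add: field_simps)
  then show ?thesis using assms(2,3) unfolding C_mat_def mat1_def by (simp only: index_mat split) auto
qed

lemma A_mat_index:
  assumes "k \<ge> 2" "i < k div 2" "j < k div 2"
  shows "A_mat k $$ (i, j) = of_real (cos (pi * real_of_int (int (2 * i + 1)) * (2 * real j + 1) / real (2 * k)))"
proof -
  have "pi * real_of_int (int (2 * i + 1)) * (2 * real j + 1) / real (2 * k) = (2 * real (i + 1) - 1) * (2 * real (j + 1) - 1) * pi / (2 * real k)"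
    by (simp add: field_simps)
  then show ?thesis using assms(2,3) unfolding A_mat_def mat1_def by (simp only: index_mat split)
qed

lemma mat_carriers [simp]:
  "A_mat k \<in> carrier_mat (k div 2) (k div 2)"
  "B_mat k \<in> carrier_mat ((k + 1) div 2) ((k + 1) div 2)"
  "C_mat k \<in> carrier_mat ((k + 1) div 2) ((k + 1) div 2)"
  by (simp_all add: A_mat_def B_mat_def C_mat_def mat1_def)

lemma mat_diag_mat_mult_vec:
  fixes P Q :: "complex mat"
  assumes P: "P \<in> carrier_mat n n" and Q: "Q \<in> carrier_mat n n" and i: "i < n"
  shows "((P * mat_diag n f * Q) *\<^sub>v Matrix.vec n v) $ i = (\<Sum>l<n. (\<Sum>j<n. P $$ (i, j) * f j * Q $$ (j, l)) * v l)"
  using assms unfolding mat_diag_mult_right[OF P]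
  by (simp add: scalar_prod_def lessThan_atLeast0)

lemma mat_diag_mult_vec:
  fixes f v :: "nat \<Rightarrow> complex"
  shows "mat_diag n f *\<^sub>v Matrix.vec n v = Matrix.vec n (\<lambda>i. f i * v i)"
proof (rule eq_vecI)
  fix i assume "i < dim_vec (Matrix.vec n (\<lambda>i. f i * v i))"
  then have i: "i < n" by simp
  have "(mat_diag n f *\<^sub>v Matrix.vec n v) $ i = (\<Sum>j = 0..<n. (if i = j then f j else 0) * v j)"
    using i by (simp add: mat_diag_def scalar_prod_def)
  also have "\<dots> = (\<Sum>j = 0..<n. if i = j then f j * v j else 0)" by (intro sum.cong) auto
  also have "\<dots> = f i * v i" using i by simp
  finally show "(mat_diag n f *\<^sub>v Matrix.vec n v) $ i = Matrix.vec n (\<lambda>i. f i * v i) $ i" using i by simp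
qed (simp add: mat_diag_def)

lemma Im_transform_pos:
  assumes \<tau>: "Im \<tau> > 0"
  shows "Im (\<tau> / (4 * of_int m * \<tau> + 1)) > 0" "4 * of_int m * \<tau> + 1 \<noteq> 0"
proof -
  have \<tau>0: "\<tau> \<noteq> 0" using \<tau> by auto
  define \<sigma> where "\<sigma> = - 1 / \<tau> + of_int (- 4 * m)"
  have im: "Im \<sigma> > 0" using Im_minus_inverse_pos[OF \<tau>] by (simp add: \<sigma>_def)
  then have \<sigma>0: "\<sigma> \<noteq> 0" by auto
  have e: "4 * of_int m * \<tau> + 1 = - (\<sigma> * \<tau>)" using \<tau>0 by (simp add: \<sigma>_def field_simps)
  then show "4 * of_int m * \<tau> + 1 \<noteq> 0" using \<tau>0 \<sigma>0 by simp
  have "\<tau> / (4 * of_int m * \<tau> + 1) = - 1 / \<sigma>" unfolding e using \<tau>0 by simp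
  then show "Im (\<tau> / (4 * of_int m * \<tau> + 1)) > 0" using Im_minus_inverse_pos[OF im] by simp
qed

text \<open>Folding the residues a and folding the index j each give a factor 2, whence 4 / k. The
  sum over j becomes a matrix product with the phases on the diagonal.\<close>

lemma X0_transform:
  assumes k: "k \<ge> 2" and \<tau>: "Im \<tau> > 0"
  shows "X0 k (\<tau> / (4 * of_int m * \<tau> + 1)) = (4 / of_nat k * exp (of_real pi * \<i> * of_int m / 3)) \<cdot>\<^sub>v
     ((B_mat k * mat_diag ((k + 1) div 2) (gauss_factor k m) * C_mat k) *\<^sub>v X0 k \<tau>)"
  unfolding X0_eq[OF k \<tau>] X0_eq[OF k Im_transform_pos(1)[OF \<tau>]]
proof (rule eq_vecI)
  let ?D = "(k + 1) div 2"
  let ?q = "\<lambda>j. quot k (int (2 * j)) \<tau>"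
  let ?v = "Matrix.vec ?D ?q"
  let ?E = "exp (of_real pi * \<i> * of_int m / 3)"
  let ?W = "(4 / of_nat k * ?E) \<cdot>\<^sub>v ((B_mat k * mat_diag ?D (gauss_factor k m) * C_mat k) *\<^sub>v ?v)"
  fix i assume "i < dim_vec ?W"
  then have i: "i < ?D" using carrier_matD[OF mat_carriers(2)[of k]] by simp
  have k0: "k > 0" using k by simp
  \<comment> \<open>The half weight of the middle j belongs to B, that of l = 0 to C.\<close>
  have tc: "theta_coeff k m (int (2 * i)) (int (2 * l)) * (if l = 0 then 1 / 2 else 1)
     = 2 * (\<Sum>j<?D. B_mat k $$ (i, j) * gauss_factor k m j * C_mat k $$ (j, l))" if l: "l < ?D" for l
  proof -
    have "theta_coeff k m (int (2 * i)) (int (2 * l)) * (if l = 0 then 1 / 2 else 1)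
       = 2 * (\<Sum>j<?D. (if odd k \<and> j = k div 2 then 1 / 2 else 1) *
     (of_real (cos (pi * real_of_int (int (2 * i)) * (2 * real j + 1) / real (2 * k)) * cos (pi * real_of_int (int (2 * l)) * (2 * real j + 1) / real (2 * k))) * gauss_factor k m j)
       * (if l = 0 then 1 / 2 else 1))"
      by (subst theta_coeff_fold) (simp, simp only: mult.assoc sum_distrib_right)
    also have "\<dots> = 2 * (\<Sum>j<?D. B_mat k $$ (i, j) * gauss_factor k m j * C_mat k $$ (j, l))"
    proof (rule arg_cong[where f = "\<lambda>x. 2 * x"], rule sum.cong[OF refl])
      fix j assume "j \<in> {..<?D}"
      then have j: "j < ?D" by simp
      show "(if odd k \<and> j = k div 2 then 1 / 2 else 1) *
     (of_real (cos (pi * real_of_int (int (2 * i)) * (2 * real j + 1) / real (2 * k)) * cos (pi * real_of_int (int (2 * l)) * (2 * real j + 1) / real (2 * k))) * gauss_factor k m j)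
       * (if l = 0 then 1 / 2 else 1) = B_mat k $$ (i, j) * gauss_factor k m j * C_mat k $$ (j, l)"
        unfolding B_mat_index[OF k i j] C_mat_index[OF k j l] of_real_mult by (simp only: mult_ac)
    qed
    finally show ?thesis .
  qed
  have "quot k (int (2 * i)) (\<tau> / (4 * of_int m * \<tau> + 1)) = ?E / of_nat k *
     (2 * (\<Sum>l<?D. (if l = 0 then 1 / 2 else 1) * (theta_coeff k m (int (2 * i)) (int (2 * l)) * ?q l)))"
    unfolding quot_transform[OF k0 \<tau> eta_nonzero[OF \<tau>]] by (subst quot_sum_even[OF k]) simp_all
  also have "(\<Sum>l<?D. (if l = 0 then 1 / 2 else 1) * (theta_coeff k m (int (2 * i)) (int (2 * l)) * ?q l))
     = (\<Sum>l<?D. 2 * ((\<Sum>j<?D. B_mat k $$ (i, j) * gauss_factor k m j * C_mat k $$ (j, l)) * ?q l))"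
  proof (intro sum.cong refl)
    fix l assume "l \<in> {..<?D}"
    then have l: "l < ?D" by simp
    have "(if l = 0 then 1 / 2 else 1) * (theta_coeff k m (int (2 * i)) (int (2 * l)) * ?q l)
       = theta_coeff k m (int (2 * i)) (int (2 * l)) * (if l = 0 then 1 / 2 else 1) * ?q l" by (simp only: mult_ac)
    then show "(if l = 0 then 1 / 2 else 1) * (theta_coeff k m (int (2 * i)) (int (2 * l)) * ?q l)
      = 2 * ((\<Sum>j<?D. B_mat k $$ (i, j) * gauss_factor k m j * C_mat k $$ (j, l)) * ?q l)"
      unfolding tc[OF l] by (simp only: mult.assoc)
  qed
  also have "\<dots> = 2 * ((B_mat k * mat_diag ?D (gauss_factor k m) * C_mat k) *\<^sub>v ?v) $ i"
    by (subst mat_diag_mat_mult_vec[OF mat_carriers(2,3) i]) (rule sum_distrib_left[symmetric])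
  finally have "quot k (int (2 * i)) (\<tau> / (4 * of_int m * \<tau> + 1)) =
    4 / of_nat k * ?E * ((B_mat k * mat_diag ?D (gauss_factor k m) * C_mat k) *\<^sub>v ?v) $ i" by simp
  moreover have "i < dim_vec ((B_mat k * mat_diag ?D (gauss_factor k m) * C_mat k) *\<^sub>v ?v)"
    using i mat_carriers(2)[of k] by (metis carrier_matD(1) dim_mult_mat_vec index_mult_mat(2))
  ultimately show "Matrix.vec ?D (\<lambda>j. quot k (int (2 * j)) (\<tau> / (4 * of_int m * \<tau> + 1))) $ i = ?W $ i"
    using i by (simp only: index_smult_vec index_vec)
qed (use carrier_matD[OF mat_carriers(2)[of k]] in simp)

lemma X1_transform:
  assumes k: "k \<ge> 2" and \<tau>: "Im \<tau> > 0"
  shows "X1 k (\<tau> / (4 * of_int m * \<tau> + 1)) = (4 / of_nat k * exp (of_real pi * \<i> * of_int m / 3)) \<cdot>\<^sub>v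
     ((A_mat k * mat_diag (k div 2) (gauss_factor k m) * A_mat k) *\<^sub>v X1 k \<tau>)"
  unfolding X1_eq[OF k \<tau>] X1_eq[OF k Im_transform_pos(1)[OF \<tau>]]
proof (rule eq_vecI)
  let ?D = "k div 2"
  let ?q = "\<lambda>j. quot k (int (2 * j + 1)) \<tau>"
  let ?v = "Matrix.vec ?D ?q"
  let ?E = "exp (of_real pi * \<i> * of_int m / 3)"
  let ?W = "(4 / of_nat k * ?E) \<cdot>\<^sub>v ((A_mat k * mat_diag ?D (gauss_factor k m) * A_mat k) *\<^sub>v ?v)"
  fix i assume "i < dim_vec ?W"
  then have i: "i < ?D" using carrier_matD[OF mat_carriers(1)[of k]] by simp
  have k0: "k > 0" using k by simp
  have tc: "theta_coeff k m (int (2 * i + 1)) (int (2 * l + 1))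
     = 2 * (\<Sum>j<?D. A_mat k $$ (i, j) * gauss_factor k m j * A_mat k $$ (j, l))" if l: "l < ?D" for l
  proof -
    have "theta_coeff k m (int (2 * i + 1)) (int (2 * l + 1)) = 2 * (\<Sum>j<?D.
     of_real (cos (pi * real_of_int (int (2 * i + 1)) * (2 * real j + 1) / real (2 * k)) * cos (pi * real_of_int (int (2 * l + 1)) * (2 * real j + 1) / real (2 * k))) * gauss_factor k m j)"
      by (rule theta_coeff_fold_odd) (use k in auto)
    also have "\<dots> = 2 * (\<Sum>j<?D. A_mat k $$ (i, j) * gauss_factor k m j * A_mat k $$ (j, l))"
    proof (rule arg_cong[where f = "\<lambda>x. 2 * x"], rule sum.cong[OF refl])
      fix j assume "j \<in> {..<?D}"
      then have j: "j < ?D" by simp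
      \<comment> \<open>A is symmetric, so the cosine in which l is the row index is again the entry
        (j, l).\<close>
      have "A_mat k $$ (j, l) = of_real (cos (pi * real_of_int (int (2 * l + 1)) * (2 * real j + 1) / real (2 * k)))"
        unfolding A_mat_index[OF k j l] by (simp add: mult_ac add_ac)
      then show "of_real (cos (pi * real_of_int (int (2 * i + 1)) * (2 * real j + 1) / real (2 * k)) * cos (pi * real_of_int (int (2 * l + 1)) * (2 * real j + 1) / real (2 * k))) * gauss_factor k m j
         = A_mat k $$ (i, j) * gauss_factor k m j * A_mat k $$ (j, l)"
        unfolding A_mat_index[OF k i j] of_real_mult by (simp only: mult_ac)
    qed
    finally show ?thesis .
  qed
  have "quot k (int (2 * i + 1)) (\<tau> / (4 * of_int m * \<tau> + 1)) = ?E / of_nat k *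
     (2 * (\<Sum>l<?D. theta_coeff k m (int (2 * i + 1)) (int (2 * l + 1)) * ?q l))"
    unfolding quot_transform[OF k0 \<tau> eta_nonzero[OF \<tau>]] by (subst quot_sum_odd[OF k]) simp_all
  also have "(\<Sum>l<?D. theta_coeff k m (int (2 * i + 1)) (int (2 * l + 1)) * ?q l)
     = (\<Sum>l<?D. 2 * ((\<Sum>j<?D. A_mat k $$ (i, j) * gauss_factor k m j * A_mat k $$ (j, l)) * ?q l))"
    by (intro sum.cong refl) (simp only: tc lessThan_iff mult.assoc)
  also have "\<dots> = 2 * ((A_mat k * mat_diag ?D (gauss_factor k m) * A_mat k) *\<^sub>v ?v) $ i"
    by (subst mat_diag_mat_mult_vec[OF mat_carriers(1,1) i]) (rule sum_distrib_left[symmetric])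
  finally have "quot k (int (2 * i + 1)) (\<tau> / (4 * of_int m * \<tau> + 1)) =
    4 / of_nat k * ?E * ((A_mat k * mat_diag ?D (gauss_factor k m) * A_mat k) *\<^sub>v ?v) $ i" by simp
  moreover have "i < dim_vec ((A_mat k * mat_diag ?D (gauss_factor k m) * A_mat k) *\<^sub>v ?v)"
    using i mat_carriers(1)[of k] by (metis carrier_matD(1) dim_mult_mat_vec index_mult_mat(2))
  ultimately show "Matrix.vec ?D (\<lambda>j. quot k (int (2 * j + 1)) (\<tau> / (4 * of_int m * \<tau> + 1))) $ i = ?W $ i"
    using i by (simp only: index_smult_vec index_vec)
qed (use carrier_matD[OF mat_carriers(1)[of k]] in simp)

lemma X0_translate:
  assumes k: "k \<ge> 2" and \<tau>: "Im \<tau> > 0"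
  shows "X0 k (\<tau> + of_int b) = exp (- (of_real pi * \<i> * of_int b / 12)) \<cdot>\<^sub>v
    (mat_diag ((k + 1) div 2) (\<lambda>j. exp (of_real pi * \<i> * of_int b * (of_int (int (2 * j)))\<^sup>2 / (2 * of_nat k))) *\<^sub>v X0 k \<tau>)"
proof -
  have "Im (\<tau> + of_int b) > 0" and k0: "k > 0" using \<tau> k by simp_all
  then show ?thesis
    unfolding X0_eq[OF k \<tau>] X0_eq[OF k \<open>Im (\<tau> + of_int b) > 0\<close>] mat_diag_mult_vec quot_translate[OF k0]
    by (intro eq_vecI) (simp_all add: mult_ac)
qed

lemma X1_translate:
  assumes k: "k \<ge> 2" and \<tau>: "Im \<tau> > 0"
  shows "X1 k (\<tau> + of_int b) = exp (- (of_real pi * \<i> * of_int b / 12)) \<cdot>\<^sub>v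
    (mat_diag (k div 2) (\<lambda>j. exp (of_real pi * \<i> * of_int b * (of_int (int (2 * j + 1)))\<^sup>2 / (2 * of_nat k))) *\<^sub>v X1 k \<tau>)"
proof -
  have "Im (\<tau> + of_int b) > 0" and k0: "k > 0" using \<tau> k by simp_all
  then show ?thesis
    unfolding X1_eq[OF k \<tau>] X1_eq[OF k \<open>Im (\<tau> + of_int b) > 0\<close>] mat_diag_mult_vec quot_translate[OF k0]
    by (intro eq_vecI) (simp_all add: mult_ac)
qed

section \<open>Generation of \<open>\<Gamma>\<^sub>0(4)\<close>\<close>

lemma nearest_multiple:
  fixes c d :: int
  assumes "c \<noteq> 0"
  shows "\<exists>n. 2 * \<bar>d + c * n\<bar> \<le> \<bar>c\<bar>"
proof -
  define s where "s = d mod \<bar>c\<bar>"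
  have s: "0 \<le> s" "s < \<bar>c\<bar>" using assms by (simp_all add: s_def)
  define p where "p = d div \<bar>c\<bar>"
  have "s + \<bar>c\<bar> * p = d" unfolding s_def p_def by (rule mod_mult_div_eq)
  moreover have "\<bar>c\<bar> * p = c * (sgn c * p)" by (simp add: abs_sgn)
  ultimately obtain t where t: "s + c * t = d" by metis
  show ?thesis
  proof (cases "2 * s \<le> \<bar>c\<bar>")
    case True
    then show ?thesis using s unfolding t[symmetric] by (intro exI[of _ "- t"]) simp
  next
    case False
    have "d + c * (- t - sgn c) = s - \<bar>c\<bar>" unfolding t[symmetric] by (simp add: algebra_simps abs_sgn)
    then show ?thesis using False s by (intro exI[of _ "- t - sgn c"]) simp
  qed
qed

text \<open>Every element of \<open>\<Gamma>\<^sub>0(4)\<close> is reduced to \<open>\<plusminus>T\<^sup>n\<close> by right multiplication with powers of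
  \<open>T\<close> and \<open>U = (1, 0; 4, 1)\<close>: since \<open>d\<close> is odd and \<open>4\<close> divides \<open>c\<close>, the bounds \<open>2 \<bar>d\<bar> \<le> \<bar>c\<bar>\<close> and
  \<open>\<bar>c\<bar> \<le> 2 \<bar>d\<bar>\<close> obtained by division with remainder cannot both be equalities.\<close>

lemma Gamma0_4_induct:
  fixes a b c d :: int
  assumes det: "a * d - b * c = 1" and "4 dvd c"
    and base: "\<And>n. P 1 n 0 1" "\<And>n. P (-1) n 0 (-1)"
    and T: "\<And>a b c d n. a * d - b * c = 1 \<Longrightarrow> P a (a * n + b) c (c * n + d) \<Longrightarrow> P a b c d"
    and U: "\<And>a b c d m. a * d - b * c = 1 \<Longrightarrow> P (a + 4 * m * b) b (c + 4 * m * d) d \<Longrightarrow> P a b c d"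
  shows "P a b c d"
  using det \<open>4 dvd c\<close>
proof (induction "nat \<bar>c\<bar>" arbitrary: a b c d rule: less_induct)
  case less
  show ?case
  proof (cases "c = 0")
    case True
    then have "a * d = 1" using less.prems by simp
    then have "(a = 1 \<and> d = 1) \<or> (a = -1 \<and> d = -1)" by (auto simp: zmult_eq_1_iff)
    then show ?thesis using True base by auto
  next
    case False
    obtain n where n: "2 * \<bar>d + c * n\<bar> \<le> \<bar>c\<bar>" using nearest_multiple[OF False] by blast
    define b' d' where "b' = a * n + b" and "d' = c * n + d"
    have det': "a * d' - b' * c = 1" using less.prems(1) by (simp add: b'_def d'_def algebra_simps)
    obtain c0 where c0: "c = 4 * c0" using less.prems(2) by (elim dvdE)
    have odd: "odd d'"
    proof
      assume "even d'"
      then have "even (a * d' - b' * c)" using c0 by simp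
      then show False using det' by simp
    qed
    have lt: "2 * \<bar>d'\<bar> < \<bar>c\<bar>"
    proof -
      have "2 * \<bar>d'\<bar> \<le> \<bar>c\<bar>" using n by (simp add: d'_def add.commute)
      moreover have "2 * \<bar>d'\<bar> \<noteq> \<bar>c\<bar>"
      proof
        assume "2 * \<bar>d'\<bar> = \<bar>c\<bar>"
        then have "\<bar>d'\<bar> = 2 * \<bar>c0\<bar>" using c0 by (simp add: abs_mult)
        then have "even \<bar>d'\<bar>" by simp
        then show False using odd by simp
      qed
      ultimately show ?thesis by simp
    qed
    have "4 * d' \<noteq> 0" using odd by auto
    from nearest_multiple[OF this] obtain m where m: "2 * \<bar>c + 4 * d' * m\<bar> \<le> \<bar>4 * d'\<bar>" by blast
    define c'' a'' where "c'' = c + 4 * m * d'" and "a'' = a + 4 * m * b'"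
    have "\<bar>c''\<bar> \<le> 2 * \<bar>d'\<bar>" using m by (simp add: c''_def abs_mult mult_ac)
    then have "nat \<bar>c''\<bar> < nat \<bar>c\<bar>" using lt by simp
    moreover have "a'' * d' - b' * c'' = 1" using det' by (simp add: a''_def c''_def algebra_simps)
    moreover have "4 dvd c''" using less.prems(2) by (simp add: c''_def)
    ultimately have "P a'' b' c'' d'" by (rule less.hyps)
    then have "P a b' c d'" unfolding a''_def c''_def by (rule U[OF det'])
    then show ?thesis unfolding b'_def d'_def by (rule T[OF less.prems(1)])
  qed
qed

section \<open>From the generators to the group\<close>

lemma det_2x2:
  fixes A :: "int mat"
  assumes A: "A \<in> carrier_mat 2 2"
  shows "Determinant.det A = A $$ (0, 0) * A $$ (1, 1) - A $$ (0, 1) * A $$ (1, 0)"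
proof -
  have m: "mat_delete A 0 j \<in> carrier_mat 1 1" for j using mat_delete_carrier[OF A, of 0 j] by simp
  have "Determinant.det A = (\<Sum>j<2. A $$ (0, j) * cofactor A 0 j)"
    using laplace_expansion_row[OF A, of 0] by simp
  also have "\<dots> = A $$ (0, 0) * cofactor A 0 0 + A $$ (0, 1) * cofactor A 0 1"
    by (simp add: numeral_2_eq_2)
  also have "cofactor A 0 0 = A $$ (1, 1)"
    unfolding cofactor_def det_single[OF m] using A by (simp add: mat_delete_def)
  also have "cofactor A 0 1 = - A $$ (1, 0)"
    unfolding cofactor_def det_single[OF m] using A by (simp add: mat_delete_def)
  finally show ?thesis by simp
qed

text \<open>X (\<gamma>' (f \<tau>)) = \<rho>1 X (f \<tau>) = \<rho>1 \<rho>2 X \<tau>, so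
  \<open>P\<close> survives composition with a power of a generator, and
  \<open>Gamma0_4_induct\<close> reduces the whole group to such compositions.\<close>

theorem vv_modular_function_Gamma0_4:
  assumes car: "\<And>\<tau>. Im \<tau> > 0 \<Longrightarrow> X \<tau> \<in> carrier_vec n"
    and T: "\<And>b::int. \<exists>\<rho>\<in>carrier_mat n n. \<forall>\<tau>. Im \<tau> > 0 \<longrightarrow> X (\<tau> + of_int b) = \<rho> *\<^sub>v X \<tau>"
    and U: "\<And>m::int. \<exists>\<rho>\<in>carrier_mat n n. \<forall>\<tau>. Im \<tau> > 0 \<longrightarrow> X (\<tau> / (4 * of_int m * \<tau> + 1)) = \<rho> *\<^sub>v X \<tau>"
  shows "vv_modular_function 4 n X"
proof -
  define P where "P a b c d \<longleftrightarrow> (\<exists>\<rho>\<in>carrier_mat n n. \<forall>\<tau>. Im \<tau> > 0 \<longrightarrow>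
    X ((of_int a * \<tau> + of_int b) / (of_int c * \<tau> + of_int d)) = \<rho> *\<^sub>v X \<tau>)" for a b c d :: int
  have comp: "P a b c d"
    if p1: "P a' b' c' d'" and p2: "\<exists>\<rho>\<in>carrier_mat n n. \<forall>\<tau>. Im \<tau> > 0 \<longrightarrow> X (f \<tau>) = \<rho> *\<^sub>v X \<tau>"
      and p3: "\<And>\<tau>. Im \<tau> > 0 \<Longrightarrow> Im (f \<tau>) > 0"
      and p4: "\<And>\<tau>. Im \<tau> > 0 \<Longrightarrow> (of_int a * \<tau> + of_int b) / (of_int c * \<tau> + of_int d)
          = (of_int a' * f \<tau> + of_int b') / (of_int c' * f \<tau> + of_int d')"
    for a b c d a' b' c' d' f
  proof -
    obtain \<rho>1 where r1: "\<rho>1 \<in> carrier_mat n n" "\<And>\<tau>. Im \<tau> > 0 \<Longrightarrow>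
       X ((of_int a' * \<tau> + of_int b') / (of_int c' * \<tau> + of_int d')) = \<rho>1 *\<^sub>v X \<tau>"
      using p1 unfolding P_def by blast
    obtain \<rho>2 where r2: "\<rho>2 \<in> carrier_mat n n" "\<And>\<tau>. Im \<tau> > 0 \<Longrightarrow> X (f \<tau>) = \<rho>2 *\<^sub>v X \<tau>"
      using p2 by blast
    have "X ((of_int a * \<tau> + of_int b) / (of_int c * \<tau> + of_int d)) = (\<rho>1 * \<rho>2) *\<^sub>v X \<tau>" if "Im \<tau> > 0" for \<tau>
      unfolding p4[OF that] r1(2)[OF p3[OF that]] r2(2)[OF that]
      using r1(1) r2(1) car[OF that] by simp
    then show ?thesis unfolding P_def using r1(1) r2(1) by (intro bexI[of _ "\<rho>1 * \<rho>2"]) auto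
  qed
  have main: "P a b c d" if "a * d - b * c = 1" "4 dvd c" for a b c d
    using that
  proof (rule Gamma0_4_induct[where P = P])
    show "P 1 n 0 1" for n using T[of n] by (simp add: P_def)
    \<comment> \<open>The matrix -1 acts trivially: (-\<tau> + n) / (-1) = \<tau> - n.\<close>
    show "P (-1) n 0 (-1)" for n using T[of "-n"] by (simp add: P_def)
    fix a b c d m :: int assume det: "a * d - b * c = 1"
    show "P a b c d" if "P a (a * m + b) c (c * m + d)"
    \<comment> \<open>The given matrix is \<gamma> T^m, so f is the translation by -m that undoes
      the factor T^m.\<close>
    proof (rule comp[OF that T[of "-m"]])
      fix \<tau> :: complex assume "Im \<tau> > 0"
      then show "Im (\<tau> + of_int (- m)) > 0" by simp
      show "(of_int a * \<tau> + of_int b) / (of_int c * \<tau> + of_int d) =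
         (of_int a * (\<tau> + of_int (- m)) + of_int (a * m + b)) / (of_int c * (\<tau> + of_int (- m)) + of_int (c * m + d))"
        by (simp add: algebra_simps)
    qed
    show "P a b c d" if "P (a + 4 * m * b) b (c + 4 * m * d) d"
    proof (rule comp[OF that U[of "-m"]])
      fix \<tau> :: complex assume \<tau>: "Im \<tau> > 0"
      show "Im (\<tau> / (4 * of_int (- m) * \<tau> + 1)) > 0" by (rule Im_transform_pos(1)[OF \<tau>])
      define w where "w = 4 * of_int (- m) * \<tau> + 1"
      have w: "w \<noteq> 0" unfolding w_def by (rule Im_transform_pos(2)[OF \<tau>])
      \<comment> \<open>Numerator and denominator of \<gamma> U^m at \<tau> / w share the factor 1 /
        w, which cancels in their quotient.\<close>
      have *: "of_int (x + 4 * m * y) * (\<tau> / w) + of_int y = (of_int x * \<tau> + of_int y) / w" for x y :: int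
      proof -
        have "of_int (x + 4 * m * y) * \<tau> + of_int y * w = of_int x * \<tau> + of_int y"
          by (simp add: w_def algebra_simps)
        then show ?thesis using w by (simp add: field_simps)
      qed
      show "(of_int a * \<tau> + of_int b) / (of_int c * \<tau> + of_int d) =
         (of_int (a + 4 * m * b) * (\<tau> / (4 * of_int (- m) * \<tau> + 1)) + of_int b) /
         (of_int (c + 4 * m * d) * (\<tau> / (4 * of_int (- m) * \<tau> + 1)) + of_int d)"
        unfolding w_def[symmetric] * using w by simp
    qed
  qed
  show ?thesis
    unfolding vv_modular_function_def
  proof (intro conjI allI impI ballI)
    fix \<gamma> assume "\<gamma> \<in> Gamma0 4"
    then have g: "\<gamma> \<in> carrier_mat 2 2" "Determinant.det \<gamma> = 1" "4 dvd \<gamma> $$ (1, 0)" by (auto simp: Gamma0_def)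
    have "P (\<gamma> $$ (0, 0)) (\<gamma> $$ (0, 1)) (\<gamma> $$ (1, 0)) (\<gamma> $$ (1, 1))"
      using g(2) unfolding det_2x2[OF g(1)] by (rule main) (rule g(3))
    then show "\<exists>\<rho>\<in>carrier_mat n n. \<forall>\<tau>. 0 < Im \<tau> \<longrightarrow> X (moeb_act \<gamma> \<tau>) = \<rho> *\<^sub>v X \<tau>"
      unfolding P_def moeb_act_def moebius_def .
  qed (use car in auto)
qed

theorem corollary1p6:
  fixes k :: nat
  assumes "k \<ge> 2"
  shows
    "(\<forall>\<tau>::complex. Im \<tau> > 0 \<longrightarrow>
        X0 k (\<tau> + 1) = exp (- (1 / 12) * of_real pi * \<i>) \<cdot>\<^sub>v
          (mat_diag (dim0 k) (\<lambda>j. exp (of_real ((2 * real j)\<^sup>2 / (2 * real k) * pi) * \<i>)) *\<^sub>v X0 k \<tau>) \<and>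
        X1 k (\<tau> + 1) = exp (- (1 / 12) * of_real pi * \<i>) \<cdot>\<^sub>v
          (mat_diag (dim1 k) (\<lambda>j. exp (of_real ((2 * real j + 1)\<^sup>2 / (2 * real k) * pi) * \<i>)) *\<^sub>v X1 k \<tau>) \<and>
        X0 k (\<tau> / (4 * \<tau> + 1)) = (4 / of_nat k * exp (of_real pi * \<i> / 3)) \<cdot>\<^sub>v
          ((B_mat k * Lambda'_mat k * C_mat k) *\<^sub>v X0 k \<tau>) \<and>
        X1 k (\<tau> / (4 * \<tau> + 1)) = (4 / of_nat k * exp (of_real pi * \<i> / 3)) \<cdot>\<^sub>v
          ((A_mat k * the (mat_inverse (Lambda_mat k)) * A_mat k) *\<^sub>v X1 k \<tau>)) \<and>
     vv_modular_function 4 (dim0 k) (X0 k) \<and>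
     vv_modular_function 4 (dim1 k) (X1 k)"
proof -
  note k = assms
  have D: "dim0 k = (k + 1) div 2" "dim1 k = k div 2" "(t'_idx k + 1) div 2 = (k + 1) div 2"
    using dim0_eq[OF k] dim1_eq[OF k] dim'_eq[OF k] by auto
  have e12: "exp (- (of_real pi * \<i> * of_int 1 / 12)) = exp (- (1 / 12) * of_real pi * \<i>)" by simp
  have d0: "(\<lambda>j. exp (of_real pi * \<i> * of_int 1 * (of_int (int (2 * j)))\<^sup>2 / (2 * of_nat k)))
      = (\<lambda>j. exp (of_real ((2 * real j)\<^sup>2 / (2 * real k) * pi) * \<i>))"
    by (intro ext arg_cong[where f = exp]) (simp add: field_simps)
  have d1: "(\<lambda>j. exp (of_real pi * \<i> * of_int 1 * (of_int (int (2 * j + 1)))\<^sup>2 / (2 * of_nat k)))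
      = (\<lambda>j. exp (of_real ((2 * real j + 1)\<^sup>2 / (2 * real k) * pi) * \<i>))"
    by (intro ext arg_cong[where f = exp]) (simp add: field_simps)
  \<comment> \<open>At m = 1 the phases are the inverses of those in \<Lambda>, so one diagonal
    serves both laws, cut at length (k + 1) div 2 for even r and k div 2 for odd r.\<close>
  have L': "Lambda'_mat k = mat_diag ((k + 1) div 2) (gauss_factor k 1)"
    unfolding Lambda'_mat_def D
    by (intro arg_cong[where f = "mat_diag _"] ext arg_cong[where f = exp]) (simp add: field_simps)
  have L: "the (mat_inverse (Lambda_mat k)) = mat_diag (k div 2) (gauss_factor k 1)"
    unfolding mat_inverse_Lambda option.sel D
    by (intro arg_cong[where f = "mat_diag _"] ext arg_cong[where f = exp]) (simp add: field_simps)
  have main: "X0 k (\<tau> + 1) = exp (- (1 / 12) * of_real pi * \<i>) \<cdot>\<^sub>v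
          (mat_diag (dim0 k) (\<lambda>j. exp (of_real ((2 * real j)\<^sup>2 / (2 * real k) * pi) * \<i>)) *\<^sub>v X0 k \<tau>) \<and>
        X1 k (\<tau> + 1) = exp (- (1 / 12) * of_real pi * \<i>) \<cdot>\<^sub>v
          (mat_diag (dim1 k) (\<lambda>j. exp (of_real ((2 * real j + 1)\<^sup>2 / (2 * real k) * pi) * \<i>)) *\<^sub>v X1 k \<tau>) \<and>
        X0 k (\<tau> / (4 * \<tau> + 1)) = (4 / of_nat k * exp (of_real pi * \<i> / 3)) \<cdot>\<^sub>v
          ((B_mat k * Lambda'_mat k * C_mat k) *\<^sub>v X0 k \<tau>) \<and>
        X1 k (\<tau> / (4 * \<tau> + 1)) = (4 / of_nat k * exp (of_real pi * \<i> / 3)) \<cdot>\<^sub>v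
          ((A_mat k * the (mat_inverse (Lambda_mat k)) * A_mat k) *\<^sub>v X1 k \<tau>)" if \<tau>: "Im \<tau> > 0" for \<tau>
  proof (intro conjI)
    show "X0 k (\<tau> + 1) = exp (- (1 / 12) * of_real pi * \<i>) \<cdot>\<^sub>v
          (mat_diag (dim0 k) (\<lambda>j. exp (of_real ((2 * real j)\<^sup>2 / (2 * real k) * pi) * \<i>)) *\<^sub>v X0 k \<tau>)"
      using X0_translate[OF k \<tau>, of 1] unfolding e12 d0 unfolding D of_int_1 .
    show "X1 k (\<tau> + 1) = exp (- (1 / 12) * of_real pi * \<i>) \<cdot>\<^sub>v
          (mat_diag (dim1 k) (\<lambda>j. exp (of_real ((2 * real j + 1)\<^sup>2 / (2 * real k) * pi) * \<i>)) *\<^sub>v X1 k \<tau>)"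
      using X1_translate[OF k \<tau>, of 1] unfolding e12 d1 unfolding D of_int_1 .
    show "X0 k (\<tau> / (4 * \<tau> + 1)) = (4 / of_nat k * exp (of_real pi * \<i> / 3)) \<cdot>\<^sub>v
          ((B_mat k * Lambda'_mat k * C_mat k) *\<^sub>v X0 k \<tau>)"
      using X0_transform[OF k \<tau>, of 1] unfolding L'[symmetric] unfolding of_int_1 mult_1_right .
    show "X1 k (\<tau> / (4 * \<tau> + 1)) = (4 / of_nat k * exp (of_real pi * \<i> / 3)) \<cdot>\<^sub>v
          ((A_mat k * the (mat_inverse (Lambda_mat k)) * A_mat k) *\<^sub>v X1 k \<tau>)"
      using X1_transform[OF k \<tau>, of 1] unfolding L[symmetric] unfolding of_int_1 mult_1_right .
  qed
  have smult: "\<exists>\<rho>\<in>carrier_mat n n. \<forall>\<tau>. Im \<tau> > 0 \<longrightarrow> X (f \<tau>) = \<rho> *\<^sub>v X \<tau>"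
    if "M \<in> carrier_mat n n" "\<And>\<tau>. Im \<tau> > 0 \<Longrightarrow> X \<tau> \<in> carrier_vec n"
      "\<And>\<tau>. Im \<tau> > 0 \<Longrightarrow> X (f \<tau>) = x \<cdot>\<^sub>v (M *\<^sub>v X \<tau>)"
    for n x f and M :: "complex mat" and X :: "complex \<Rightarrow> complex vec"
  proof (intro bexI[of _ "x \<cdot>\<^sub>m M"] allI impI)
    fix \<tau> :: complex assume \<tau>: "Im \<tau> > 0"
    show "X (f \<tau>) = x \<cdot>\<^sub>m M *\<^sub>v X \<tau>"
      unfolding that(3)[OF \<tau>] using that(1) that(2)[OF \<tau>] by (intro eq_vecI) auto
  qed (use that(1) in simp)
  have car0: "X0 k \<tau> \<in> carrier_vec ((k + 1) div 2)" if "Im \<tau> > 0" for \<tau>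
    unfolding X0_eq[OF k that] by simp
  have car1: "X1 k \<tau> \<in> carrier_vec (k div 2)" if "Im \<tau> > 0" for \<tau>
    unfolding X1_eq[OF k that] by simp
  have "vv_modular_function 4 (dim0 k) (X0 k)" unfolding D
  proof (rule vv_modular_function_Gamma0_4[OF car0])
    show "\<exists>\<rho>\<in>carrier_mat ((k + 1) div 2) ((k + 1) div 2). \<forall>\<tau>. Im \<tau> > 0 \<longrightarrow> X0 k (\<tau> + of_int b) = \<rho> *\<^sub>v X0 k \<tau>" for b
      by (rule smult[where X = "X0 k" and f = "\<lambda>\<tau>. \<tau> + of_int b", OF mat_diag_dim car0 X0_translate[OF k]])
    show "\<exists>\<rho>\<in>carrier_mat ((k + 1) div 2) ((k + 1) div 2). \<forall>\<tau>. Im \<tau> > 0 \<longrightarrow> X0 k (\<tau> / (4 * of_int m * \<tau> + 1)) = \<rho> *\<^sub>v X0 k \<tau>" for m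
      by (rule smult[where X = "X0 k" and f = "\<lambda>\<tau>. \<tau> / (4 * of_int m * \<tau> + 1)", OF _ car0 X0_transform[OF k]])
        (intro mult_carrier_mat[of _ "(k + 1) div 2" "(k + 1) div 2"] mat_diag_dim mat_carriers)
  qed
  moreover have "vv_modular_function 4 (dim1 k) (X1 k)" unfolding D
  proof (rule vv_modular_function_Gamma0_4[OF car1])
    show "\<exists>\<rho>\<in>carrier_mat (k div 2) (k div 2). \<forall>\<tau>. Im \<tau> > 0 \<longrightarrow> X1 k (\<tau> + of_int b) = \<rho> *\<^sub>v X1 k \<tau>" for b
      by (rule smult[where X = "X1 k" and f = "\<lambda>\<tau>. \<tau> + of_int b", OF mat_diag_dim car1 X1_translate[OF k]])
    show "\<exists>\<rho>\<in>carrier_mat (k div 2) (k div 2). \<forall>\<tau>. Im \<tau> > 0 \<longrightarrow> X1 k (\<tau> / (4 * of_int m * \<tau> + 1)) = \<rho> *\<^sub>v X1 k \<tau>" for m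
      by (rule smult[where X = "X1 k" and f = "\<lambda>\<tau>. \<tau> / (4 * of_int m * \<tau> + 1)", OF _ car1 X1_transform[OF k]])
        (intro mult_carrier_mat[of _ "k div 2" "k div 2"] mat_diag_dim mat_carriers)
  qed
  ultimately show ?thesis using main by blast
qed

end
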